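(* Let $\phi$ be an inner function and let $P_\phi$ be the orthogonal projection of $H^2$ onto $\phi H^2$. Then the space $\mathcal{H}(P_\phi)$ satisfies the FCKF; that is, every Bessel sequence of normalized kernel functions in $\mathcal{H}(P_\phi)$ can be partitioned into finitely many Riesz basic sequences.
   Context: $\mathbb{D}$ is the open unit disk in $\mathbb{C}$ and $H^2$ is the Hardy space on $\mathbb{D}$, a reproducing kernel Hilbert space with kernel $K(z,w)=\frac{1}{1-z\bar w}$. For a positive contraction $P\in B(H^2)$, $\mathcal{H}(P)$ denotes the range of $P^{1/2}$ equipped with the norm $\|y\|_P=\|x\|_{H^2}$, where $x$ is the unique vector in $(\ker P^{1/2})^\perp$ with $y=P^{1/2}x$. It is a reproducing kernel Hilbert space on $\mathbb{D}$. When $P$ is an orthogonal projection, $\mathcal{H}(P)$ is just the range of $P$ with the $H^2$ norm. The kernel function of $\mathcal{H}(P)$ at $w\in\mathbb{D}$ is denoted $k^P_w$ (so $f(w)=\langle f,k^P_w\rangle_P$ for $f\in\mathcal{H}(P)$, and $k^P_w=Pk_w$ where $k_w(z)=K(z,w)$); whenever $k^P_w\ne0$, the normalized kernel function is $\widetilde{k}^P_w=k^P_w/\|k^P_w\|_P$. A countable indexed family $\{f_i\}_{i\in J}$ in a Hilbert space $\mathcal{H}$ is a Bessel sequence if there is $B>0$ with $\sum_{i\in J}|\langle x,f_i\rangle|^2\le B\|x\|^2$ for all $x\in\mathcal{H}$. It is a Riesz basis for a Hilbert space $\mathcal{K}$ if there are an orthonormal basis $\{u_i\}_{i\in J}$ of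 $\mathcal{K}$ and an invertible $S\in B(\mathcal{K})$ with $Su_i=f_i$ for all $i$; it is a Riesz basic sequence if it is a Riesz basis for the closure of its linear span. A family $\{f_i\}_{i\in J}$ can be partitioned into finitely many Riesz basic sequences if there is a finite partition $J=A_1\cup\dots\cup A_n$ such that each $\{f_i\}_{i\in A_m}$ is a Riesz basic sequence. *)

theory Defs
  imports "HOL-Complex_Analysis.Complex_Analysis" "HOL-Library.Disjoint_Sets"
begin

section \<open>Hilbert spaces of functions\<close>

text \<open>
  A Hilbert space of complex functions is given by its set of vectors and its inner product
  (linear in the first argument), with the pointwise vector space operations. A function on the
  unit disk is represented by its extension by 0 to the whole plane, so that equality of vectors
  is equality in HOL.
\<close>

record fspace =
  vectors :: "(complex \<Rightarrow> complex) set"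
  cinner :: "(complex \<Rightarrow> complex) \<Rightarrow> (complex \<Rightarrow> complex) \<Rightarrow> complex"

definition hnorm :: "fspace \<Rightarrow> (complex \<Rightarrow> complex) \<Rightarrow> real" where
  "hnorm H f = sqrt (Re (cinner H f f))"

definition lin_span :: "'i set \<Rightarrow> ('i \<Rightarrow> complex \<Rightarrow> complex) \<Rightarrow> (complex \<Rightarrow> complex) set" where
  "lin_span J f = {(\<lambda>z. \<Sum>i\<in>I. c i * f i z) | I c. finite I \<and> I \<subseteq> J}"

definition hclosure :: "fspace \<Rightarrow> (complex \<Rightarrow> complex) set \<Rightarrow> (complex \<Rightarrow> complex) set" where
  "hclosure H M = {g \<in> vectors H. \<forall>e>0. \<exists>h\<in>M. hnorm H (\<lambda>z. g z - h z) < e}"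

definition bounded_op ::
    "fspace \<Rightarrow> ((complex \<Rightarrow> complex) \<Rightarrow> (complex \<Rightarrow> complex)) \<Rightarrow> bool" where
  "bounded_op H T \<longleftrightarrow>
     (\<forall>f\<in>vectors H. T f \<in> vectors H) \<and>
     (\<forall>f\<in>vectors H. \<forall>g\<in>vectors H. T (\<lambda>z. f z + g z) = (\<lambda>z. T f z + T g z)) \<and>
     (\<forall>c. \<forall>f\<in>vectors H. T (\<lambda>z. c * f z) = (\<lambda>z. c * T f z)) \<and>
     (\<exists>C. \<forall>f\<in>vectors H. hnorm H (T f) \<le> C * hnorm H f)"

definition invertible_op ::
    "fspace \<Rightarrow> ((complex \<Rightarrow> complex) \<Rightarrow> (complex \<Rightarrow> complex)) \<Rightarrow> bool" where
  "invertible_op H S \<longleftrightarrow>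
     bounded_op H S \<and>
     (\<exists>T. bounded_op H T \<and> (\<forall>f\<in>vectors H. T (S f) = f \<and> S (T f) = f))"

definition positive_op ::
    "fspace \<Rightarrow> ((complex \<Rightarrow> complex) \<Rightarrow> (complex \<Rightarrow> complex)) \<Rightarrow> bool" where
  "positive_op H T \<longleftrightarrow>
     bounded_op H T \<and> (\<forall>f\<in>vectors H. cinner H (T f) f \<in> \<real>\<^sub>\<ge>\<^sub>0)"

text \<open>
  Operators matter only on the vectors of the space; extensionality makes the positive square
  root unique as a HOL function.
\<close>

definition op_sqrt ::
    "fspace \<Rightarrow> ((complex \<Rightarrow> complex) \<Rightarrow> (complex \<Rightarrow> complex))
     \<Rightarrow> ((complex \<Rightarrow> complex) \<Rightarrow> (complex \<Rightarrow> complex))" where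
  "op_sqrt H P =
     (THE Q. Q \<in> extensional (vectors H) \<and> positive_op H Q \<and>
             (\<forall>f\<in>vectors H. Q (Q f) = P f))"

definition orth_proj ::
    "fspace \<Rightarrow> (complex \<Rightarrow> complex) set \<Rightarrow> ((complex \<Rightarrow> complex) \<Rightarrow> (complex \<Rightarrow> complex))" where
  "orth_proj H M f =
     (THE g. g \<in> M \<and> (\<forall>h\<in>M. cinner H (\<lambda>z. f z - g z) h = 0))"

definition orthonormal_basis ::
    "fspace \<Rightarrow> 'i set \<Rightarrow> ('i \<Rightarrow> complex \<Rightarrow> complex) \<Rightarrow> bool" where
  "orthonormal_basis H J u \<longleftrightarrow>
     (\<forall>i\<in>J. u i \<in> vectors H) \<and>
     (\<forall>i\<in>J. \<forall>j\<in>J. cinner H (u i) (u j) = (if i = j then 1 else 0)) \<and>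
     hclosure H (lin_span J u) = vectors H"

definition bessel_sequence ::
    "fspace \<Rightarrow> 'i set \<Rightarrow> ('i \<Rightarrow> complex \<Rightarrow> complex) \<Rightarrow> bool" where
  "bessel_sequence H J f \<longleftrightarrow>
     countable J \<and> (\<forall>i\<in>J. f i \<in> vectors H) \<and>
     (\<exists>B>0. \<forall>x\<in>vectors H.
        (\<lambda>i. (cmod (cinner H x (f i)))\<^sup>2) summable_on J \<and>
        (\<Sum>\<^sub>\<infinity>i\<in>J. (cmod (cinner H x (f i)))\<^sup>2) \<le> B * (hnorm H x)\<^sup>2)"

definition riesz_basis ::
    "fspace \<Rightarrow> 'i set \<Rightarrow> ('i \<Rightarrow> complex \<Rightarrow> complex) \<Rightarrow> bool" where
  "riesz_basis K J f \<longleftrightarrow>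
     (\<exists>u S. orthonormal_basis K J u \<and> invertible_op K S \<and> (\<forall>i\<in>J. S (u i) = f i))"

definition riesz_basic_sequence ::
    "fspace \<Rightarrow> 'i set \<Rightarrow> ('i \<Rightarrow> complex \<Rightarrow> complex) \<Rightarrow> bool" where
  "riesz_basic_sequence H J f \<longleftrightarrow>
     (\<forall>i\<in>J. f i \<in> vectors H) \<and>
     riesz_basis (H\<lparr>vectors := hclosure H (lin_span J f)\<rparr>) J f"

section \<open>Kernel functions and the FCKF\<close>

definition kernel_fun :: "fspace \<Rightarrow> complex \<Rightarrow> complex \<Rightarrow> complex" where
  "kernel_fun H w = (THE k. k \<in> vectors H \<and> (\<forall>f\<in>vectors H. f w = cinner H f k))"

definition normalized_kernel :: "fspace \<Rightarrow> complex \<Rightarrow> complex \<Rightarrow> complex" where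
  "normalized_kernel H w = (\<lambda>z. kernel_fun H w z / of_real (hnorm H (kernel_fun H w)))"

text \<open>
  The \<open>itself\<close> argument is the type of the indices of the families. The points
  \<open>w i\<close> may repeat.
\<close>

definition satisfies_FCKF :: "'i itself \<Rightarrow> fspace \<Rightarrow> bool" where
  "satisfies_FCKF _ H \<longleftrightarrow>
     (\<forall>(J :: 'i set) w.
        (\<forall>i\<in>J. w i \<in> ball 0 1 \<and> kernel_fun H (w i) \<noteq> (\<lambda>z. 0)) \<longrightarrow>
        bessel_sequence H J (\<lambda>i. normalized_kernel H (w i)) \<longrightarrow>
        (\<exists>\<A>. finite \<A> \<and> partition_on J \<A> \<and>
             (\<forall>A\<in>\<A>. riesz_basic_sequence H A (\<lambda>i. normalized_kernel H (w i)))))"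

section \<open>The Hardy space and the spaces \<open>\<H>(P)\<close>\<close>

definition taylor_coeff :: "(complex \<Rightarrow> complex) \<Rightarrow> nat \<Rightarrow> complex" where
  "taylor_coeff f n = (deriv ^^ n) f 0 / fact n"

definition H2 :: fspace where
  "H2 = \<lparr> vectors = {f. f holomorphic_on ball 0 1 \<and> (\<forall>z. z \<notin> ball 0 1 \<longrightarrow> f z = 0) \<and>
                     summable (\<lambda>n. (cmod (taylor_coeff f n))\<^sup>2)},
          cinner = (\<lambda>f g. \<Sum>n. taylor_coeff f n * cnj (taylor_coeff g n)) \<rparr>"

text \<open>
  The space \<open>\<H>(P)\<close>: the range of the square root \<open>Q\<close> of \<open>P\<close>,
  normed so that \<open>Q\<close> maps the orthogonal complement of its kernel isometrically
  onto it. The inner product below is the one inducing this norm.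
\<close>

definition range_preimage ::
    "((complex \<Rightarrow> complex) \<Rightarrow> (complex \<Rightarrow> complex)) \<Rightarrow> (complex \<Rightarrow> complex) \<Rightarrow> (complex \<Rightarrow> complex)" where
  "range_preimage Q y =
     (THE x. x \<in> vectors H2 \<and> Q x = y \<and>
             (\<forall>g\<in>vectors H2. Q g = (\<lambda>z. 0) \<longrightarrow> cinner H2 x g = 0))"

definition HP :: "((complex \<Rightarrow> complex) \<Rightarrow> (complex \<Rightarrow> complex)) \<Rightarrow> fspace" where
  "HP P =
     \<lparr> vectors = op_sqrt H2 P ` vectors H2,
       cinner = (\<lambda>y y'. cinner H2 (range_preimage (op_sqrt H2 P) y)
                                  (range_preimage (op_sqrt H2 P) y')) \<rparr>"

text \<open>
  Inner functions: bounded holomorphic functions on the disk whose radial limits exist and have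
  modulus 1 almost everywhere on the circle. Values outside the disk are irrelevant.
\<close>

definition inner_function :: "(complex \<Rightarrow> complex) \<Rightarrow> bool" where
  "inner_function \<phi> \<longleftrightarrow>
     \<phi> holomorphic_on ball 0 1 \<and> bounded (\<phi> ` ball 0 1) \<and>
     (AE t in lborel. t \<in> {0..2*pi} \<longrightarrow>
        (\<exists>l. cmod l = 1 \<and> ((\<lambda>r. \<phi> (of_real r * cis t)) \<longlongrightarrow> l) (at_left 1)))"

definition P_inner ::
    "(complex \<Rightarrow> complex) \<Rightarrow> ((complex \<Rightarrow> complex) \<Rightarrow> (complex \<Rightarrow> complex))" where
  "P_inner \<phi> = orth_proj H2 ((\<lambda>f z. \<phi> z * f z) ` vectors H2)"

end

theory Submission
  imports Defs
begin


text \<open>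
  Multiplication by \<open>\<phi>\<close> is an isometry of the Hardy space, so the normalized kernels of
  \<open>\<phi> H\<^sup>2\<close> are, up to unimodular factors, the isometric images of the normalized Szego kernels.
  Their Gram matrix \<open>G\<close> satisfies \<open>\<bar>G i j\<bar>\<^sup>2 = 1 - \<rho>(w i, w j)\<^sup>2\<close> with the pseudohyperbolic
  distance \<open>\<rho>\<close>. Testing the Bessel inequality on the kernels bounds the row sums of
  \<open>\<bar>G i j\<bar>\<^sup>2\<close> by \<open>B\<close>, so the graph of pairs with \<open>\<bar>G i j\<bar>\<^sup>2 > 1/2\<close> has bounded degree and
  finitely many colours suffice. Inside a colour class the row sums give Carleson's condition
  \<open>\<Prod>j. \<rho>(w i, w j)\<^sup>2 \<ge> exp (- 2 * B)\<close>. Finally, the inverse of a finite Gram matrix is its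
  complex conjugate, scaled by values of Blaschke products, so the Bessel bound for the kernels
  is also, up to Carleson's constant, a bound for the inverse: this is the lower Riesz bound.
\<close>

section \<open>Geometry of function spaces\<close>

text \<open>A Riesz basic sequence is defined through operators on an infinite-dimensional closed
  span, while every estimate here concerns finite sums. The proof therefore aims at two
  inequalities, uniform over finite index sets, between the norm of the coefficients and the norm of
  the linear combination. Gram-Schmidt and extension by density turn them into an orthonormal basis
  and an invertible operator. The threshold 1/2 comes from 1 - x \<ge> exp (- 2 * x) on [0, 1/2],
  which converts a bound for a sum of squared Gram entries into one for a product. Repeated points
  are covered as well: their Gram entry has modulus 1, so they are adjacent in the graph and fall
  into different classes. The isometry is where two descriptions meet: \<open>H2\<close> is given by
  Taylor coefficients, inner functions by radial limits. Parseval's identity on circles of radius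
  below 1 connects them; boundary values are taken only of \<phi> and of polynomials, and density
  does the rest. Spaces are records with an explicit carrier, so a closed span is the same record
  with another \<open>vectors\<close> field.\<close>

locale inner_fspace =
  fixes H :: fspace
  assumes zero_mem [simp]: "(\<lambda>z. 0) \<in> vectors H"
    and add_mem [simp]: "\<lbrakk>f \<in> vectors H; g \<in> vectors H\<rbrakk> \<Longrightarrow> (\<lambda>z. f z + g z) \<in> vectors H"
    and scale_mem [simp]: "f \<in> vectors H \<Longrightarrow> (\<lambda>z. c * f z) \<in> vectors H"
    and cinner_add_left:
      "\<lbrakk>f \<in> vectors H; g \<in> vectors H; h \<in> vectors H\<rbrakk>
        \<Longrightarrow> cinner H (\<lambda>z. f z + g z) h = cinner H f h + cinner H g h"
    and cinner_scale_left:
      "\<lbrakk>f \<in> vectors H; h \<in> vectors H\<rbrakk> \<Longrightarrow> cinner H (\<lambda>z. c * f z) h = c * cinner H f h"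
    and cinner_commute:
      "\<lbrakk>f \<in> vectors H; g \<in> vectors H\<rbrakk> \<Longrightarrow> cinner H f g = cnj (cinner H g f)"
    and cinner_self_nonneg: "f \<in> vectors H \<Longrightarrow> 0 \<le> Re (cinner H f f)"
    and cinner_self_eq_0: "\<lbrakk>f \<in> vectors H; cinner H f f = 0\<rbrakk> \<Longrightarrow> f = (\<lambda>z. 0)"
begin

lemma cinner_zero_left [simp]: "h \<in> vectors H \<Longrightarrow> cinner H (\<lambda>z. 0) h = 0"
  using cinner_scale_left[of "\<lambda>z. 0" h 0] by simp

lemma cinner_zero_right [simp]: "h \<in> vectors H \<Longrightarrow> cinner H h (\<lambda>z. 0) = 0"
  using cinner_commute[of h "\<lambda>z. 0"] by simp

lemma minus_mem [simp]: "f \<in> vectors H \<Longrightarrow> (\<lambda>z. - f z) \<in> vectors H"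
  using scale_mem[of f "-1"] by simp

lemma diff_mem [simp]: "\<lbrakk>f \<in> vectors H; g \<in> vectors H\<rbrakk> \<Longrightarrow> (\<lambda>z. f z - g z) \<in> vectors H"
  using add_mem[of f "\<lambda>z. - g z"] by simp

lemma cinner_diff_left:
  "\<lbrakk>f \<in> vectors H; g \<in> vectors H; h \<in> vectors H\<rbrakk>
    \<Longrightarrow> cinner H (\<lambda>z. f z - g z) h = cinner H f h - cinner H g h"
  using cinner_add_left[of f "\<lambda>z. (-1) * g z" h] cinner_scale_left[of g h "-1"]
    scale_mem[of g "-1"]
  by simp

lemma cinner_add_right:
  "\<lbrakk>f \<in> vectors H; g \<in> vectors H; h \<in> vectors H\<rbrakk>
    \<Longrightarrow> cinner H h (\<lambda>z. f z + g z) = cinner H h f + cinner H h g"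
  using cinner_commute[of h "\<lambda>z. f z + g z"] cinner_add_left[of f g h]
    cinner_commute[of h f] cinner_commute[of h g]
  by simp

lemma cinner_scale_right:
  "\<lbrakk>f \<in> vectors H; h \<in> vectors H\<rbrakk> \<Longrightarrow> cinner H h (\<lambda>z. c * f z) = cnj c * cinner H h f"
  using cinner_commute[of h "\<lambda>z. c * f z"] cinner_scale_left[of f h c] cinner_commute[of h f]
  by simp

lemma cinner_diff_right:
  "\<lbrakk>f \<in> vectors H; g \<in> vectors H; h \<in> vectors H\<rbrakk>
    \<Longrightarrow> cinner H h (\<lambda>z. f z - g z) = cinner H h f - cinner H h g"
  using cinner_commute[of h "\<lambda>z. f z - g z"] cinner_diff_left[of f g h]
    cinner_commute[of h f] cinner_commute[of h g]
  by simp

lemma sum_mem [simp]: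
  assumes "\<And>i. i \<in> I \<Longrightarrow> f i \<in> vectors H"
  shows "(\<lambda>z. \<Sum>i\<in>I. c i * f i z) \<in> vectors H"
  using assms
proof (induction I rule: infinite_finite_induct)
  case (insert i I)
  then have "(\<lambda>z. c i * f i z + (\<Sum>i\<in>I. c i * f i z)) \<in> vectors H"
    by (intro add_mem scale_mem) auto
  then show ?case using insert.hyps by simp
qed auto

lemma cinner_sum_left:
  assumes "\<And>i. i \<in> I \<Longrightarrow> f i \<in> vectors H" "h \<in> vectors H"
  shows "cinner H (\<lambda>z. \<Sum>i\<in>I. c i * f i z) h = (\<Sum>i\<in>I. c i * cinner H (f i) h)"
  using assms(1)
proof (induction I rule: infinite_finite_induct)
  case (insert i I)
  then have "cinner H (\<lambda>z. c i * f i z + (\<Sum>i\<in>I. c i * f i z)) h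
      = c i * cinner H (f i) h + (\<Sum>i\<in>I. c i * cinner H (f i) h)"
    using assms(2) by (subst cinner_add_left) (auto simp: cinner_scale_left)
  then show ?case using insert.hyps by simp
qed (use assms(2) in auto)

lemma cinner_sum_right:
  assumes "\<And>i. i \<in> I \<Longrightarrow> f i \<in> vectors H" "h \<in> vectors H"
  shows "cinner H h (\<lambda>z. \<Sum>i\<in>I. c i * f i z) = (\<Sum>i\<in>I. cnj (c i) * cinner H h (f i))"
proof -
  have "cinner H h (\<lambda>z. \<Sum>i\<in>I. c i * f i z) = cnj (\<Sum>i\<in>I. c i * cinner H (f i) h)"
    using cinner_sum_left[OF assms, where c = c] cinner_commute[of h "\<lambda>z. \<Sum>i\<in>I. c i * f i z"] assms
    by simp
  also have "\<dots> = (\<Sum>i\<in>I. cnj (c i) * cinner H h (f i))"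
    using assms(2) assms(1)[THEN cinner_commute[OF assms(2)]] by (auto intro!: sum.cong)
  finally show ?thesis .
qed

lemma cinner_self: "f \<in> vectors H \<Longrightarrow> cinner H f f = of_real ((hnorm H f)\<^sup>2)"
  using cinner_self_nonneg[of f] cinner_commute[of f f]
  by (simp add: hnorm_def complex_eq_iff)

lemma hnorm_power2: "f \<in> vectors H \<Longrightarrow> (hnorm H f)\<^sup>2 = Re (cinner H f f)"
  by (simp add: cinner_self)

lemma hnorm_nonneg [simp]: "f \<in> vectors H \<Longrightarrow> 0 \<le> hnorm H f"
  using cinner_self_nonneg[of f] by (simp add: hnorm_def)

lemma hnorm_zero [simp]: "hnorm H (\<lambda>z. 0) = 0"
  by (simp add: hnorm_def)

lemma hnorm_eq_0_iff: "f \<in> vectors H \<Longrightarrow> hnorm H f = 0 \<longleftrightarrow> f = (\<lambda>z. 0)"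
  using cinner_self_eq_0[of f] cinner_self[of f] by auto

lemma hnorm_scale: "f \<in> vectors H \<Longrightarrow> hnorm H (\<lambda>z. c * f z) = cmod c * hnorm H f"
proof -
  assume f: "f \<in> vectors H"
  have "cinner H (\<lambda>z. c * f z) (\<lambda>z. c * f z) = of_real ((cmod c * hnorm H f)\<^sup>2)"
    using f by (simp add: cinner_scale_left cinner_scale_right cinner_self power_mult_distrib
        mult.assoc[symmetric] complex_norm_square[symmetric] del: of_real_power)
  then have "(hnorm H (\<lambda>z. c * f z))\<^sup>2 = (cmod c * hnorm H f)\<^sup>2"
    using f by (simp add: hnorm_power2 del: of_real_mult of_real_power)
  then show ?thesis
    using f by (simp add: power2_eq_iff_nonneg)
qed

lemma hnorm_diff_commute:
  "\<lbrakk>f \<in> vectors H; g \<in> vectors H\<rbrakk> \<Longrightarrow> hnorm H (\<lambda>z. f z - g z) = hnorm H (\<lambda>z. g z - f z)"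
  using hnorm_scale[of "\<lambda>z. f z - g z" "-1"] by (simp add: algebra_simps)

lemma hnorm_add_power2:
  "\<lbrakk>f \<in> vectors H; g \<in> vectors H\<rbrakk>
    \<Longrightarrow> (hnorm H (\<lambda>z. f z + g z))\<^sup>2 = (hnorm H f)\<^sup>2 + (hnorm H g)\<^sup>2 + 2 * Re (cinner H f g)"
  using cinner_commute[of f g]
  by (simp add: hnorm_power2 cinner_add_left cinner_add_right)

lemma Cauchy_Schwarz:
  assumes f: "f \<in> vectors H" and g: "g \<in> vectors H"
  shows "cmod (cinner H f g) \<le> hnorm H f * hnorm H g"
proof (cases "g = (\<lambda>z. 0)")
  case True
  then show ?thesis using f by simp
next
  case False
  then have pos: "hnorm H g > 0"
    using g hnorm_eq_0_iff[of g] hnorm_nonneg[of g] by linarith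
  \<comment> \<open>This \<open>c\<close> minimizes the norm of f + c * g: it subtracts from f its
    projection onto g.\<close>
  define c where "c = - cinner H f g / of_real ((hnorm H g)\<^sup>2)"
  have cg: "c * of_real ((hnorm H g)\<^sup>2) = - cinner H f g"
    using pos by (simp add: c_def)
  have "0 \<le> (hnorm H (\<lambda>z. f z + c * g z))\<^sup>2" by simp
  also have "\<dots> = (hnorm H f)\<^sup>2 + (cmod c * hnorm H g)\<^sup>2 + 2 * Re (cnj c * cinner H f g)"
    using f g by (simp add: hnorm_add_power2 hnorm_scale cinner_scale_right)
  also have "cnj c * cinner H f g = - of_real ((cmod (cinner H f g))\<^sup>2 / (hnorm H g)\<^sup>2)"
    using complex_norm_square[of "cinner H f g"] by (simp add: c_def mult.commute)
  also have "(cmod c * hnorm H g)\<^sup>2 = (cmod (cinner H f g))\<^sup>2 / (hnorm H g)\<^sup>2"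
    using pos by (simp add: c_def norm_divide norm_mult power2_eq_square)
  finally have "(cmod (cinner H f g))\<^sup>2 / (hnorm H g)\<^sup>2 \<le> (hnorm H f)\<^sup>2"
    by (simp del: of_real_divide of_real_power)
  then have "(cmod (cinner H f g))\<^sup>2 \<le> (hnorm H f * hnorm H g)\<^sup>2"
    using pos by (simp add: divide_simps power_mult_distrib mult.commute)
  then show ?thesis
    using f g by (simp add: power2_le_iff_abs_le abs_le_square_iff[symmetric])
qed

lemma hnorm_triangle:
  assumes f: "f \<in> vectors H" and g: "g \<in> vectors H"
  shows "hnorm H (\<lambda>z. f z + g z) \<le> hnorm H f + hnorm H g"
proof -
  have "Re (cinner H f g) \<le> hnorm H f * hnorm H g"
    using Cauchy_Schwarz[OF f g] complex_Re_le_cmod order_trans by blast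
  then have "(hnorm H (\<lambda>z. f z + g z))\<^sup>2 \<le> (hnorm H f + hnorm H g)\<^sup>2"
    using f g by (simp add: hnorm_add_power2 power2_sum)
  then show ?thesis
    using f g by (simp add: power2_le_iff_abs_le abs_le_square_iff[symmetric])
qed

lemma hnorm_diff_triangle:
  assumes "f \<in> vectors H" "g \<in> vectors H" "h \<in> vectors H"
  shows "hnorm H (\<lambda>z. f z - h z) \<le> hnorm H (\<lambda>z. f z - g z) + hnorm H (\<lambda>z. g z - h z)"
  using hnorm_triangle[of "\<lambda>z. f z - g z" "\<lambda>z. g z - h z"] assms by simp

lemma hnorm_triangle_sub:
  assumes "f \<in> vectors H" "g \<in> vectors H"
  shows "hnorm H f \<le> hnorm H g + hnorm H (\<lambda>z. f z - g z)"
  using hnorm_triangle[of g "\<lambda>z. f z - g z"] assms by simp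

lemma hnorm_triangle_diff:
  assumes "f \<in> vectors H" "g \<in> vectors H"
  shows "\<bar>hnorm H f - hnorm H g\<bar> \<le> hnorm H (\<lambda>z. f z - g z)"
  using hnorm_triangle_sub[of f g] hnorm_triangle_sub[of g f] hnorm_diff_commute[of f g] assms
  by simp

lemma hnorm_add_diff_le:
  assumes "f \<in> vectors H" "g \<in> vectors H" "f' \<in> vectors H" "g' \<in> vectors H"
  shows "hnorm H (\<lambda>z. (f z + g z) - (f' z + g' z))
    \<le> hnorm H (\<lambda>z. f z - f' z) + hnorm H (\<lambda>z. g z - g' z)"
  using hnorm_triangle[of "\<lambda>z. f z - f' z" "\<lambda>z. g z - g' z"] assms
  by (simp add: algebra_simps)

lemma hnorm_sum_power2:
  assumes "\<And>i. i \<in> I \<Longrightarrow> f i \<in> vectors H"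
  shows "of_real ((hnorm H (\<lambda>z. \<Sum>i\<in>I. c i * f i z))\<^sup>2)
    = (\<Sum>i\<in>I. \<Sum>j\<in>I. c j * cnj (c i) * cinner H (f j) (f i))"
proof -
  let ?x = "\<lambda>z. \<Sum>i\<in>I. c i * f i z"
  have "of_real ((hnorm H ?x)\<^sup>2) = cinner H ?x ?x"
    using assms by (intro cinner_self[symmetric] sum_mem)
  also have "\<dots> = (\<Sum>i\<in>I. cnj (c i) * cinner H ?x (f i))"
    using assms by (intro cinner_sum_right) auto
  also have "\<dots> = (\<Sum>i\<in>I. cnj (c i) * (\<Sum>j\<in>I. c j * cinner H (f j) (f i)))"
    using assms by (intro sum.cong) (auto simp: cinner_sum_left)
  finally show ?thesis
    by (simp add: sum_distrib_left mult_ac)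
qed

lemma hnorm_sum_orthonormal:
  assumes "\<And>i. i \<in> I \<Longrightarrow> f i \<in> vectors H"
    and "\<And>i j. \<lbrakk>i \<in> I; j \<in> I\<rbrakk> \<Longrightarrow> cinner H (f i) (f j) = (if i = j then 1 else 0)"
    and "finite I"
  shows "(hnorm H (\<lambda>z. \<Sum>i\<in>I. c i * f i z))\<^sup>2 = (\<Sum>i\<in>I. (cmod (c i))\<^sup>2)"
proof -
  have "complex_of_real ((hnorm H (\<lambda>z. \<Sum>i\<in>I. c i * f i z))\<^sup>2)
      = (\<Sum>i\<in>I. \<Sum>j\<in>I. if i = j then c j * cnj (c i) else 0)"
    using assms(1,2) by (simp only: hnorm_sum_power2) (auto intro!: sum.cong)
  also have "\<dots> = of_real (\<Sum>i\<in>I. (cmod (c i))\<^sup>2)"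
    using assms(3) by (simp add: sum.delta' complex_norm_square[symmetric] del: of_real_power)
  finally show ?thesis using of_real_eq_iff by blast
qed

text \<open>Pairing f with its projection x gives s = \<parallel>x\<parallel>^2, so Cauchy-Schwarz
  yields s^2 \<le> \<parallel>f\<parallel>^2 * s, and a factor s cancels.\<close>

lemma Bessel_inequality:
  assumes e: "\<And>i. i \<in> I \<Longrightarrow> e i \<in> vectors H"
    and orth: "\<And>i j. \<lbrakk>i \<in> I; j \<in> I\<rbrakk> \<Longrightarrow> cinner H (e i) (e j) = (if i = j then 1 else 0)"
    and fin: "finite I" and f: "f \<in> vectors H"
  shows "(\<Sum>i\<in>I. (cmod (cinner H f (e i)))\<^sup>2) \<le> (hnorm H f)\<^sup>2"
proof -
  define x where "x = (\<lambda>z. \<Sum>i\<in>I. cinner H f (e i) * e i z)"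
  define s where "s = (\<Sum>i\<in>I. (cmod (cinner H f (e i)))\<^sup>2)"
  have x: "x \<in> vectors H" using e by (simp add: x_def)
  have nx: "(hnorm H x)\<^sup>2 = s"
    unfolding x_def s_def using e orth fin by (rule hnorm_sum_orthonormal)
  have "cinner H f x = (\<Sum>i\<in>I. cnj (cinner H f (e i)) * cinner H f (e i))"
    unfolding x_def using e f by (rule cinner_sum_right)
  also have "\<dots> = of_real s"
    by (simp add: s_def complex_norm_square mult.commute del: of_real_power)
  finally have "cmod (cinner H f x) = \<bar>s\<bar>" by simp
  then have "s \<le> hnorm H f * hnorm H x"
    using Cauchy_Schwarz[OF f x] by linarith
  then have "s * s \<le> (hnorm H f * hnorm H x) * (hnorm H f * hnorm H x)"
    using nx[symmetric] by (intro mult_mono) (simp_all add: f x)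
  also have "\<dots> = (hnorm H f)\<^sup>2 * s"
    using nx by (simp add: power2_eq_square mult_ac)
  finally have "s * s \<le> (hnorm H f)\<^sup>2 * s" .
  moreover have "s \<ge> 0" using nx by (metis zero_le_power2)
  ultimately show ?thesis
    unfolding s_def[symmetric]
    by (metis mult_right_le_imp_le order_le_less zero_le_power2)
qed

end

text \<open>Convergence and the Cauchy property are spelled out through \<open>hnorm\<close>,
  because the carrier is a set of plain functions without a metric type of its own.\<close>

locale hilbert_fspace = inner_fspace +
  assumes complete:
    "\<lbrakk>\<And>n. X n \<in> vectors H;
      \<And>e. e > 0 \<Longrightarrow> \<exists>N. \<forall>m\<ge>N. \<forall>n\<ge>N. hnorm H (\<lambda>z. X m z - X n z) < e\<rbrakk>
     \<Longrightarrow> \<exists>l\<in>vectors H. (\<lambda>n. hnorm H (\<lambda>z. X n z - l z)) \<longlonglongrightarrow> 0"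


section \<open>Riesz bounds and Riesz basic sequences\<close>

lemma lin_span_superset: "i \<in> J \<Longrightarrow> f i \<in> lin_span J f"
  unfolding lin_span_def by (rule CollectI, rule exI[of _ "{i}"], rule exI[of _ "\<lambda>_. 1"]) auto

lemma lin_span_sum: "\<lbrakk>finite I; I \<subseteq> J\<rbrakk> \<Longrightarrow> (\<lambda>z. \<Sum>i\<in>I. c i * f i z) \<in> lin_span J f"
  unfolding lin_span_def by blast

lemma lin_span_zero: "(\<lambda>z. 0) \<in> lin_span J f"
  using lin_span_sum[of "{}" J "\<lambda>_. 0" f] by simp

lemma lin_span_add:
  assumes "x \<in> lin_span J f" "y \<in> lin_span J f"
  shows "(\<lambda>z. x z + y z) \<in> lin_span J f"
proof -
  obtain I c where I: "finite I" "I \<subseteq> J" "x = (\<lambda>z. \<Sum>i\<in>I. c i * f i z)"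
    using assms(1) unfolding lin_span_def by blast
  obtain K d where K: "finite K" "K \<subseteq> J" "y = (\<lambda>z. \<Sum>i\<in>K. d i * f i z)"
    using assms(2) unfolding lin_span_def by blast
  define c' where "c' i = (if i \<in> I then c i else 0)" for i
  define d' where "d' i = (if i \<in> K then d i else 0)" for i
  have "x z + y z = (\<Sum>i\<in>I \<union> K. (c' i + d' i) * f i z)" for z
  proof -
    have "x z = (\<Sum>i\<in>I \<union> K. c' i * f i z)"
      unfolding I(3) using I(1) K(1) by (intro sum.mono_neutral_cong_left) (auto simp: c'_def)
    moreover have "y z = (\<Sum>i\<in>I \<union> K. d' i * f i z)"
      unfolding K(3) using I(1) K(1) by (intro sum.mono_neutral_cong_left) (auto simp: d'_def)
    ultimately show ?thesis by (simp add: distrib_right sum.distrib)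
  qed
  then show ?thesis
    using lin_span_sum[of "I \<union> K" J "\<lambda>i. c' i + d' i" f] I K by simp
qed

lemma lin_span_scale:
  assumes "x \<in> lin_span J f"
  shows "(\<lambda>z. c * x z) \<in> lin_span J f"
proof -
  obtain I d where I: "finite I" "I \<subseteq> J" "x = (\<lambda>z. \<Sum>i\<in>I. d i * f i z)"
    using assms unfolding lin_span_def by blast
  show ?thesis
    using lin_span_sum[OF I(1,2), of "\<lambda>i. c * d i" f] by (simp add: I(3) sum_distrib_left mult.assoc)
qed

lemma lin_span_diff:
  "\<lbrakk>x \<in> lin_span J f; y \<in> lin_span J f\<rbrakk> \<Longrightarrow> (\<lambda>z. x z - y z) \<in> lin_span J f"
  using lin_span_add[of x J f "\<lambda>z. (-1) * y z"] lin_span_scale[of y J f "-1"] by simp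

lemma lin_span_sum_mem:
  assumes "\<And>i. i \<in> I \<Longrightarrow> g i \<in> lin_span J f"
  shows "(\<lambda>z. \<Sum>i\<in>I. c i * g i z) \<in> lin_span J f"
  using assms
proof (induction I rule: infinite_finite_induct)
  case (insert i I)
  then have "(\<lambda>z. c i * g i z + (\<Sum>i\<in>I. c i * g i z)) \<in> lin_span J f"
    by (intro lin_span_add lin_span_scale) auto
  then show ?case using insert.hyps by simp
qed (auto simp: lin_span_zero)

lemma lin_span_subset:
  assumes "\<And>i. i \<in> I \<Longrightarrow> g i \<in> lin_span J f"
  shows "lin_span I g \<subseteq> lin_span J f"
proof
  fix x assume "x \<in> lin_span I g"
  then obtain K c where K: "K \<subseteq> I" "x = (\<lambda>z. \<Sum>i\<in>K. c i * g i z)"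
    unfolding lin_span_def by blast
  then show "x \<in> lin_span J f"
    using assms by (auto intro!: lin_span_sum_mem)
qed

lemma lin_span_mono: "I \<subseteq> J \<Longrightarrow> lin_span I f \<subseteq> lin_span J f"
  by (rule lin_span_subset) (auto intro: lin_span_superset)

context inner_fspace
begin

lemma lin_span_mem: "\<lbrakk>\<And>i. i \<in> J \<Longrightarrow> f i \<in> vectors H; x \<in> lin_span J f\<rbrakk> \<Longrightarrow> x \<in> vectors H"
  unfolding lin_span_def by (auto intro!: sum_mem)

lemma hclosure_superset:
  assumes "M \<subseteq> vectors H"
  shows "M \<subseteq> hclosure H M"
proof
  fix g assume g: "g \<in> M"
  then have "hnorm H (\<lambda>z. g z - g z) < e" if "e > 0" for e
    using that by simp
  then show "g \<in> hclosure H M"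
    using g assms unfolding hclosure_def by blast
qed

lemma inner_fspace_subspace:
  assumes "V \<subseteq> vectors H" "(\<lambda>z. 0) \<in> V"
    and "\<And>f g. \<lbrakk>f \<in> V; g \<in> V\<rbrakk> \<Longrightarrow> (\<lambda>z. f z + g z) \<in> V"
    and "\<And>c f. f \<in> V \<Longrightarrow> (\<lambda>z. c * f z) \<in> V"
  shows "inner_fspace (H\<lparr>vectors := V\<rparr>)"
  using assms
  by unfold_locales
    (auto simp: cinner_add_left cinner_scale_left cinner_self_nonneg subset_iff
      intro: cinner_commute cinner_self_eq_0)

end

context hilbert_fspace
begin

text \<open>Riesz bases are defined inside a closed span, so that span must itself be a Hilbert
  space for the same inner product. A Cauchy sequence converges in the ambient space, and its limit
  stays in the closure by an e/2 argument.\<close>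

lemma hilbert_fspace_hclosure:
  assumes V: "V \<subseteq> vectors H" "(\<lambda>z. 0) \<in> V"
    and add: "\<And>f g. \<lbrakk>f \<in> V; g \<in> V\<rbrakk> \<Longrightarrow> (\<lambda>z. f z + g z) \<in> V"
    and scale: "\<And>c f. f \<in> V \<Longrightarrow> (\<lambda>z. c * f z) \<in> V"
  shows "hilbert_fspace (H\<lparr>vectors := hclosure H V\<rparr>)"
proof -
  let ?C = "hclosure H V"
  have C: "?C \<subseteq> vectors H" by (auto simp: hclosure_def)
  have zero: "(\<lambda>z. 0) \<in> ?C" using hclosure_superset V by blast
  have "(\<lambda>z. f z + g z) \<in> ?C" if f: "f \<in> ?C" and g: "g \<in> ?C" for f g
  proof -
    have "\<exists>h\<in>V. hnorm H (\<lambda>z. (f z + g z) - h z) < e" if "e > 0" for e :: real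
    proof -
      obtain f' where f': "f' \<in> V" "hnorm H (\<lambda>z. f z - f' z) < e / 2"
        using f \<open>e > 0\<close> unfolding hclosure_def by (auto dest!: spec[of _ "e/2"])
      obtain g' where g': "g' \<in> V" "hnorm H (\<lambda>z. g z - g' z) < e / 2"
        using g \<open>e > 0\<close> unfolding hclosure_def by (auto dest!: spec[of _ "e/2"])
      have "hnorm H (\<lambda>z. (f z + g z) - (f' z + g' z)) < e"
        using hnorm_add_diff_le[of f g f' g'] f f' g g' V(1) C by (force simp: subset_iff)
      then show ?thesis using add[OF f'(1) g'(1)] by auto
    qed
    then show ?thesis using f g by (auto simp: hclosure_def)
  qed
  moreover have "(\<lambda>z. c * f z) \<in> ?C" if f: "f \<in> ?C" for f c
  proof -
    have "\<exists>h\<in>V. hnorm H (\<lambda>z. c * f z - h z) < e" if "e > 0" for e :: real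
    proof -
      \<comment> \<open>The summand 1 covers c = 0 and makes the final inequality strict.\<close>
      have e: "e / (cmod c + 1) > 0" using \<open>e > 0\<close> by (simp add: add_nonneg_pos)
      then obtain f' where f': "f' \<in> V" "hnorm H (\<lambda>z. f z - f' z) < e / (cmod c + 1)"
        using f unfolding hclosure_def by blast
      have mem: "f \<in> vectors H" "f' \<in> vectors H" using f f' V(1) C by auto
      have "hnorm H (\<lambda>z. c * f z - c * f' z) = cmod c * hnorm H (\<lambda>z. f z - f' z)"
        using hnorm_scale[of "\<lambda>z. f z - f' z" c] mem by (simp add: algebra_simps)
      also have "\<dots> \<le> cmod c * (e / (cmod c + 1))"
        using f'(2) by (intro mult_left_mono) auto
      also have "\<dots> < e" using \<open>e > 0\<close> by (simp add: field_simps add_pos_nonneg)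
      finally show ?thesis using scale[OF f'(1), of c] by auto
    qed
    then show ?thesis using f by (auto simp: hclosure_def)
  qed
  ultimately interpret K: inner_fspace "H\<lparr>vectors := ?C\<rparr>"
    using C zero by (intro inner_fspace_subspace)
  show ?thesis
  proof
    fix X :: "nat \<Rightarrow> complex \<Rightarrow> complex"
    assume X: "\<And>n. X n \<in> vectors (H\<lparr>vectors := ?C\<rparr>)"
      and Cau: "\<And>e. e > 0 \<Longrightarrow> \<exists>N. \<forall>m\<ge>N. \<forall>n\<ge>N.
        hnorm (H\<lparr>vectors := ?C\<rparr>) (\<lambda>z. X m z - X n z) < e"
    have XH: "X n \<in> vectors H" for n using X[of n] C by auto
    obtain l where l: "l \<in> vectors H" "(\<lambda>n. hnorm H (\<lambda>z. X n z - l z)) \<longlonglongrightarrow> 0"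
      using complete[of X] XH Cau by (auto simp: hnorm_def)
    have "\<exists>h\<in>V. hnorm H (\<lambda>z. l z - h z) < e" if "e > 0" for e :: real
    proof -
      have "eventually (\<lambda>n. hnorm H (\<lambda>z. X n z - l z) < e / 2) sequentially"
        using l(2) \<open>e > 0\<close> by (intro order_tendstoD) auto
      then obtain n where n: "hnorm H (\<lambda>z. X n z - l z) < e / 2"
        by (auto simp: eventually_sequentially)
      obtain h where h: "h \<in> V" "hnorm H (\<lambda>z. X n z - h z) < e / 2"
        using X[of n] \<open>e > 0\<close> by (auto simp: hclosure_def dest!: spec[of _ "e/2"])
      have "hnorm H (\<lambda>z. l z - h z) < e"
        using hnorm_diff_triangle[of l "X n" h] hnorm_diff_commute[of l "X n"] n h l(1) XH[of n] V(1)
        by (auto simp: subset_iff)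
      then show ?thesis using h(1) by blast
    qed
    then have "l \<in> ?C" using l(1) by (auto simp: hclosure_def)
    then show "\<exists>l\<in>vectors (H\<lparr>vectors := ?C\<rparr>).
        (\<lambda>n. hnorm (H\<lparr>vectors := ?C\<rparr>) (\<lambda>z. X n z - l z)) \<longlonglongrightarrow> 0"
      using l(2) by (auto simp: hnorm_def)
  qed
qed

text \<open>A densely defined bounded operator extends by closing its graph; keeping the graph
  symmetric in the two families yields inverse operators.\<close>

definition span_graph ::
    "'i set \<Rightarrow> ('i \<Rightarrow> complex \<Rightarrow> complex) \<Rightarrow> ('i \<Rightarrow> complex \<Rightarrow> complex)
     \<Rightarrow> (complex \<Rightarrow> complex) \<Rightarrow> (complex \<Rightarrow> complex) \<Rightarrow> bool" where
  "span_graph J u f x y \<longleftrightarrow> y \<in> vectors H \<and>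
     (\<forall>e>0. \<exists>I c. finite I \<and> I \<subseteq> J \<and> hnorm H (\<lambda>z. x z - (\<Sum>i\<in>I. c i * u i z)) < e \<and>
        hnorm H (\<lambda>z. y z - (\<Sum>i\<in>I. c i * f i z)) < e)"

end

section \<open>Extending an operator from a dense span\<close>

text \<open>\<open>dominated\<close> makes the assignment of \<open>f i\<close> to
  \<open>u i\<close> well defined, linear and bounded on finite combinations. The locale is
  instantiated twice, with \<open>u\<close> and \<open>f\<close> exchanged, to obtain an operator
  and its inverse.\<close>

locale dominated_family = hilbert_fspace +
  fixes J :: "'i set" and u f :: "'i \<Rightarrow> complex \<Rightarrow> complex" and D :: real
  assumes u_mem [simp]: "i \<in> J \<Longrightarrow> u i \<in> vectors H"
    and f_mem [simp]: "i \<in> J \<Longrightarrow> f i \<in> vectors H"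
    and dense: "hclosure H (lin_span J u) = vectors H"
    and D_nonneg: "D \<ge> 0"
    and dominated: "\<lbrakk>finite I; I \<subseteq> J\<rbrakk> \<Longrightarrow>
      hnorm H (\<lambda>z. \<Sum>i\<in>I. c i * f i z) \<le> D * hnorm H (\<lambda>z. \<Sum>i\<in>I. c i * u i z)"
begin

lemma sums_mem [simp]:
  assumes "I \<subseteq> J"
  shows "(\<lambda>z. \<Sum>i\<in>I. c i * f i z) \<in> vectors H" "(\<lambda>z. \<Sum>i\<in>I. c i * u i z) \<in> vectors H"
  using assms by (auto intro!: sum_mem)

lemma dominated_diff:
  assumes "finite I" "I \<subseteq> J" "finite K" "K \<subseteq> J"
  shows "hnorm H (\<lambda>z. (\<Sum>i\<in>I. c i * f i z) - (\<Sum>i\<in>K. d i * f i z))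
    \<le> D * hnorm H (\<lambda>z. (\<Sum>i\<in>I. c i * u i z) - (\<Sum>i\<in>K. d i * u i z))"
proof -
  define b where "b i = (if i \<in> I then c i else 0) - (if i \<in> K then d i else 0)" for i
  have eq: "(\<Sum>i\<in>I. c i * g i z) - (\<Sum>i\<in>K. d i * g i z) = (\<Sum>i\<in>I \<union> K. b i * g i z)"
    for g :: "'i \<Rightarrow> complex \<Rightarrow> complex" and z
  proof -
    have "(\<Sum>i\<in>I. c i * g i z) = (\<Sum>i\<in>I \<union> K. (if i \<in> I then c i else 0) * g i z)"
      using assms by (intro sum.mono_neutral_cong_left) auto
    moreover have "(\<Sum>i\<in>K. d i * g i z) = (\<Sum>i\<in>I \<union> K. (if i \<in> K then d i else 0) * g i z)"
      using assms by (intro sum.mono_neutral_cong_left) auto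
    ultimately show ?thesis by (simp add: b_def left_diff_distrib sum_subtractf)
  qed
  show ?thesis
    unfolding eq using assms by (intro dominated) auto
qed

text \<open>The domination constant survives the closure of the graph. Apart from boundedness this
  also yields single-valuedness, as it forces the values over 0 to vanish.\<close>

lemma span_graph_bound:
  assumes x: "x \<in> vectors H" and g: "span_graph J u f x y"
  shows "hnorm H y \<le> D * hnorm H x"
proof (rule field_le_epsilon)
  fix e :: real assume e: "e > 0"
  \<comment> \<open>An error d in x costs D * d after the estimate, and approximating y costs
    another d; together this is e.\<close>
  define d where "d = e / (D + 1)"
  have d: "d > 0" using e D_nonneg by (simp add: d_def)
  then obtain I c where I: "finite I" "I \<subseteq> J"
      "hnorm H (\<lambda>z. x z - (\<Sum>i\<in>I. c i * u i z)) < d"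
      "hnorm H (\<lambda>z. y z - (\<Sum>i\<in>I. c i * f i z)) < d"
    using g unfolding span_graph_def by blast
  let ?U = "\<lambda>z. \<Sum>i\<in>I. c i * u i z" and ?F = "\<lambda>z. \<Sum>i\<in>I. c i * f i z"
  have y: "y \<in> vectors H" using g by (simp add: span_graph_def)
  have "hnorm H ?U \<le> hnorm H x + d"
    using hnorm_triangle_diff[of x ?U] x I by auto
  then have "D * hnorm H ?U \<le> D * (hnorm H x + d)"
    using D_nonneg by (intro mult_left_mono)
  moreover have "hnorm H y \<le> hnorm H ?F + d"
    using hnorm_triangle_diff[of y ?F] y I by auto
  moreover have "hnorm H ?F \<le> D * hnorm H ?U"
    using I by (intro dominated)
  ultimately have "hnorm H y \<le> D * hnorm H x + (D + 1) * d"
    by (simp add: algebra_simps)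
  also have "(D + 1) * d = e" using D_nonneg by (simp add: d_def)
  finally show "hnorm H y \<le> D * hnorm H x + e" .
qed

lemma span_graph_add:
  assumes x: "x \<in> vectors H" "x' \<in> vectors H"
    and g: "span_graph J u f x y" "span_graph J u f x' y'"
  shows "span_graph J u f (\<lambda>z. x z + x' z) (\<lambda>z. y z + y' z)"
  unfolding span_graph_def
proof (intro conjI allI impI)
  have y: "y \<in> vectors H" "y' \<in> vectors H" using g by (auto simp: span_graph_def)
  then show "(\<lambda>z. y z + y' z) \<in> vectors H" by simp
  fix e :: real assume "e > 0"
  then have e: "e / 2 > 0" by simp
  obtain I c where I: "finite I" "I \<subseteq> J"
      "hnorm H (\<lambda>z. x z - (\<Sum>i\<in>I. c i * u i z)) < e / 2"
      "hnorm H (\<lambda>z. y z - (\<Sum>i\<in>I. c i * f i z)) < e / 2"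
    using g(1) e unfolding span_graph_def by blast
  obtain K d where K: "finite K" "K \<subseteq> J"
      "hnorm H (\<lambda>z. x' z - (\<Sum>i\<in>K. d i * u i z)) < e / 2"
      "hnorm H (\<lambda>z. y' z - (\<Sum>i\<in>K. d i * f i z)) < e / 2"
    using g(2) e unfolding span_graph_def by blast
  define b where "b i = (if i \<in> I then c i else 0) + (if i \<in> K then d i else 0)" for i
  have eq: "(\<Sum>i\<in>I \<union> K. b i * g i z) = (\<Sum>i\<in>I. c i * g i z) + (\<Sum>i\<in>K. d i * g i z)"
    for g :: "'i \<Rightarrow> complex \<Rightarrow> complex" and z
  proof -
    have "(\<Sum>i\<in>I. c i * g i z) = (\<Sum>i\<in>I \<union> K. (if i \<in> I then c i else 0) * g i z)"
      using I K by (intro sum.mono_neutral_cong_left) auto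
    moreover have "(\<Sum>i\<in>K. d i * g i z) = (\<Sum>i\<in>I \<union> K. (if i \<in> K then d i else 0) * g i z)"
      using I K by (intro sum.mono_neutral_cong_left) auto
    ultimately show ?thesis by (simp add: b_def distrib_right sum.distrib)
  qed
  have "hnorm H (\<lambda>z. (x z + x' z) - (\<Sum>i\<in>I \<union> K. b i * u i z)) < e"
    using hnorm_add_diff_le[of x x' "\<lambda>z. \<Sum>i\<in>I. c i * u i z" "\<lambda>z. \<Sum>i\<in>K. d i * u i z"] x I K
    unfolding eq by auto
  moreover have "hnorm H (\<lambda>z. (y z + y' z) - (\<Sum>i\<in>I \<union> K. b i * f i z)) < e"
    using hnorm_add_diff_le[of y y' "\<lambda>z. \<Sum>i\<in>I. c i * f i z" "\<lambda>z. \<Sum>i\<in>K. d i * f i z"] y I K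
    unfolding eq by auto
  ultimately show "\<exists>I c. finite I \<and> I \<subseteq> J \<and>
      hnorm H (\<lambda>z. (x z + x' z) - (\<Sum>i\<in>I. c i * u i z)) < e \<and>
      hnorm H (\<lambda>z. (y z + y' z) - (\<Sum>i\<in>I. c i * f i z)) < e"
    using I(1,2) K(1,2) by (intro exI[of _ "I \<union> K"] exI[of _ b]) auto
qed

lemma span_graph_scale:
  assumes x: "x \<in> vectors H" and g: "span_graph J u f x y"
  shows "span_graph J u f (\<lambda>z. a * x z) (\<lambda>z. a * y z)"
  unfolding span_graph_def
proof (intro conjI allI impI)
  have y: "y \<in> vectors H" using g by (auto simp: span_graph_def)
  then show "(\<lambda>z. a * y z) \<in> vectors H" by simp
  fix e :: real assume e: "e > 0"
  have "e / (cmod a + 1) > 0" using e by (simp add: add_nonneg_pos)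
  then obtain I c where I: "finite I" "I \<subseteq> J"
      "hnorm H (\<lambda>z. x z - (\<Sum>i\<in>I. c i * u i z)) < e / (cmod a + 1)"
      "hnorm H (\<lambda>z. y z - (\<Sum>i\<in>I. c i * f i z)) < e / (cmod a + 1)"
    using g unfolding span_graph_def by blast
  have small: "hnorm H (\<lambda>z. a * p z - (\<Sum>i\<in>I. (a * c i) * g i z)) < e"
    if p: "p \<in> vectors H" and g: "(\<lambda>z. \<Sum>i\<in>I. c i * g i z) \<in> vectors H"
      and lt: "hnorm H (\<lambda>z. p z - (\<Sum>i\<in>I. c i * g i z)) < e / (cmod a + 1)" for p g
  proof -
    have "hnorm H (\<lambda>z. a * p z - (\<Sum>i\<in>I. (a * c i) * g i z))
        = cmod a * hnorm H (\<lambda>z. p z - (\<Sum>i\<in>I. c i * g i z))"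
      using hnorm_scale[OF diff_mem[OF p g], of a]
      by (simp add: right_diff_distrib sum_distrib_left mult.assoc)
    also have "\<dots> \<le> cmod a * (e / (cmod a + 1))"
      using lt by (intro mult_left_mono) auto
    also have "\<dots> < e" using e by (simp add: field_simps add_pos_nonneg)
    finally show ?thesis .
  qed
  show "\<exists>I c. finite I \<and> I \<subseteq> J \<and>
      hnorm H (\<lambda>z. a * x z - (\<Sum>i\<in>I. c i * u i z)) < e \<and>
      hnorm H (\<lambda>z. a * y z - (\<Sum>i\<in>I. c i * f i z)) < e"
    using I small[OF x _ I(3)] small[OF y _ I(4)]
    by (intro exI[of _ I] exI[of _ "\<lambda>i. a * c i"]) auto
qed

text \<open>By linearity of the graph, y - y' is a value over 0, and the bound makes its norm
  0.\<close>

lemma span_graph_unique: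
  assumes x: "x \<in> vectors H" and g: "span_graph J u f x y" "span_graph J u f x y'"
  shows "y = y'"
proof -
  have y: "y \<in> vectors H" "y' \<in> vectors H" using g by (auto simp: span_graph_def)
  have "span_graph J u f (\<lambda>z. (-1) * x z) (\<lambda>z. (-1) * y' z)"
    using x g(2) by (rule span_graph_scale)
  then have "span_graph J u f (\<lambda>z. x z + (-1) * x z) (\<lambda>z. y z + (-1) * y' z)"
    using x g(1) by (intro span_graph_add) auto
  then have "span_graph J u f (\<lambda>z. 0) (\<lambda>z. y z - y' z)" by simp
  from span_graph_bound[OF zero_mem this] have "hnorm H (\<lambda>z. y z - y' z) \<le> 0" by simp
  then have "hnorm H (\<lambda>z. y z - y' z) = 0"
    using y by (intro antisym hnorm_nonneg diff_mem)
  then have "(\<lambda>z. y z - y' z) = (\<lambda>z. 0)"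
    using y hnorm_eq_0_iff[of "\<lambda>z. y z - y' z"] by simp
  then show ?thesis by (simp add: fun_eq_iff)
qed

text \<open>Combinations of the \<open>u i\<close> tending to x form a Cauchy sequence; by
  domination the combinations of the \<open>f i\<close> with the same coefficients are Cauchy too,
  and completeness provides y.\<close>

lemma span_graph_ex:
  assumes x: "x \<in> vectors H"
  shows "\<exists>y. span_graph J u f x y"
proof -
  have "x \<in> hclosure H (lin_span J u)" using x dense by simp
  then have "\<exists>I c. finite I \<and> I \<subseteq> J \<and> hnorm H (\<lambda>z. x z - (\<Sum>i\<in>I. c i * u i z)) < e"
    if "e > 0" for e :: real
    using that unfolding hclosure_def lin_span_def by blast
  then have "\<exists>I c. finite I \<and> I \<subseteq> J \<and>
      hnorm H (\<lambda>z. x z - (\<Sum>i\<in>I. c i * u i z)) < inverse (real (Suc n))" for n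
    by simp
  then obtain I c where I: "\<And>n. finite (I n)" "\<And>n. I n \<subseteq> J" and
    lt: "\<And>n. hnorm H (\<lambda>z. x z - (\<Sum>i\<in>I n. c n i * u i z)) < inverse (real (Suc n))"
    by metis
  define U where "U n = (\<lambda>z. \<Sum>i\<in>I n. c n i * u i z)" for n
  define F where "F n = (\<lambda>z. \<Sum>i\<in>I n. c n i * f i z)" for n
  have mem: "U n \<in> vectors H" "F n \<in> vectors H" for n
    using I(2) by (auto simp: U_def F_def)
  have ltU: "hnorm H (\<lambda>z. x z - U n z) < inverse (real (Suc n))" for n
    using lt by (simp add: U_def)
  have FU: "hnorm H (\<lambda>z. F m z - F n z) \<le> D * hnorm H (\<lambda>z. U m z - U n z)" for m n
    unfolding F_def U_def using I by (intro dominated_diff)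
  have "\<exists>N. \<forall>m\<ge>N. \<forall>n\<ge>N. hnorm H (\<lambda>z. F m z - F n z) < e" if e: "e > 0" for e :: real
  proof -
    \<comment> \<open>Two approximants this close to x differ by at most e / (D + 1), and D * (e /
      (D + 1)) is below e.\<close>
    have "e / (2 * (D + 1)) > 0" using e D_nonneg by simp
    then obtain N where N: "inverse (real (Suc N)) < e / (2 * (D + 1))"
      using reals_Archimedean by blast
    have close: "hnorm H (\<lambda>z. x z - U n z) < e / (2 * (D + 1))" if "n \<ge> N" for n
    proof -
      have "inverse (real (Suc n)) \<le> inverse (real (Suc N))"
        using that by (simp add: field_simps)
      then show ?thesis using ltU[of n] N by linarith
    qed
    have "hnorm H (\<lambda>z. F m z - F n z) < e" if "m \<ge> N" "n \<ge> N" for m n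
    proof -
      have "hnorm H (\<lambda>z. U m z - U n z) \<le> 2 * (e / (2 * (D + 1)))"
        using hnorm_diff_triangle[of "U m" x "U n"] hnorm_diff_commute[of "U m" x] mem x
          close[OF that(1)] close[OF that(2)] by auto
      then have "D * hnorm H (\<lambda>z. U m z - U n z) \<le> D * (2 * (e / (2 * (D + 1))))"
        using D_nonneg by (rule mult_left_mono)
      also have "\<dots> < e" using e D_nonneg by (simp add: field_simps)
      finally show ?thesis using FU[of m n] by linarith
    qed
    then show ?thesis by blast
  qed
  then obtain y where y: "y \<in> vectors H" "(\<lambda>n. hnorm H (\<lambda>z. F n z - y z)) \<longlonglongrightarrow> 0"
    using complete[of F] mem by blast
  have "span_graph J u f x y"
    unfolding span_graph_def
  proof (intro conjI allI impI y(1))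
    fix e :: real assume e: "e > 0"
    have "eventually (\<lambda>n. hnorm H (\<lambda>z. F n z - y z) < e) sequentially"
      using y(2) e by (intro order_tendstoD) auto
    moreover have "eventually (\<lambda>n. inverse (real (Suc n)) < e) sequentially"
      using LIMSEQ_inverse_real_of_nat e by (rule order_tendstoD)
    ultimately have "eventually (\<lambda>n. hnorm H (\<lambda>z. F n z - y z) < e \<and>
        inverse (real (Suc n)) < e) sequentially"
      by eventually_elim auto
    then obtain n where n: "hnorm H (\<lambda>z. F n z - y z) < e" "inverse (real (Suc n)) < e"
      by (auto simp: eventually_sequentially)
    show "\<exists>I c. finite I \<and> I \<subseteq> J \<and> hnorm H (\<lambda>z. x z - (\<Sum>i\<in>I. c i * u i z)) < e \<and>
        hnorm H (\<lambda>z. y z - (\<Sum>i\<in>I. c i * f i z)) < e"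
      using I n ltU[of n] hnorm_diff_commute[of y "F n"] mem y(1)
      by (intro exI[of _ "I n"] exI[of _ "c n"]) (auto simp: U_def F_def)
  qed
  then show ?thesis by (rule exI[of "span_graph J u f x"])
qed

definition extension :: "(complex \<Rightarrow> complex) \<Rightarrow> complex \<Rightarrow> complex" where
  "extension x = (THE y. span_graph J u f x y)"

lemma span_graph_extension: "x \<in> vectors H \<Longrightarrow> span_graph J u f x (extension x)"
  unfolding extension_def
  by (rule theI'[of "span_graph J u f x"]) (metis span_graph_ex span_graph_unique)

lemma extension_eqI: "\<lbrakk>x \<in> vectors H; span_graph J u f x y\<rbrakk> \<Longrightarrow> extension x = y"
  using span_graph_extension span_graph_unique by blast

lemma extension_base: "i \<in> J \<Longrightarrow> extension (u i) = f i"
  by (rule extension_eqI)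
    (auto simp: span_graph_def intro!: exI[of _ "{i}"] exI[of _ "\<lambda>_. 1"])

lemma bounded_op_extension: "bounded_op H extension"
  unfolding bounded_op_def
proof (intro conjI ballI allI)
  fix x assume x: "x \<in> vectors H"
  then show "extension x \<in> vectors H"
    using span_graph_extension by (auto simp: span_graph_def)
  fix a show "extension (\<lambda>z. a * x z) = (\<lambda>z. a * extension x z)"
    using x by (intro extension_eqI span_graph_scale span_graph_extension) auto
  fix y assume y: "y \<in> vectors H"
  show "extension (\<lambda>z. x z + y z) = (\<lambda>z. extension x z + extension y z)"
    using x y by (intro extension_eqI span_graph_add span_graph_extension) auto
qed (use span_graph_bound span_graph_extension in blast)

end

context hilbert_fspace
begin

text \<open>For an orthonormal \<open>u\<close> the coefficient sum is the squared norm of the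
  combination of the \<open>u i\<close>. The upper bound thus dominates \<open>f\<close> by
  \<open>u\<close> and the lower bound \<open>u\<close> by \<open>f\<close>; the two extensions have
  transposed graphs and so invert each other.\<close>

lemma riesz_basisI:
  assumes ob: "orthonormal_basis H J u" and f: "\<And>i. i \<in> J \<Longrightarrow> f i \<in> vectors H"
    and dense: "hclosure H (lin_span J f) = vectors H"
    and C: "C \<ge> 0" and upper: "\<And>I c. \<lbrakk>finite I; I \<subseteq> J\<rbrakk> \<Longrightarrow>
      (hnorm H (\<lambda>z. \<Sum>i\<in>I. c i * f i z))\<^sup>2 \<le> C * (\<Sum>i\<in>I. (cmod (c i))\<^sup>2)"
    and E: "E \<ge> 0" and lower: "\<And>I c. \<lbrakk>finite I; I \<subseteq> J\<rbrakk> \<Longrightarrow>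
      (\<Sum>i\<in>I. (cmod (c i))\<^sup>2) \<le> E * (hnorm H (\<lambda>z. \<Sum>i\<in>I. c i * f i z))\<^sup>2"
  shows "riesz_basis H J f"
proof -
  have u: "\<And>i. i \<in> J \<Longrightarrow> u i \<in> vectors H"
    and orth: "\<And>i j. \<lbrakk>i \<in> J; j \<in> J\<rbrakk> \<Longrightarrow> cinner H (u i) (u j) = (if i = j then 1 else 0)"
    and du: "hclosure H (lin_span J u) = vectors H"
    using ob by (auto simp: orthonormal_basis_def)
  have nu: "(\<Sum>i\<in>I. (cmod (c i))\<^sup>2) = (hnorm H (\<lambda>z. \<Sum>i\<in>I. c i * u i z))\<^sup>2"
    if "finite I" "I \<subseteq> J" for I c
    using that u orth by (intro hnorm_sum_orthonormal[symmetric]) (auto simp: subset_iff)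
  have sq: "a \<le> sqrt q * b" if "a\<^sup>2 \<le> q * b\<^sup>2" "b \<ge> 0" "q \<ge> 0" for a b q :: real
  proof (rule power2_le_imp_le)
    show "a\<^sup>2 \<le> (sqrt q * b)\<^sup>2" using that by (simp add: power_mult_distrib)
  qed (use that in simp)
  interpret S: dominated_family H J u f "sqrt C"
  proof unfold_locales
    fix I c assume I: "finite I" "I \<subseteq> J"
    show "hnorm H (\<lambda>z. \<Sum>i\<in>I. c i * f i z) \<le> sqrt C * hnorm H (\<lambda>z. \<Sum>i\<in>I. c i * u i z)"
      using upper[OF I, of c] nu[OF I, of c] C I u by (intro sq hnorm_nonneg sum_mem) auto
  qed (use u f du C in auto)
  interpret T: dominated_family H J f u "sqrt E"
  proof unfold_locales
    fix I c assume I: "finite I" "I \<subseteq> J"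
    show "hnorm H (\<lambda>z. \<Sum>i\<in>I. c i * u i z) \<le> sqrt E * hnorm H (\<lambda>z. \<Sum>i\<in>I. c i * f i z)"
      using lower[OF I, of c] nu[OF I, of c] E I f by (intro sq hnorm_nonneg sum_mem) auto
  qed (use u f dense E in auto)
  have sym: "span_graph J f u y x \<longleftrightarrow> span_graph J u f x y"
    if "x \<in> vectors H" "y \<in> vectors H" for x y
    using that unfolding span_graph_def by (auto simp: conj_commute)
  have "T.extension (S.extension x) = x" "S.extension (T.extension x) = x"
    if x: "x \<in> vectors H" for x
  proof -
    have "S.extension x \<in> vectors H" "T.extension x \<in> vectors H"
      using x S.span_graph_extension T.span_graph_extension by (auto simp: span_graph_def)
    then show "T.extension (S.extension x) = x" "S.extension (T.extension x) = x"
      using x S.span_graph_extension[OF x] T.span_graph_extension[OF x] sym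
      by (auto intro!: T.extension_eqI S.extension_eqI)
  qed
  then have "invertible_op H S.extension"
    unfolding invertible_op_def
    using S.bounded_op_extension T.bounded_op_extension by blast
  then show ?thesis
    unfolding riesz_basis_def using ob S.extension_base by blast
qed

end

section \<open>Orthonormal bases by Gram-Schmidt\<close>

text \<open>The recursion follows the enumeration \<open>to_nat_on A\<close>. The basis therefore
  keeps the given index set \<open>A\<close>, as \<open>riesz_basis\<close> demands, whether
  \<open>A\<close> is finite or infinite.\<close>

function gram_schmidt ::
    "fspace \<Rightarrow> 'i set \<Rightarrow> ('i \<Rightarrow> complex \<Rightarrow> complex) \<Rightarrow> 'i \<Rightarrow> complex \<Rightarrow> complex" where
  "gram_schmidt H A f i =
     (let v = (\<lambda>z. f i z - (\<Sum>k\<in>{k \<in> A. to_nat_on A k < to_nat_on A i}.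
            cinner H (f i) (gram_schmidt H A f k) * gram_schmidt H A f k z))
      in (\<lambda>z. inverse (of_real (hnorm H v)) * v z))"
  by pat_completeness auto
termination
  by (relation "Wellfounded.measure (\<lambda>(H, A, f, i). to_nat_on A i)") auto

declare gram_schmidt.simps [simp del]

lemma finite_to_nat_on_less: "countable A \<Longrightarrow> finite {k \<in> A. to_nat_on A k < n}"
  by (rule inj_on_finite[of "to_nat_on A" _ "{..<n}"]) (auto intro: inj_on_subset[OF inj_on_to_nat_on])

context hilbert_fspace
begin

context
  fixes A :: "'i set" and f :: "'i \<Rightarrow> complex \<Rightarrow> complex" and E :: real
  assumes A: "countable A" and f: "\<And>i. i \<in> A \<Longrightarrow> f i \<in> vectors H"
    and lower: "\<And>I c. \<lbrakk>finite I; I \<subseteq> A\<rbrakk> \<Longrightarrow>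
      (\<Sum>i\<in>I. (cmod (c i))\<^sup>2) \<le> E * (hnorm H (\<lambda>z. \<Sum>i\<in>I. c i * f i z))\<^sup>2"
begin

private abbreviation (input) "u \<equiv> gram_schmidt H A f"
private abbreviation (input) "before i \<equiv> {k \<in> A. to_nat_on A k < to_nat_on A i}"
private abbreviation (input) "initial i \<equiv> {k \<in> A. to_nat_on A k \<le> to_nat_on A i}"

text \<open>A linear relation with coefficient -1 at i has coefficient sum at least 1, whereas the
  lower bound would make it at most 0. This independence keeps the normalizing divisor of
  Gram-Schmidt away from 0.\<close>

lemma not_in_lin_span_others:
  assumes i: "i \<in> A" and B: "B \<subseteq> A" "i \<notin> B"
  shows "f i \<notin> lin_span B f"
proof
  assume "f i \<in> lin_span B f"
  then obtain I c where I: "finite I" "I \<subseteq> B" "f i = (\<lambda>z. \<Sum>i\<in>I. c i * f i z)"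
    unfolding lin_span_def by blast
  have iI: "i \<notin> I" using B I by auto
  define d where "d k = (if k = i then -1 else c k)" for k
  have "(\<Sum>k\<in>insert i I. d k * f k z) = 0" for z
  proof -
    have "(\<Sum>k\<in>I. d k * f k z) = (\<Sum>k\<in>I. c k * f k z)"
      using iI by (intro sum.cong) (auto simp: d_def)
    then show ?thesis using I(1) iI fun_cong[OF I(3), of z] by (simp add: d_def)
  qed
  then have "(\<Sum>k\<in>insert i I. (cmod (d k))\<^sup>2) \<le> 0"
    using lower[of "insert i I" d] I B i by auto
  moreover have "(\<Sum>k\<in>insert i I. (cmod (d k))\<^sup>2) \<ge> 1"
    using I(1) iI by (simp add: d_def sum_nonneg)
  ultimately show False by simp
qed

text \<open>All five claims are proved in one induction because they feed each other: membership in
  the span of the earlier \<open>f k\<close> gives a nonzero residual, and orthonormality of the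
  earlier \<open>u k\<close> gives orthogonality of the new one. The two span inclusions later
  identify the spans over all of \<open>A\<close>.\<close>

lemma gram_schmidt_step:
  assumes i: "i \<in> A"
  shows "u i \<in> lin_span (initial i) f \<and> f i \<in> lin_span (initial i) u \<and> u i \<in> vectors H \<and>
    cinner H (u i) (u i) = 1 \<and> (\<forall>k\<in>before i. cinner H (u i) (u k) = 0)"
  using i
proof (induction "to_nat_on A i" arbitrary: i rule: less_induct)
  case less
  have IH: "u k \<in> lin_span (initial k) f" "f k \<in> lin_span (initial k) u" "u k \<in> vectors H"
      "cinner H (u k) (u k) = 1" "\<And>j. j \<in> before k \<Longrightarrow> cinner H (u k) (u j) = 0"
    if "k \<in> before i" for k
    using less.hyps[of k] that by auto
  have fin: "finite (before i)" using A by (rule finite_to_nat_on_less)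
  have sub: "initial k \<subseteq> before i" if "k \<in> before i" for k
    using that by auto
  have orth: "cinner H (u k) (u j) = (if k = j then 1 else 0)"
    if k: "k \<in> before i" and j: "j \<in> before i" for k j
  proof -
    consider "k = j" | "to_nat_on A k < to_nat_on A j" | "to_nat_on A j < to_nat_on A k"
      using inj_on_to_nat_on[OF A] k j by (force simp: inj_on_def)
    then show ?thesis
    proof cases
      case 1 then show ?thesis using IH(4)[OF k] by simp
    next
      case 2
      then have "cinner H (u j) (u k) = 0" "k \<noteq> j" using IH(5)[OF j, of k] k by auto
      then show ?thesis using cinner_commute[of "u k" "u j"] IH(3) k j by auto
    next
      case 3
      then show ?thesis using IH(5)[OF k, of j] j by auto
    qed
  qed
  have fi: "f i \<in> vectors H" using f less.prems by blast
  define p where "p = (\<lambda>z. \<Sum>k\<in>before i. cinner H (f i) (u k) * u k z)"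
  define v where "v = (\<lambda>z. f i z - p z)"
  have p: "p \<in> vectors H" unfolding p_def using IH(3) by (rule sum_mem)
  have v: "v \<in> vectors H" unfolding v_def using fi p by (rule diff_mem)
  have ui: "u i = (\<lambda>z. inverse (of_real (hnorm H v)) * v z)"
    unfolding gram_schmidt.simps[of H A f i] Let_def v_def p_def ..
  \<comment> \<open>The projection is expressed through the earlier \<open>f k\<close>, not the
    \<open>u k\<close>, so that a vanishing residual contradicts the independence of
    \<open>f i\<close>.\<close>
  have pf: "p \<in> lin_span (before i) f"
    unfolding p_def
    by (rule lin_span_sum_mem) (use IH(1) lin_span_mono[OF sub, of _ f] in blast)
  have "v \<noteq> (\<lambda>z. 0)"
  proof
    assume "v = (\<lambda>z. 0)"
    then have "f i = p" by (simp add: v_def fun_eq_iff)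
    then show False using not_in_lin_span_others[of i "before i"] pf less.prems by auto
  qed
  then have pos: "hnorm H v > 0"
    using hnorm_eq_0_iff[OF v] hnorm_nonneg[OF v] by linarith
  have "before i \<subseteq> initial i" by auto
  note mono = lin_span_mono[OF this]
  have ii: "i \<in> initial i" using less.prems by auto
  have "v \<in> lin_span (initial i) f"
    unfolding v_def using pf mono ii by (blast intro: lin_span_diff lin_span_superset)
  then have 1: "u i \<in> lin_span (initial i) f" unfolding ui by (rule lin_span_scale)
  have "p \<in> lin_span (initial i) u"
    unfolding p_def using mono[of u] by (intro lin_span_sum_mem) (auto intro: lin_span_superset)
  moreover have "(\<lambda>z. of_real (hnorm H v) * u i z) \<in> lin_span (initial i) u"
    using ii by (intro lin_span_scale lin_span_superset)
  ultimately have "(\<lambda>z. of_real (hnorm H v) * u i z + p z) \<in> lin_span (initial i) u"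
    by (intro lin_span_add)
  also have "(\<lambda>z. of_real (hnorm H v) * u i z + p z) = f i"
    using pos by (simp add: ui fun_eq_iff mult.assoc[symmetric]) (simp add: v_def)
  finally have 2: "f i \<in> lin_span (initial i) u" .
  have 3: "u i \<in> vectors H" unfolding ui using v by simp
  have 4: "cinner H (u i) (u i) = 1"
    unfolding ui using v pos
    by (simp add: cinner_scale_left cinner_scale_right cinner_self power2_eq_square)
      (simp add: field_simps)
  have "cinner H v (u k) = 0" if k: "k \<in> before i" for k
  proof -
    have "cinner H p (u k) = (\<Sum>j\<in>before i. cinner H (f i) (u j) * cinner H (u j) (u k))"
      unfolding p_def using IH(3) k by (intro cinner_sum_left) auto
    also have "\<dots> = (\<Sum>j\<in>before i. if j = k then cinner H (f i) (u j) else 0)"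
      using orth k by (intro sum.cong) auto
    also have "\<dots> = cinner H (f i) (u k)" using fin k by simp
    finally show ?thesis
      unfolding v_def using fi p IH(3)[OF k] by (simp add: cinner_diff_left)
  qed
  then have 5: "\<forall>k\<in>before i. cinner H (u i) (u k) = 0"
    unfolding ui using v IH(3) by (auto simp: cinner_scale_left)
  show ?case using 1 2 3 4 5 by blast
qed

lemma orthonormal_basis_gram_schmidt:
  assumes dense: "hclosure H (lin_span A f) = vectors H"
  shows "orthonormal_basis H A u"
  unfolding orthonormal_basis_def
proof (intro conjI ballI)
  fix i j assume i: "i \<in> A" and j: "j \<in> A"
  show "u i \<in> vectors H" using gram_schmidt_step[OF i] by simp
  consider "i = j" | "i \<noteq> j" "j \<in> before i" | "i \<noteq> j" "i \<in> before j"
    using inj_on_to_nat_on[OF A] i j by (force simp: inj_on_def)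
  then show "cinner H (u i) (u j) = (if i = j then 1 else 0)"
  proof cases
    case 3
    then show ?thesis
      using gram_schmidt_step[OF i] gram_schmidt_step[OF j] cinner_commute[of "u i" "u j"] by auto
  qed (use gram_schmidt_step[OF i] in auto)
next
  have "initial i \<subseteq> A" for i by auto
  note mono = lin_span_mono[OF this]
  have "lin_span A u = lin_span A f"
    using gram_schmidt_step mono by (intro equalityI lin_span_subset) blast+
  then show "hclosure H (lin_span A u) = vectors H" using dense by simp
qed

end

text \<open>The bounds involve only finite combinations, whose norms are the same in the closed span
  as in the whole space. In the closed span density holds by construction, and independence comes
  from the lower bound.\<close>

lemma riesz_basic_sequenceI:
  assumes A: "countable A" and f: "\<And>i. i \<in> A \<Longrightarrow> f i \<in> vectors H"
    and C: "C \<ge> 0" and upper: "\<And>I c. \<lbrakk>finite I; I \<subseteq> A\<rbrakk> \<Longrightarrow>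
      (hnorm H (\<lambda>z. \<Sum>i\<in>I. c i * f i z))\<^sup>2 \<le> C * (\<Sum>i\<in>I. (cmod (c i))\<^sup>2)"
    and E: "E \<ge> 0" and lower: "\<And>I c. \<lbrakk>finite I; I \<subseteq> A\<rbrakk> \<Longrightarrow>
      (\<Sum>i\<in>I. (cmod (c i))\<^sup>2) \<le> E * (hnorm H (\<lambda>z. \<Sum>i\<in>I. c i * f i z))\<^sup>2"
  shows "riesz_basic_sequence H A f"
proof -
  have span: "lin_span A f \<subseteq> vectors H" using f lin_span_mem by blast
  let ?K = "H\<lparr>vectors := hclosure H (lin_span A f)\<rparr>"
  interpret K: hilbert_fspace ?K
    using span by (intro hilbert_fspace_hclosure lin_span_zero lin_span_add lin_span_scale)
  have hn: "hnorm ?K = hnorm H" by (simp add: hnorm_def fun_eq_iff)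
  have fK: "f i \<in> vectors ?K" if "i \<in> A" for i
    using lin_span_superset[OF that, of f] hclosure_superset[OF span] by auto
  have dense: "hclosure ?K (lin_span A f) = vectors ?K"
    unfolding hclosure_def[of ?K] hn by (auto simp: hclosure_def)
  have "orthonormal_basis ?K A (gram_schmidt ?K A f)"
    using A fK lower dense unfolding hn[symmetric] by (rule K.orthonormal_basis_gram_schmidt)
  then have "riesz_basis ?K A f"
    using fK dense C upper E lower unfolding hn[symmetric] by (rule K.riesz_basisI)
  then show ?thesis using f by (simp add: riesz_basic_sequence_def)
qed

end


section \<open>Gram matrices of Szego kernels\<close>

lemma degree_prod_linear_le:
  "degree (\<Prod>l\<in>I. [:b l, c l:]) \<le> card I"
proof -
  have "degree (\<Prod>l\<in>I. [:b l, c l:]) \<le> sum (degree \<circ> (\<lambda>l. [:b l, c l:])) I"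
  proof (cases "finite I")
    case True
    then show ?thesis by (rule degree_prod_sum_le)
  qed simp
  also have "\<dots> \<le> (\<Sum>l\<in>I. 1)" by (intro sum_mono) simp
  finally show ?thesis by simp
qed

text \<open>Both sides are polynomials of degree below \<open>card I\<close> that agree at the
  \<open>card I\<close> distinct nodes.\<close>

lemma Lagrange_interpolation:
  fixes p :: "'a :: field poly"
  assumes I: "finite I" and inj: "inj_on a I" and deg: "degree p < card I"
  shows "poly p x = (\<Sum>k\<in>I. poly p (a k) * (\<Prod>l\<in>I - {k}. (x - a l) / (a k - a l)))"
proof -
  define q where "q = (\<Sum>k\<in>I. smult (poly p (a k))
      (\<Prod>l\<in>I - {k}. [:- a l / (a k - a l), 1 / (a k - a l):]))"
  have q: "poly q x = (\<Sum>k\<in>I. poly p (a k) * (\<Prod>l\<in>I - {k}. (x - a l) / (a k - a l)))" for x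
    by (simp add: q_def poly_sum poly_prod diff_divide_distrib)
  have eq: "poly q (a m) = poly p (a m)" if m: "m \<in> I" for m
  proof -
    have "(\<Prod>l\<in>I - {k}. (a m - a l) / (a k - a l)) = (if k = m then 1 else 0)" if k: "k \<in> I" for k
    proof (cases "k = m")
      case True
      have "(a m - a l) / (a k - a l) = 1" if "l \<in> I - {k}" for l
        using inj that m True by (auto simp: inj_on_def)
      then show ?thesis using True by simp
    next
      case False
      then have "m \<in> I - {k}" using m by simp
      then show ?thesis using I False by (auto intro!: bexI[of _ m])
    qed
    then have "poly q (a m) = (\<Sum>k\<in>I. poly p (a k) * (if k = m then 1 else 0))"
      unfolding q by (intro sum.cong) auto
    then show ?thesis using I m by (simp add: if_distrib cong: if_cong)
  qed
  have "degree q \<le> card I - 1"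
    unfolding q_def
  proof (intro degree_sum_le I)
    fix k assume k: "k \<in> I"
    have "degree (\<Prod>l\<in>I - {k}. [:- a l / (a k - a l), 1 / (a k - a l):]) \<le> card (I - {k})"
      by (rule degree_prod_linear_le)
    then show "degree (smult (poly p (a k))
        (\<Prod>l\<in>I - {k}. [:- a l / (a k - a l), 1 / (a k - a l):])) \<le> card I - 1"
      using I k by (simp add: degree_smult_le order_trans[OF degree_smult_le])
  qed
  moreover have "card (a ` I) = card I" using inj by (rule card_image)
  ultimately have card: "card (a ` I) > degree p" "card (a ` I) > degree q"
    using deg by linarith+
  have "poly p x = poly q x" if "x \<in> a ` I" for x
    using that by (elim imageE) (simp only: eq)
  then have "p = q" using card by (rule poly_eqI_degree)
  then have "poly p x = poly q x" by simp
  then show ?thesis by (simp only: q)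
qed

text \<open>Lagrange interpolation of \<open>\<Prod>l\<in>I - {i}. 1 - w l * x\<close> at \<open>x = 1 / y\<close>; the value
  \<open>y = 0\<close> is reached by continuity.\<close>

lemma reflected_Lagrange:
  fixes a w :: "'i \<Rightarrow> complex"
  assumes I: "finite I" and inj: "inj_on a I" and i: "i \<in> I"
  shows "(\<Sum>k\<in>I. (\<Prod>l\<in>I - {i}. 1 - w l * a k) * (\<Prod>l\<in>I - {k}. (1 - a l * y) / (a k - a l)))
    = (\<Prod>l\<in>I - {i}. y - w l)" (is "?L y = ?R y")
proof -
  have nz: "?L y = ?R y" if y: "y \<noteq> 0" for y
  proof -
    define p where "p = (\<Prod>l\<in>I - {i}. [:1, - w l:])"
    have p: "poly p x = (\<Prod>l\<in>I - {i}. 1 - w l * x)" for x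
      by (simp add: p_def poly_prod mult.commute)
    have "degree p \<le> card (I - {i})" unfolding p_def by (rule degree_prod_linear_le)
    also have "\<dots> < card I" using I i by (rule card_Diff1_less)
    finally have "poly p (1 / y)
        = (\<Sum>k\<in>I. poly p (a k) * (\<Prod>l\<in>I - {k}. (1 / y - a l) / (a k - a l)))"
      using I inj by (intro Lagrange_interpolation)
    \<comment> \<open>Every product involved has \<open>card I - 1\<close> factors, so this power
      puts exactly one y into each factor and clears 1 / y.\<close>
    then have "y ^ (card I - 1) * poly p (1 / y)
        = (\<Sum>k\<in>I. poly p (a k) * (y ^ (card I - 1) * (\<Prod>l\<in>I - {k}. (1 / y - a l) / (a k - a l))))"
      by (simp add: sum_distrib_left mult_ac)
    also have "\<dots> = ?L y"
    proof (intro sum.cong refl)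
      fix k assume k: "k \<in> I"
      have "y ^ (card I - 1) * (\<Prod>l\<in>I - {k}. (1 / y - a l) / (a k - a l))
          = (\<Prod>l\<in>I - {k}. y * ((1 / y - a l) / (a k - a l)))"
        using I k by (simp only: prod.distrib) (simp add: prod_constant)
      also have "\<dots> = (\<Prod>l\<in>I - {k}. (1 - a l * y) / (a k - a l))"
        using y by (intro prod.cong) (auto simp: right_diff_distrib mult_ac)
      finally show "poly p (a k) * (y ^ (card I - 1) * (\<Prod>l\<in>I - {k}. (1 / y - a l) / (a k - a l)))
          = (\<Prod>l\<in>I - {i}. 1 - w l * a k) * (\<Prod>l\<in>I - {k}. (1 - a l * y) / (a k - a l))"
        by (simp add: p)
    qed
    also have "y ^ (card I - 1) * poly p (1 / y) = (\<Prod>l\<in>I - {i}. y * (1 - w l * (1 / y)))"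
      using I i by (simp only: prod.distrib p) (simp add: prod_constant)
    also have "\<dots> = ?R y"
      using y by (intro prod.cong) (auto simp: field_simps)
    finally show ?thesis ..
  qed
  show ?thesis
  proof (cases "y = 0")
    case True
    have "isCont (\<lambda>y. ?L y - ?R y) 0"
      using inj by (intro continuous_intros) (auto simp: inj_on_def)
    then have "(\<lambda>y. ?L y - ?R y) \<midarrow>0\<rightarrow> ?L 0 - ?R 0" by (simp add: isCont_def)
    moreover have "(\<lambda>y. ?L y - ?R y) \<midarrow>0\<rightarrow> 0"
      by (rule Lim_transform_eventually[OF tendsto_const]) (auto simp: eventually_at_filter nz)
    ultimately have "?L 0 - ?R 0 = 0" by (rule LIM_unique)
    then show ?thesis using True by simp
  qed (rule nz)
qed

text \<open>Entry (i, j) is the inner product of the normalized Szego kernel at \<open>w j\<close>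
  with the one at \<open>w i\<close>. In this order the matrix maps the coefficients of a
  combination to its inner products with the kernels.\<close>

definition szego_gram :: "('i \<Rightarrow> complex) \<Rightarrow> 'i \<Rightarrow> 'i \<Rightarrow> complex" where
  "szego_gram w i j = of_real (sqrt (1 - (cmod (w i))\<^sup>2) * sqrt (1 - (cmod (w j))\<^sup>2))
     / (1 - w i * cnj (w j))"

text \<open>The value at \<open>w k\<close> of the finite Blaschke product that vanishes at the
  other points; its modulus is the product of the pseudohyperbolic distances from
  \<open>w k\<close>.\<close>

definition blaschke_at :: "('i \<Rightarrow> complex) \<Rightarrow> 'i set \<Rightarrow> 'i \<Rightarrow> complex" where
  "blaschke_at w I k = (\<Prod>l\<in>I - {k}. (w k - w l) / (1 - cnj (w l) * w k))"

lemma one_minus_mult_cnj_nonzero: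
  assumes "cmod z < 1" "cmod w < 1"
  shows "1 - z * cnj w \<noteq> 0"
proof
  assume "1 - z * cnj w = 0"
  then have "cmod z * cmod w = 1" by (metis complex_mod_cnj eq_iff_diff_eq_0 norm_mult norm_one)
  moreover have "cmod z * cmod w < 1 * 1" using assms by (intro mult_strict_mono') auto
  ultimately show False by simp
qed

text \<open>The matrix inverting the Gram matrix is the Gram matrix of the biorthogonal functions
  \<open>B / b k\<close> times the \<open>k\<close>-th kernel, suitably scaled, where \<open>B\<close> is the finite Blaschke product
  with zeros \<open>w l\<close> and \<open>b k\<close> its \<open>k\<close>-th factor.\<close>

lemma szego_gram_inverse:
  assumes I: "finite I" and disk: "\<And>k. k \<in> I \<Longrightarrow> cmod (w k) < 1" and inj: "inj_on w I"
    and i: "i \<in> I" and j: "j \<in> I"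
  shows "(\<Sum>k\<in>I. szego_gram w i k * (cnj (szego_gram w k j)
      / (blaschke_at w I j * cnj (blaschke_at w I k)))) = (if i = j then 1 else 0)"
proof -
  define a where "a k = cnj (w k)" for k
  define s where "s k = complex_of_real (sqrt (1 - (cmod (w k))\<^sup>2))" for k
  have s2: "s k * s k = 1 - w k * a k" if "k \<in> I" for k
  proof -
    have "(cmod (w k))\<^sup>2 \<le> 1" using disk[OF that] by (simp add: power_le_one)
    then show ?thesis
      by (simp add: s_def a_def complex_norm_square[symmetric] flip: of_real_mult)
  qed
  have nz: "1 - w k * a l \<noteq> 0" if "k \<in> I" "l \<in> I" for k l
    unfolding a_def using disk that by (intro one_minus_mult_cnj_nonzero) auto
  have inja: "inj_on a I" using inj by (auto simp: inj_on_def a_def)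
  have anz: "a k - a l \<noteq> 0" if "k \<in> I" "l \<in> I" "k \<noteq> l" for k l
    using inja that by (auto simp: inj_on_def)
  have wnz: "w k - w l \<noteq> 0" if "k \<in> I" "l \<in> I" "k \<noteq> l" for k l
    using inj that by (auto simp: inj_on_def)
  have G: "szego_gram w k l = s k * s l / (1 - w k * a l)" for k l
    by (simp add: szego_gram_def s_def a_def)
  have cG: "cnj (szego_gram w k l) = s k * s l / (1 - a k * w l)" for k l
    by (simp add: szego_gram_def s_def a_def)
  \<comment> \<open>With \<open>a\<close> in place of the conjugates the identity becomes rational
    in \<open>w\<close> and \<open>a\<close>. \<open>N\<close> and \<open>Q\<close> keep the factors
    that the interpolation formula omits, so that a quotient independent of k can be pulled out of
    the sum.\<close>
  define N where "N k = (\<Prod>l\<in>I. 1 - w l * a k)" for k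
  define M where "M k = (\<Prod>l\<in>I - {k}. a k - a l)" for k
  define Q where "Q = (\<Prod>l\<in>I. 1 - a l * w j)"
  have Mnz: "M k \<noteq> 0" if "k \<in> I" for k
    unfolding M_def using I anz that by (auto simp: prod_zero_iff)
  have Qnz: "Q \<noteq> 0"
    unfolding Q_def using I nz j by (auto simp: prod_zero_iff mult.commute)
  have Nnz: "N k \<noteq> 0" if "k \<in> I" for k
    unfolding N_def using I nz that by (auto simp: prod_zero_iff)
  have cb: "cnj (blaschke_at w I k) = M k * (1 - w k * a k) / N k" if k: "k \<in> I" for k
  proof -
    have "cnj (blaschke_at w I k) = M k / (\<Prod>l\<in>I - {k}. 1 - w l * a k)"
      by (simp add: blaschke_at_def M_def a_def cnj_prod prod_dividef)
    moreover have "N k = (1 - w k * a k) * (\<Prod>l\<in>I - {k}. 1 - w l * a k)"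
      unfolding N_def using I k by (rule prod.remove)
    ultimately show ?thesis using nz[OF k k] by simp
  qed
  have bnz: "blaschke_at w I j \<noteq> 0"
    using cb[OF j] Mnz[OF j] Nnz[OF j] nz[OF j j] by auto
  have "(\<Sum>k\<in>I. szego_gram w i k * (cnj (szego_gram w k j)
        / (blaschke_at w I j * cnj (blaschke_at w I k))))
      = (\<Sum>k\<in>I. s i * s j / (blaschke_at w I j * Q) *
          ((\<Prod>l\<in>I - {i}. 1 - w l * a k) * (\<Prod>l\<in>I - {k}. (1 - a l * w j) / (a k - a l))))"
  proof (intro sum.cong refl)
    fix k assume k: "k \<in> I"
    have 1: "N k = (1 - w i * a k) * (\<Prod>l\<in>I - {i}. 1 - w l * a k)"
      unfolding N_def using I i by (rule prod.remove)
    have 2: "Q = (1 - a k * w j) * (\<Prod>l\<in>I - {k}. 1 - a l * w j)"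
      unfolding Q_def using I k by (rule prod.remove)
    have 3: "(\<Prod>l\<in>I - {k}. (1 - a l * w j) / (a k - a l)) = (\<Prod>l\<in>I - {k}. 1 - a l * w j) / M k"
      by (simp add: prod_dividef M_def)
    have 4: "szego_gram w i k * (cnj (szego_gram w k j)
          / (blaschke_at w I j * cnj (blaschke_at w I k)))
        = s i * s j * (s k * s k) * N k / ((1 - w i * a k) * (1 - a k * w j) *
            blaschke_at w I j * M k * (1 - w k * a k))"
      unfolding cG cb[OF k] unfolding G by (simp add: mult_ac)
    show "szego_gram w i k * (cnj (szego_gram w k j)
          / (blaschke_at w I j * cnj (blaschke_at w I k)))
        = s i * s j / (blaschke_at w I j * Q) *
          ((\<Prod>l\<in>I - {i}. 1 - w l * a k) * (\<Prod>l\<in>I - {k}. (1 - a l * w j) / (a k - a l)))"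
      unfolding 4 3 s2[OF k] using nz[OF i k] nz[OF k k] nz[OF j k] bnz Mnz[OF k] Qnz
      by (simp add: 1 divide_simps) (simp add: 2 mult_ac)
  qed
  \<comment> \<open>The reflected interpolation is evaluated at y = \<open>w j\<close>, again a
    point of the family: for i \<noteq> j the remaining product contains the factor
    \<open>w j - w j\<close>.\<close>
  also have "\<dots> = s i * s j / (blaschke_at w I j * Q) * (\<Prod>l\<in>I - {i}. w j - w l)"
    unfolding sum_distrib_left[symmetric] using I inja i by (subst reflected_Lagrange) auto
  also have "\<dots> = (if i = j then 1 else 0)"
  proof (cases "i = j")
    case True
    have "Q = (1 - a j * w j) * (\<Prod>l\<in>I - {j}. 1 - a l * w j)"
      unfolding Q_def using I j by (rule prod.remove)
    then have "blaschke_at w I j * Q = (1 - w j * a j) * (\<Prod>l\<in>I - {j}. w j - w l)"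
      using Qnz by (simp add: blaschke_at_def prod_dividef a_def mult_ac)
    moreover have "blaschke_at w I j * Q \<noteq> 0" using bnz Qnz by simp
    ultimately show ?thesis using True s2[OF j] by simp
  next
    case False
    then have "(\<Prod>l\<in>I - {i}. w j - w l) = 0"
      using I j by (auto intro!: bexI[of _ j])
    then show ?thesis using False by simp
  qed
  finally show ?thesis .
qed

section \<open>Pseudohyperbolic distance and Carleson's condition\<close>

lemma cmod_szego_gram_power2:
  assumes "cmod (w i) < 1" "cmod (w j) < 1"
  shows "(cmod (szego_gram w i j))\<^sup>2
    = (1 - (cmod (w i))\<^sup>2) * (1 - (cmod (w j))\<^sup>2) / (cmod (1 - w i * cnj (w j)))\<^sup>2"
proof -
  have "(cmod (w i))\<^sup>2 \<le> 1" "(cmod (w j))\<^sup>2 \<le> 1" using assms by (simp_all add: power_le_one)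
  then show ?thesis
    by (simp add: szego_gram_def norm_divide norm_mult power_divide power_mult_distrib)
qed

text \<open>Stated for equal points rather than equal indices: with i = j it normalizes the kernels,
  with i \<noteq> j it shows that repeated points exceed the threshold 1/2.\<close>

lemma cmod_szego_gram_self:
  assumes "cmod (w i) < 1" "cmod (w j) < 1" "w i = w j"
  shows "cmod (szego_gram w i j) = 1"
proof -
  have lt: "(cmod (w j))\<^sup>2 < 1" using assms by (simp add: power_less_one_iff abs_square_less_1)
  have "1 - w j * cnj (w j) = of_real (1 - (cmod (w j))\<^sup>2)"
    by (simp only: complex_norm_square[symmetric] of_real_diff of_real_1)
  then have "cmod (1 - w j * cnj (w j)) = \<bar>1 - (cmod (w j))\<^sup>2\<bar>"
    by (simp only: norm_of_real)
  then have "(cmod (szego_gram w i j))\<^sup>2 = 1"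
    using lt unfolding cmod_szego_gram_power2[of w i j, OF assms(1,2)] assms(3)
    by (simp add: power2_eq_square)
  then show ?thesis using norm_ge_zero[of "szego_gram w i j"] by (auto simp: power2_eq_1_iff simp del: norm_ge_zero)
qed

text \<open>The subtracted quotient is the squared modulus of a Gram entry, so Blaschke factors
  become accessible to the row sums of the Bessel inequality.\<close>

lemma pseudohyperbolic_power2:
  assumes "cmod z < 1" "cmod w < 1"
  shows "(cmod ((z - w) / (1 - cnj w * z)))\<^sup>2
    = 1 - (1 - (cmod z)\<^sup>2) * (1 - (cmod w)\<^sup>2) / (cmod (1 - z * cnj w))\<^sup>2"
proof -
  have nz: "cmod (1 - z * cnj w) \<noteq> 0" using one_minus_mult_cnj_nonzero[OF assms] by simp
  have "(cmod (1 - z * cnj w))\<^sup>2 - (cmod (z - w))\<^sup>2 = (1 - (cmod z)\<^sup>2) * (1 - (cmod w)\<^sup>2)"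
    unfolding cmod_power2 by (simp add: algebra_simps power2_eq_square)
  then have "(cmod (z - w))\<^sup>2 = (cmod (1 - z * cnj w))\<^sup>2 - (1 - (cmod z)\<^sup>2) * (1 - (cmod w)\<^sup>2)"
    by linarith
  moreover have "(cmod ((z - w) / (1 - cnj w * z)))\<^sup>2
      = (cmod (z - w))\<^sup>2 / (cmod (1 - z * cnj w))\<^sup>2"
    by (simp add: norm_divide power_divide mult.commute)
  ultimately show ?thesis using nz by (simp only: diff_divide_distrib) simp
qed

text \<open>This is ln (1 - x) \<ge> - x - 2 * x^2 combined with 2 * x^2 \<le> x. The restriction to
  x \<le> 1/2 fixes the threshold of the colouring.\<close>

lemma exp_minus_double_le:
  fixes x :: real
  assumes "0 \<le> x" "x \<le> 1/2"
  shows "exp (- 2 * x) \<le> 1 - x"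
proof -
  have "- x - 2 * x\<^sup>2 \<le> ln (1 - x)" using assms by (rule ln_one_minus_pos_lower_bound)
  moreover have "2 * x\<^sup>2 \<le> x" using assms mult_left_mono[of x "1/2" x] by (simp add: power2_eq_square)
  ultimately have "exp (- 2 * x) \<le> exp (ln (1 - x))" by simp
  then show ?thesis using assms by simp
qed

text \<open>The exponential of the row sum splits into a product, compared factor by factor with the
  squared pseudohyperbolic distances. The bound depends on \<open>B\<close> alone, hence not on the
  finite set \<open>I\<close>.\<close>

lemma blaschke_at_lower_bound:
  assumes I: "finite I" and disk: "\<And>k. k \<in> I \<Longrightarrow> cmod (w k) < 1" and k: "k \<in> I"
    and sep: "\<And>l. \<lbrakk>l \<in> I; l \<noteq> k\<rbrakk> \<Longrightarrow> (cmod (szego_gram w k l))\<^sup>2 \<le> 1/2"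
    and B: "(\<Sum>l\<in>I. (cmod (szego_gram w k l))\<^sup>2) \<le> B"
  shows "exp (- 2 * B) \<le> (cmod (blaschke_at w I k))\<^sup>2"
proof -
  have "(\<Sum>l\<in>I - {k}. (cmod (szego_gram w k l))\<^sup>2) \<le> (\<Sum>l\<in>I. (cmod (szego_gram w k l))\<^sup>2)"
    using I by (intro sum_mono2) auto
  then have "exp (- 2 * B) \<le> exp (\<Sum>l\<in>I - {k}. - 2 * (cmod (szego_gram w k l))\<^sup>2)"
    using B by (simp add: sum_negf sum_distrib_left[symmetric])
  also have "\<dots> = (\<Prod>l\<in>I - {k}. exp (- 2 * (cmod (szego_gram w k l))\<^sup>2))"
    using I by (simp add: exp_sum)
  also have "\<dots> \<le> (\<Prod>l\<in>I - {k}. 1 - (cmod (szego_gram w k l))\<^sup>2)"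
    using sep by (intro prod_mono conjI exp_minus_double_le) auto
  also have "\<dots> = (\<Prod>l\<in>I - {k}. (cmod ((w k - w l) / (1 - cnj (w l) * w k)))\<^sup>2)"
    using disk k by (intro prod.cong refl) (auto simp: cmod_szego_gram_power2 pseudohyperbolic_power2
        simp del: norm_divide)
  also have "\<dots> = (cmod (blaschke_at w I k))\<^sup>2"
    by (simp only: blaschke_at_def prod_norm[symmetric] prod_power_distrib)
  finally show ?thesis .
qed

context inner_fspace
begin

text \<open>Duality: synthesis is the adjoint of the analysis map and has the same norm. Writing
  \<parallel>x\<parallel>^2 as the pairing of x with its own expansion and applying Cauchy-Schwarz
  leaves one factor \<parallel>x\<parallel>^2 to cancel.\<close>

lemma synthesis_bound:
  assumes f: "\<And>i. i \<in> I \<Longrightarrow> f i \<in> vectors H"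
    and B: "\<And>x. x \<in> vectors H \<Longrightarrow> (\<Sum>i\<in>I. (cmod (cinner H x (f i)))\<^sup>2) \<le> B * (hnorm H x)\<^sup>2"
    and B0: "B \<ge> 0"
  shows "(hnorm H (\<lambda>z. \<Sum>i\<in>I. c i * f i z))\<^sup>2 \<le> B * (\<Sum>i\<in>I. (cmod (c i))\<^sup>2)"
proof -
  define x where "x = (\<lambda>z. \<Sum>i\<in>I. c i * f i z)"
  define C where "C = (\<Sum>i\<in>I. (cmod (c i))\<^sup>2)"
  have x: "x \<in> vectors H" unfolding x_def using f by (rule sum_mem)
  have C: "C \<ge> 0" unfolding C_def by (intro sum_nonneg) simp
  have "of_real ((hnorm H x)\<^sup>2) = cinner H x x" using cinner_self[OF x] by simp
  also have "\<dots> = (\<Sum>i\<in>I. cnj (c i) * cinner H x (f i))"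
    using cinner_sum_right[OF f x, where c = c] by (simp add: x_def)
  finally have "(hnorm H x)\<^sup>2 = cmod (\<Sum>i\<in>I. cnj (c i) * cinner H x (f i))"
    by (metis abs_of_nonneg norm_of_real zero_le_power2)
  also have "\<dots> \<le> (\<Sum>i\<in>I. cmod (c i) * cmod (cinner H x (f i)))"
    by (rule order_trans[OF norm_sum]) (simp add: norm_mult)
  finally have "((hnorm H x)\<^sup>2)\<^sup>2 \<le> (\<Sum>i\<in>I. cmod (c i) * cmod (cinner H x (f i)))\<^sup>2"
    by (intro power_mono) auto
  also have "\<dots> \<le> C * (\<Sum>i\<in>I. (cmod (cinner H x (f i)))\<^sup>2)"
    unfolding C_def by (rule Cauchy_Schwarz_ineq_sum)
  also have "\<dots> \<le> C * (B * (hnorm H x)\<^sup>2)"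
    using C B[OF x] by (intro mult_left_mono)
  finally have *: "(hnorm H x)\<^sup>2 * (hnorm H x)\<^sup>2 \<le> (B * C) * (hnorm H x)\<^sup>2"
    by (simp add: power2_eq_square mult_ac)
  show ?thesis
  proof (cases "hnorm H x = 0")
    case True
    have "0 \<le> B * C" using B0 C by simp
    then show ?thesis using True by (simp add: x_def C_def)
  next
    case False
    then have "(hnorm H x)\<^sup>2 > 0" by simp
    then have "(hnorm H x)\<^sup>2 \<le> B * C" using * mult_right_le_imp_le by blast
    then show ?thesis by (simp add: x_def C_def)
  qed
qed

text \<open>Let C be the coefficient sum and y the vector of the span with inner products
  \<open>c i\<close> against the \<open>h i\<close>. Then C is the pairing of y with x, and
  \<parallel>y\<parallel>^2 \<le> B / d * C because the inverse Gram matrix is a scaled conjugate of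
  the Gram matrix. Cauchy-Schwarz gives C^2 \<le> B / d * C * \<parallel>x\<parallel>^2, and C
  cancels.\<close>

lemma szego_lower_bound:
  assumes I: "finite I" and disk: "\<And>k. k \<in> I \<Longrightarrow> cmod (w k) < 1" and inj: "inj_on w I"
    and h: "\<And>i. i \<in> I \<Longrightarrow> h i \<in> vectors H"
    and gram: "\<And>i j. \<lbrakk>i \<in> I; j \<in> I\<rbrakk> \<Longrightarrow> cinner H (h j) (h i) = szego_gram w i j"
    and B: "\<And>c. (hnorm H (\<lambda>z. \<Sum>i\<in>I. c i * h i z))\<^sup>2 \<le> B * (\<Sum>i\<in>I. (cmod (c i))\<^sup>2)"
    and B0: "B \<ge> 0"
    and d: "d > 0" "\<And>k. k \<in> I \<Longrightarrow> d \<le> (cmod (blaschke_at w I k))\<^sup>2"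
  shows "(\<Sum>i\<in>I. (cmod (c i))\<^sup>2) \<le> B / d * (hnorm H (\<lambda>z. \<Sum>i\<in>I. c i * h i z))\<^sup>2"
proof -
  let ?b = "blaschke_at w I" and ?G = "szego_gram w"
  define a where "a k j = cnj (?G k j) / (?b j * cnj (?b k))" for k j
  \<comment> \<open>The inverse Gram matrix applied to \<open>c\<close>: the coefficients that give
    \<open>y\<close> the prescribed inner products.\<close>
  define e where "e k = (\<Sum>j\<in>I. c j * a k j)" for k
  \<comment> \<open>Conjugating the coefficients undoes the conjugation of the matrix entries, and
    the division absorbs the Blaschke scaling; \<parallel>y\<parallel> becomes the norm of an
    ordinary combination with coefficients \<open>m\<close>, to which the upper bound
    applies.\<close>
  define m where "m k = cnj (c k) / cnj (?b k)" for k
  define x where "x = (\<lambda>z. \<Sum>i\<in>I. c i * h i z)"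
  define y where "y = (\<lambda>z. \<Sum>i\<in>I. e i * h i z)"
  define C where "C = (\<Sum>i\<in>I. (cmod (c i))\<^sup>2)"
  have x: "x \<in> vectors H" and y: "y \<in> vectors H"
    unfolding x_def y_def using h by (auto intro!: sum_mem)
  have yh: "cinner H y (h i) = c i" if i: "i \<in> I" for i
  proof -
    have "cinner H y (h i) = (\<Sum>k\<in>I. e k * ?G i k)"
      unfolding y_def using h gram i by (subst cinner_sum_left) auto
    also have "\<dots> = (\<Sum>j\<in>I. c j * (\<Sum>k\<in>I. ?G i k * a k j))"
      unfolding e_def sum_distrib_left sum_distrib_right
      by (subst sum.swap) (simp add: mult_ac)
    also have "\<dots> = (\<Sum>j\<in>I. c j * (if i = j then 1 else 0))"
      unfolding a_def using I disk inj i by (intro sum.cong refl) (subst szego_gram_inverse, auto)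
    also have "\<dots> = c i" using I i by (simp add: if_distrib cong: if_cong)
    finally show ?thesis .
  qed
  have "cinner H y x = (\<Sum>i\<in>I. cnj (c i) * c i)"
    unfolding x_def using h y yh by (subst cinner_sum_right) auto
  also have "\<dots> = of_real C"
    by (simp add: C_def complex_norm_square mult.commute del: of_real_power)
  finally have yx: "cmod (cinner H y x) = \<bar>C\<bar>" by simp
  have "of_real ((hnorm H y)\<^sup>2) = cinner H y y" using cinner_self[OF y] by simp
  also have "\<dots> = (\<Sum>k\<in>I. cnj (e k) * c k)"
    using cinner_sum_right[OF h y, where c = e] yh by (simp add: y_def)
  also have "\<dots> = (\<Sum>k\<in>I. \<Sum>j\<in>I. m j * cnj (m k) * ?G k j)"
    by (simp add: e_def a_def m_def sum_distrib_right sum_distrib_left mult_ac)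
  also have "\<dots> = (\<Sum>k\<in>I. \<Sum>j\<in>I. m j * cnj (m k) * cinner H (h j) (h k))"
    using gram by (intro sum.cong) auto
  also have "\<dots> = of_real ((hnorm H (\<lambda>z. \<Sum>i\<in>I. m i * h i z))\<^sup>2)"
    using h by (subst hnorm_sum_power2) auto
  finally have "(hnorm H y)\<^sup>2 = (hnorm H (\<lambda>z. \<Sum>i\<in>I. m i * h i z))\<^sup>2"
    using of_real_eq_iff by blast
  also have "\<dots> \<le> B * (\<Sum>i\<in>I. (cmod (m i))\<^sup>2)" by (rule B)
  also have "\<dots> \<le> B * (\<Sum>i\<in>I. (cmod (c i))\<^sup>2 / d)"
    using B0 d by (intro mult_left_mono sum_mono)
      (auto simp: m_def norm_divide power_divide intro!: divide_left_mono mult_pos_pos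
        intro: less_le_trans)
  also have "\<dots> = B / d * C" by (simp add: C_def sum_divide_distrib[symmetric])
  finally have ny: "(hnorm H y)\<^sup>2 \<le> B / d * C" .
  have C: "C \<ge> 0" unfolding C_def by (intro sum_nonneg) simp
  have "C * C \<le> (hnorm H y * hnorm H x) * (hnorm H y * hnorm H x)"
    using Cauchy_Schwarz[OF y x] C yx by (intro mult_mono) (auto simp: x y)
  also have "\<dots> = (hnorm H y)\<^sup>2 * (hnorm H x)\<^sup>2" by (simp add: power2_eq_square mult_ac)
  also have "\<dots> \<le> B / d * C * (hnorm H x)\<^sup>2" using ny by (intro mult_right_mono) auto
  finally have "C * C \<le> (B / d * (hnorm H x)\<^sup>2) * C" by (simp add: mult_ac)
  moreover have "0 \<le> B / d * (hnorm H x)\<^sup>2" using B0 d(1) by simp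
  ultimately have "C \<le> B / d * (hnorm H x)\<^sup>2"
    using C by (metis mult_right_le_imp_le order_le_less)
  then show ?thesis by (simp only: C_def x_def)
qed

end

section \<open>Colouring countable graphs of bounded degree\<close>

function greedy_colour :: "('i \<Rightarrow> 'i \<Rightarrow> bool) \<Rightarrow> 'i set \<Rightarrow> 'i \<Rightarrow> nat" where
  "greedy_colour R A i =
     (LEAST c. c \<notin> greedy_colour R A ` {k \<in> A. to_nat_on A k < to_nat_on A i \<and> R i k})"
  by pat_completeness auto
termination
  by (relation "Wellfounded.measure (\<lambda>(R, A, i). to_nat_on A i)") auto

declare greedy_colour.simps [simp del]

lemma greedy_colour_props:
  fixes R :: "'i \<Rightarrow> 'i \<Rightarrow> bool" and A i
  defines "S \<equiv> {k \<in> A. to_nat_on A k < to_nat_on A i \<and> R i k}"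
  assumes A: "countable A"
  shows "greedy_colour R A i \<notin> greedy_colour R A ` S" "greedy_colour R A i \<le> card S"
proof -
  have S: "finite S"
    unfolding S_def by (rule finite_subset[OF _ finite_to_nat_on_less[OF A]]) auto
  let ?P = "\<lambda>c. c \<notin> greedy_colour R A ` S"
  \<comment> \<open>Pigeonhole: this set has \<open>card S + 1\<close> colours, one more than the
    earlier neighbours can occupy.\<close>
  have "\<not> {..card S} \<subseteq> greedy_colour R A ` S"
  proof
    assume "{..card S} \<subseteq> greedy_colour R A ` S"
    then have "card {..card S} \<le> card (greedy_colour R A ` S)"
      using S by (intro card_mono) auto
    then show False using card_image_le[OF S, of "greedy_colour R A"] by simp
  qed
  then obtain c where c: "c \<le> card S" "?P c" by auto
  have eq: "greedy_colour R A i = (LEAST c. ?P c)"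
    unfolding S_def by (rule greedy_colour.simps)
  show "?P (greedy_colour R A i)" unfolding eq by (rule LeastI[of ?P, OF c(2)])
  show "greedy_colour R A i \<le> card S"
    unfolding eq using Least_le[of ?P, OF c(2)] c(1) by linarith
qed

text \<open>The degree is bounded through finite sets of neighbours, the form in which the Bessel
  inequality supplies it. Loops are allowed, since a vertex is not among its own predecessors; the
  relation used later does have them.\<close>

lemma countable_graph_colouring:
  fixes R :: "'i \<Rightarrow> 'i \<Rightarrow> bool"
  assumes A: "countable A" and sym: "\<And>i j. R i j \<Longrightarrow> R j i"
    and deg: "\<And>i F. \<lbrakk>i \<in> A; finite F; F \<subseteq> A; \<forall>k\<in>F. R i k\<rbrakk> \<Longrightarrow> card F \<le> d"
  shows "\<exists>col :: 'i \<Rightarrow> nat. \<forall>i\<in>A. col i \<le> d \<and> (\<forall>j\<in>A. i \<noteq> j \<longrightarrow> R i j \<longrightarrow> col i \<noteq> col j)"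
proof (intro exI ballI conjI impI)
  fix i assume i: "i \<in> A"
  have "finite {k \<in> A. to_nat_on A k < to_nat_on A i \<and> R i k}"
    by (rule finite_subset[OF _ finite_to_nat_on_less[OF A]]) auto
  then show "greedy_colour R A i \<le> d"
    using greedy_colour_props(2)[OF A, of R i] deg[OF i] by force
  fix j assume j: "j \<in> A" and ne: "i \<noteq> j" and R: "R i j"
  have "to_nat_on A i \<noteq> to_nat_on A j"
    using inj_on_to_nat_on[OF A] i j ne by (auto simp: inj_on_def)
  then consider "to_nat_on A i < to_nat_on A j" | "to_nat_on A j < to_nat_on A i" by linarith
  then show "greedy_colour R A i \<noteq> greedy_colour R A j"
  proof cases
    case 1
    then have "greedy_colour R A i \<in> greedy_colour R A ` {k \<in> A. to_nat_on A k < to_nat_on A j \<and> R j k}"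
      using i sym[OF R] by blast
    then show ?thesis using greedy_colour_props(1)[OF A, of R j] by metis
  next
    case 2
    then have "greedy_colour R A j \<in> greedy_colour R A ` {k \<in> A. to_nat_on A k < to_nat_on A i \<and> R i k}"
      using j R by blast
    then show ?thesis using greedy_colour_props(1)[OF A, of R i] by metis
  qed
qed


lemma szego_gram_commute: "szego_gram w i j = cnj (szego_gram w j i)"
  by (simp add: szego_gram_def mult.commute)

section \<open>Partition of a Bessel family with a Szego Gram matrix\<close>

context hilbert_fspace
begin

text \<open>The phases \<open>u i\<close> are the freedom left when normalized kernels are carried
  to another space. They leave all moduli, hence the graph and the Bessel bound, unchanged.\<close>

theorem szego_bessel_partition:
  assumes disk: "\<And>i. i \<in> J \<Longrightarrow> cmod (w i) < 1"
    and u: "\<And>i. i \<in> J \<Longrightarrow> cmod (u i) = 1"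
    and gram: "\<And>i j. \<lbrakk>i \<in> J; j \<in> J\<rbrakk> \<Longrightarrow>
      cinner H (f j) (f i) = u j * cnj (u i) * szego_gram w i j"
    and bessel: "bessel_sequence H J f"
  shows "\<exists>\<A>. finite \<A> \<and> partition_on J \<A> \<and> (\<forall>A\<in>\<A>. riesz_basic_sequence H A f)"
proof -
  have J: "countable J" and f: "\<And>i. i \<in> J \<Longrightarrow> f i \<in> vectors H"
    using bessel by (auto simp: bessel_sequence_def)
  obtain B where B0: "B > 0" and B: "\<And>x. x \<in> vectors H \<Longrightarrow>
      (\<lambda>i. (cmod (cinner H x (f i)))\<^sup>2) summable_on J \<and>
      (\<Sum>\<^sub>\<infinity>i\<in>J. (cmod (cinner H x (f i)))\<^sup>2) \<le> B * (hnorm H x)\<^sup>2"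
    using bessel unfolding bessel_sequence_def by blast
  have Bfin: "(\<Sum>i\<in>I. (cmod (cinner H x (f i)))\<^sup>2) \<le> B * (hnorm H x)\<^sup>2"
    if "finite I" "I \<subseteq> J" "x \<in> vectors H" for I x
  proof -
    have "(\<Sum>i\<in>I. (cmod (cinner H x (f i)))\<^sup>2) \<le> (\<Sum>\<^sub>\<infinity>i\<in>J. (cmod (cinner H x (f i)))\<^sup>2)"
      using that B[of x] by (intro finite_sum_le_infsum) auto
    then show ?thesis using B[OF that(3)] by linarith
  qed
  have norm_f: "(hnorm H (f i))\<^sup>2 = 1" if i: "i \<in> J" for i
  proof -
    have "complex_of_real ((hnorm H (f i))\<^sup>2) = u i * cnj (u i) * szego_gram w i i"
      using cinner_self[OF f[OF i]] gram[OF i i] by simp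
    then have "\<bar>(hnorm H (f i))\<^sup>2\<bar> = cmod (u i * cnj (u i) * szego_gram w i i)"
      by (metis norm_of_real)
    then show ?thesis
      using u[OF i] cmod_szego_gram_self[of w i i] disk[OF i] by (simp add: norm_mult)
  qed
  \<comment> \<open>The Bessel inequality is tested on the unit vector \<open>f i\<close>.\<close>
  have gram_sum: "(\<Sum>k\<in>I. (cmod (szego_gram w i k))\<^sup>2) \<le> B"
    if I: "finite I" "I \<subseteq> J" and i: "i \<in> J" for I i
  proof -
    have "cmod (cinner H (f i) (f k)) = cmod (szego_gram w i k)" if "k \<in> I" for k
    proof -
      have k: "k \<in> J" using that I by blast
      show ?thesis
        using u[OF i] u[OF k] unfolding gram[OF k i] szego_gram_commute[of w k i]
        by (simp add: norm_mult)
    qed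
    then show ?thesis using Bfin[OF I f[OF i]] norm_f[OF i] by simp
  qed
  define R where "R i k \<longleftrightarrow> (cmod (szego_gram w i k))\<^sup>2 > 1/2" for i k
  \<comment> \<open>Each neighbour contributes more than 1/2 to a row sum bounded by
    \<open>B\<close>, so there are at most 2 * B of them.\<close>
  define d where "d = nat \<lfloor>2 * B\<rfloor>"
  have "card F \<le> d" if "i \<in> J" "finite F" "F \<subseteq> J" "\<forall>k\<in>F. R i k" for i F
  proof -
    have "real (card F) * (1/2) = (\<Sum>k\<in>F. 1/2)" by simp
    also have "\<dots> \<le> (\<Sum>k\<in>F. (cmod (szego_gram w i k))\<^sup>2)"
      using that(4) by (intro sum_mono) (auto simp: R_def)
    also have "\<dots> \<le> B" using that by (intro gram_sum)
    finally have "real (card F) \<le> 2 * B" by simp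
    then show ?thesis unfolding d_def by (simp add: le_nat_floor)
  qed
  moreover have "R j i" if "R i j" for i j
    using that unfolding R_def szego_gram_commute[of w i j] by simp
  ultimately obtain col :: "'a \<Rightarrow> nat" where
    col: "\<forall>i\<in>J. col i \<le> d \<and> (\<forall>j\<in>J. i \<noteq> j \<longrightarrow> R i j \<longrightarrow> col i \<noteq> col j)"
    using countable_graph_colouring[OF J, of R d] by blast
  define cls where "cls c = {i \<in> J. col i = c}" for c
  define \<A> where "\<A> = cls ` {..d} - {{}}"
  have "partition_on J \<A>"
    by (rule partition_onI) (use col in \<open>auto simp: \<A>_def cls_def disjnt_def\<close>)
  moreover have "finite \<A>" by (simp add: \<A>_def)
  moreover have "riesz_basic_sequence H (cls c) f" for c
  proof (rule riesz_basic_sequenceI)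
    have sub: "cls c \<subseteq> J" by (auto simp: cls_def)
    then show "countable (cls c)" using J by (rule countable_subset)
    show "f i \<in> vectors H" if "i \<in> cls c" for i using that f sub by blast
    show upper: "(hnorm H (\<lambda>z. \<Sum>i\<in>I. a i * f i z))\<^sup>2 \<le> B * (\<Sum>i\<in>I. (cmod (a i))\<^sup>2)"
      if I: "finite I" "I \<subseteq> cls c" for I a
      using f Bfin B0 I sub by (intro synthesis_bound) auto
    show "0 \<le> B" "0 \<le> B / exp (- 2 * B)" using B0 by simp_all
    show "(\<Sum>i\<in>I. (cmod (a i))\<^sup>2) \<le> B / exp (- 2 * B) * (hnorm H (\<lambda>z. \<Sum>i\<in>I. a i * f i z))\<^sup>2"
      if I: "finite I" "I \<subseteq> cls c" for I a
    proof -
      have IJ: "I \<subseteq> J" using I sub by blast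
      have sep: "(cmod (szego_gram w k l))\<^sup>2 \<le> 1/2" if "k \<in> I" "l \<in> I" "l \<noteq> k" for k l
      proof -
        have "k \<in> J" "l \<in> J" "col k = col l" using that I by (auto simp: cls_def)
        then have "\<not> R k l" using col that(3) by metis
        then show ?thesis by (simp add: R_def)
      qed
      have inj: "inj_on w I"
      proof (rule inj_onI, rule ccontr)
        fix k l assume kl: "k \<in> I" "l \<in> I" "w k = w l" "k \<noteq> l"
        then have "cmod (szego_gram w k l) = 1" using disk IJ by (intro cmod_szego_gram_self) auto
        then show False using sep[of k l] kl by simp
      qed
      have un: "cnj (u i) * u i = 1" if "i \<in> J" for i
        using u[OF that] complex_norm_square[of "u i"] by (simp add: mult.commute)
      \<comment> \<open>Removing the phases gives exactly the Szego Gram matrix; the coefficients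
        \<open>a i * u i\<close> compensate, so both the combination and the coefficient sum are
        those of the original family.\<close>
      let ?h = "\<lambda>i z. cnj (u i) * f i z"
      have "(\<Sum>i\<in>I. (cmod (a i * u i))\<^sup>2)
          \<le> B / exp (- 2 * B) * (hnorm H (\<lambda>z. \<Sum>i\<in>I. (a i * u i) * ?h i z))\<^sup>2"
      proof (rule szego_lower_bound[where w = w])
        show "finite I" by fact
        show "cmod (w k) < 1" if "k \<in> I" for k using that disk IJ by blast
        show "inj_on w I" by fact
        show "?h i \<in> vectors H" if "i \<in> I" for i using that f IJ by (auto intro!: scale_mem)
        show "cinner H (?h j) (?h i) = szego_gram w i j" if "i \<in> I" "j \<in> I" for i j
        proof -
          have ij: "i \<in> J" "j \<in> J" using that IJ by auto
          then have "cinner H (?h j) (?h i) = (cnj (u j) * u j) * (cnj (u i) * u i) * szego_gram w i j"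
            using f by (simp add: cinner_scale_left cinner_scale_right gram mult_ac)
          then show ?thesis using un ij by simp
        qed
        show "(hnorm H (\<lambda>z. \<Sum>i\<in>I. b i * ?h i z))\<^sup>2 \<le> B * (\<Sum>i\<in>I. (cmod (b i))\<^sup>2)" for b
        proof -
          have "(\<Sum>i\<in>I. (cmod (b i * cnj (u i)))\<^sup>2) = (\<Sum>i\<in>I. (cmod (b i))\<^sup>2)"
            using u IJ by (intro sum.cong) (auto simp: norm_mult)
          then show ?thesis using upper[OF I, of "\<lambda>i. b i * cnj (u i)"] by (simp add: mult.assoc)
        qed
        show "0 \<le> B" "0 < exp (- 2 * B)" using B0 by simp_all
        show "exp (- 2 * B) \<le> (cmod (blaschke_at w I k))\<^sup>2" if "k \<in> I" for k
          using that I(1) disk IJ sep gram_sum[OF I(1) IJ] by (intro blaschke_at_lower_bound) auto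
      qed
      moreover have "(\<Sum>i\<in>I. (cmod (a i * u i))\<^sup>2) = (\<Sum>i\<in>I. (cmod (a i))\<^sup>2)"
        using u IJ by (intro sum.cong) (auto simp: norm_mult)
      moreover have "(\<Sum>i\<in>I. (a i * u i) * ?h i z) = (\<Sum>i\<in>I. a i * f i z)" for z
      proof (intro sum.cong refl)
        fix i assume "i \<in> I"
        then have i: "i \<in> J" using IJ by blast
        have "(a i * u i) * ?h i z = a i * (cnj (u i) * u i) * f i z" by (simp add: mult_ac)
        then show "(a i * u i) * ?h i z = a i * f i z" by (simp only: un[OF i] mult_1_right)
      qed
      ultimately show ?thesis by simp
    qed
  qed
  then have "\<forall>A\<in>\<A>. riesz_basic_sequence H A f" by (auto simp: \<A>_def)
  ultimately show ?thesis by blast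
qed

end


section \<open>The Hardy space\<close>

lemma taylor_coeff_sums:
  assumes "f holomorphic_on ball 0 1" "cmod z < 1"
  shows "(\<lambda>n. taylor_coeff f n * z ^ n) sums f z"
  using holomorphic_power_series[of f 0 1 z] assms by (simp add: taylor_coeff_def)

lemma taylor_coeff_eqI:
  assumes "\<And>z. cmod z < 1 \<Longrightarrow> (\<lambda>n. a n * z ^ n) sums f z"
  shows "taylor_coeff f n = a n"
proof -
  have "\<forall>\<^sub>F z in nhds 0. z \<in> ball (0::complex) 1"
    by (rule eventually_nhds_in_open) auto
  then have "f has_fps_expansion Abs_fps a"
    using assms by (intro has_fps_expansionI) (auto elim!: eventually_mono)
  then show ?thesis
    using fps_nth_fps_expansion[of f "Abs_fps a" n] by (simp add: taylor_coeff_def)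
qed

lemma holomorphic_if_power_series:
  assumes "\<And>z. cmod z < 1 \<Longrightarrow> (\<lambda>n. a n * z ^ n) sums f z"
  shows "f holomorphic_on ball 0 1"
  by (rule power_series_holomorphic[where a = a]) (use assms in auto)

lemma H2_holomorphic: "f \<in> vectors H2 \<Longrightarrow> f holomorphic_on ball 0 1"
  by (simp add: H2_def)

lemma H2_outside: "\<lbrakk>f \<in> vectors H2; \<not> cmod z < 1\<rbrakk> \<Longrightarrow> f z = 0"
  by (simp add: H2_def)

lemma H2_summable: "f \<in> vectors H2 \<Longrightarrow> summable (\<lambda>n. (cmod (taylor_coeff f n))\<^sup>2)"
  by (simp add: H2_def)

lemma H2_sums: "\<lbrakk>f \<in> vectors H2; cmod z < 1\<rbrakk> \<Longrightarrow> (\<lambda>n. taylor_coeff f n * z ^ n) sums f z"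
  by (intro taylor_coeff_sums H2_holomorphic)

lemma H2_I:
  assumes "\<And>z. cmod z < 1 \<Longrightarrow> (\<lambda>n. a n * z ^ n) sums f z"
    and "\<And>z. \<not> cmod z < 1 \<Longrightarrow> f z = 0" and "summable (\<lambda>n. (cmod (a n))\<^sup>2)"
  shows "f \<in> vectors H2"
  using assms taylor_coeff_eqI[of a f] holomorphic_if_power_series[of a f] by (simp add: H2_def)

lemma H2_eqI:
  assumes f: "f \<in> vectors H2" and g: "g \<in> vectors H2"
    and eq: "\<And>n. taylor_coeff f n = taylor_coeff g n"
  shows "f = g"
proof
  fix z show "f z = g z"
    using H2_sums[OF f, of z] H2_sums[OF g, of z] H2_outside[OF f, of z] H2_outside[OF g, of z]
    by (cases "cmod z < 1") (auto simp: eq intro: sums_unique2)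
qed

lemma summable_mult_power2:
  fixes a b :: "nat \<Rightarrow> complex"
  assumes "summable (\<lambda>n. (cmod (a n))\<^sup>2)" "summable (\<lambda>n. (cmod (b n))\<^sup>2)"
  shows "summable (\<lambda>n. cmod (a n * b n))"
proof (rule summable_comparison_test')
  show "summable (\<lambda>n. (cmod (a n))\<^sup>2 + (cmod (b n))\<^sup>2)" using assms by (rule summable_add)
  fix n show "norm (cmod (a n * b n)) \<le> (cmod (a n))\<^sup>2 + (cmod (b n))\<^sup>2"
    using sum_squares_bound[of "cmod (a n)" "cmod (b n)"]
      mult_nonneg_nonneg[OF norm_ge_zero[of "a n"] norm_ge_zero[of "b n"]]
    unfolding norm_mult real_norm_def abs_mult abs_norm_cancel by linarith
qed

lemma summable_norm_add_power2:
  fixes a b :: "nat \<Rightarrow> complex"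
  assumes "summable (\<lambda>n. (cmod (a n))\<^sup>2)" "summable (\<lambda>n. (cmod (b n))\<^sup>2)"
  shows "summable (\<lambda>n. (cmod (a n + b n))\<^sup>2)"
proof (rule summable_comparison_test')
  show "summable (\<lambda>n. 2 * ((cmod (a n))\<^sup>2 + (cmod (b n))\<^sup>2))"
    using assms by (intro summable_mult summable_add)
  fix n
  have "(cmod (a n + b n))\<^sup>2 \<le> (cmod (a n) + cmod (b n))\<^sup>2"
    by (intro power_mono norm_triangle_ineq) auto
  then show "norm ((cmod (a n + b n))\<^sup>2) \<le> 2 * ((cmod (a n))\<^sup>2 + (cmod (b n))\<^sup>2)"
    using sum_squares_bound[of "cmod (a n)" "cmod (b n)"] by (simp add: power2_sum)
qed

lemma summable_norm_scale_power2:
  fixes a :: "nat \<Rightarrow> complex"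
  shows "summable (\<lambda>n. (cmod (a n))\<^sup>2) \<Longrightarrow> summable (\<lambda>n. (cmod (c * a n))\<^sup>2)"
  by (simp add: norm_mult power_mult_distrib summable_mult)

lemma summable_power_power2:
  assumes "cmod z < 1"
  shows "summable (\<lambda>n. (cmod (z ^ n))\<^sup>2)"
proof -
  have "(cmod (z ^ n))\<^sup>2 = ((cmod z)\<^sup>2) ^ n" for n
    by (simp add: norm_power power_mult[symmetric] mult.commute)
  moreover have "(cmod z)\<^sup>2 < 1" using assms by (simp add: abs_square_less_1)
  ultimately show ?thesis by (simp add: summable_geometric)
qed

text \<open>The value 0 outside the disk makes the result the canonical representative required of
  vectors of \<open>H2\<close>.\<close>

definition disk_series :: "(nat \<Rightarrow> complex) \<Rightarrow> complex \<Rightarrow> complex" where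
  "disk_series a z = (if cmod z < 1 then \<Sum>n. a n * z ^ n else 0)"

context
  fixes a :: "nat \<Rightarrow> complex"
  assumes a: "summable (\<lambda>n. (cmod (a n))\<^sup>2)"
begin

lemma disk_series_sums: "cmod z < 1 \<Longrightarrow> (\<lambda>n. a n * z ^ n) sums disk_series a z"
  using summable_norm_cancel[OF summable_mult_power2[OF a summable_power_power2[of z]]]
  by (simp add: disk_series_def summable_sums)

lemma disk_series_H2: "disk_series a \<in> vectors H2"
  using a by (intro H2_I[where a = a] disk_series_sums) (auto simp: disk_series_def)

lemma taylor_coeff_disk_series: "taylor_coeff (disk_series a) n = a n"
  by (intro taylor_coeff_eqI disk_series_sums)

end

lemma taylor_coeff_zero: "taylor_coeff (\<lambda>z. 0) n = 0"
  by (rule taylor_coeff_eqI[where a = "\<lambda>_. 0"]) simp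

lemma H2_zero: "(\<lambda>z. 0) \<in> vectors H2"
  by (rule H2_I[where a = "\<lambda>_. 0"]) simp_all

lemma taylor_coeff_add:
  "\<lbrakk>f \<in> vectors H2; g \<in> vectors H2\<rbrakk>
    \<Longrightarrow> taylor_coeff (\<lambda>z. f z + g z) n = taylor_coeff f n + taylor_coeff g n"
  using sums_add[OF H2_sums H2_sums]
  by (intro taylor_coeff_eqI[where a = "\<lambda>n. taylor_coeff f n + taylor_coeff g n"])
    (simp add: distrib_right)

lemma taylor_coeff_scale:
  "f \<in> vectors H2 \<Longrightarrow> taylor_coeff (\<lambda>z. c * f z) n = c * taylor_coeff f n"
  using sums_mult[OF H2_sums]
  by (intro taylor_coeff_eqI[where a = "\<lambda>n. c * taylor_coeff f n"]) (simp add: mult.assoc)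

lemma H2_add: "\<lbrakk>f \<in> vectors H2; g \<in> vectors H2\<rbrakk> \<Longrightarrow> (\<lambda>z. f z + g z) \<in> vectors H2"
  using taylor_coeff_add[of f g] summable_norm_add_power2[OF H2_summable[of f] H2_summable[of g]]
  by (auto simp: H2_def intro!: holomorphic_intros)

lemma H2_scale: "f \<in> vectors H2 \<Longrightarrow> (\<lambda>z. c * f z) \<in> vectors H2"
  using taylor_coeff_scale[of f c] summable_norm_scale_power2[OF H2_summable[of f], of c]
  by (auto simp: H2_def intro!: holomorphic_intros)

lemma H2_cinner: "cinner H2 f g = (\<Sum>n. taylor_coeff f n * cnj (taylor_coeff g n))"
  by (simp add: H2_def)

lemma H2_cinner_summable:
  assumes "f \<in> vectors H2" "g \<in> vectors H2"
  shows "summable (\<lambda>n. taylor_coeff f n * cnj (taylor_coeff g n))"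
  by (rule summable_norm_cancel, rule summable_mult_power2)
    (use H2_summable assms in simp_all)

lemma H2_cinner_sums:
  assumes "f \<in> vectors H2" "g \<in> vectors H2"
  shows "(\<lambda>n. taylor_coeff f n * cnj (taylor_coeff g n)) sums cinner H2 f g"
  unfolding H2_cinner using H2_cinner_summable[OF assms] by (rule summable_sums)

lemma H2_hnorm_sums:
  assumes f: "f \<in> vectors H2"
  shows "(\<lambda>n. (cmod (taylor_coeff f n))\<^sup>2) sums (hnorm H2 f)\<^sup>2"
proof -
  have "(\<lambda>n. Re (taylor_coeff f n * cnj (taylor_coeff f n))) sums Re (cinner H2 f f)"
    using H2_cinner_sums[OF f f] by (rule sums_Re)
  then have *: "(\<lambda>n. (cmod (taylor_coeff f n))\<^sup>2) sums Re (cinner H2 f f)"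
    by (simp only: complex_norm_square[symmetric] Re_complex_of_real)
  have "0 \<le> Re (cinner H2 f f)"
    by (rule sums_le[OF _ sums_zero *]) simp
  then show ?thesis using * by (simp add: hnorm_def)
qed

interpretation H2: inner_fspace H2
proof
  fix f g h :: "complex \<Rightarrow> complex" and c :: complex
  show "(\<lambda>z. 0) \<in> vectors H2" by (rule H2_zero)
  assume f: "f \<in> vectors H2"
  show "(\<lambda>z. c * f z) \<in> vectors H2" using f by (rule H2_scale)
  show "0 \<le> Re (cinner H2 f f)"
    using sums_le[OF _ sums_zero sums_Re[OF H2_cinner_sums[OF f f]]]
    by (simp add: complex_mult_cnj)
  show "f = (\<lambda>z. 0)" if "cinner H2 f f = 0"
  proof (rule H2_eqI[OF f H2_zero])
    fix n
    have s: "(\<lambda>n. (cmod (taylor_coeff f n))\<^sup>2) sums 0"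
      using H2_hnorm_sums[OF f] that by (simp add: hnorm_def)
    then have "(cmod (taylor_coeff f n))\<^sup>2 = 0"
      using suminf_eq_zero_iff[of "\<lambda>n. (cmod (taylor_coeff f n))\<^sup>2"]
      by (auto simp: sums_iff)
    then show "taylor_coeff f n = taylor_coeff (\<lambda>z. 0) n" by (simp add: taylor_coeff_zero)
  qed
  assume g: "g \<in> vectors H2"
  show "(\<lambda>z. f z + g z) \<in> vectors H2" using f g by (rule H2_add)
  show "cinner H2 f g = cnj (cinner H2 g f)"
    using sums_cnj[THEN iffD2, OF H2_cinner_sums[OF g f]] H2_cinner_sums[OF f g]
    by (auto simp: mult.commute intro: sums_unique2)
  show "cinner H2 (\<lambda>z. c * f z) g = c * cinner H2 f g"
    using sums_mult[OF H2_cinner_sums[OF f g], of c] H2_cinner_sums[OF H2_scale[OF f, of c] g]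
    by (auto simp: taylor_coeff_scale[OF f] mult.assoc intro: sums_unique2)
  assume h: "h \<in> vectors H2"
  show "cinner H2 (\<lambda>z. f z + g z) h = cinner H2 f h + cinner H2 g h"
    using sums_add[OF H2_cinner_sums[OF f h] H2_cinner_sums[OF g h]]
      H2_cinner_sums[OF H2_add[OF f g] h]
    by (auto simp: taylor_coeff_add[OF f g] distrib_right intro: sums_unique2)
qed

lemma taylor_coeff_diff:
  assumes "f \<in> vectors H2" "g \<in> vectors H2"
  shows "taylor_coeff (\<lambda>z. f z - g z) n = taylor_coeff f n - taylor_coeff g n"
  using taylor_coeff_add[of f "\<lambda>z. (-1) * g z" n] taylor_coeff_scale[of g "-1" n]
    H2_scale[of g "-1"] assms by simp

lemma H2_partial_sum_le:
  assumes "f \<in> vectors H2"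
  shows "(\<Sum>n<N. (cmod (taylor_coeff f n))\<^sup>2) \<le> (hnorm H2 f)\<^sup>2"
  using H2_hnorm_sums[OF assms] sum_le_suminf[of "\<lambda>n. (cmod (taylor_coeff f n))\<^sup>2" "{..<N}"]
  by (simp add: sums_iff)

lemma H2_hnorm_le:
  assumes f: "f \<in> vectors H2" and le: "\<And>N. (\<Sum>n<N. (cmod (taylor_coeff f n))\<^sup>2) \<le> K"
  shows "(hnorm H2 f)\<^sup>2 \<le> K"
  using H2_hnorm_sums[OF f] suminf_le_const[of "\<lambda>n. (cmod (taylor_coeff f n))\<^sup>2" K] le
  by (simp add: sums_iff)

text \<open>The usual completeness proof for square summable sequences: coefficients converge one by
  one, and letting n grow in partial sums of fixed length bounds the distance to the limit sequence
  uniformly in that length.\<close>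

interpretation H2: hilbert_fspace H2
proof
  fix X :: "nat \<Rightarrow> complex \<Rightarrow> complex"
  assume X: "\<And>n. X n \<in> vectors H2"
    and Cau: "\<And>e. e > 0 \<Longrightarrow> \<exists>N. \<forall>m\<ge>N. \<forall>n\<ge>N. hnorm H2 (\<lambda>z. X m z - X n z) < e"
  define a where "a n = taylor_coeff (X n)" for n
  have part: "(\<Sum>k<K. (cmod (a m k - a n k))\<^sup>2) \<le> (hnorm H2 (\<lambda>z. X m z - X n z))\<^sup>2" for m n K
    using H2_partial_sum_le[of "\<lambda>z. X m z - X n z"] X
    by (simp add: a_def taylor_coeff_diff)
  have coeff: "cmod (a m k - a n k) \<le> hnorm H2 (\<lambda>z. X m z - X n z)" for m n k
  proof (rule power2_le_imp_le)
    have "(cmod (a m k - a n k))\<^sup>2 \<le> (\<Sum>k<Suc k. (cmod (a m k - a n k))\<^sup>2)"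
      by (rule member_le_sum) auto
    then show "(cmod (a m k - a n k))\<^sup>2 \<le> (hnorm H2 (\<lambda>z. X m z - X n z))\<^sup>2"
      using part[where K = "Suc k"] order_trans by blast
  qed (use X in simp)
  have "Cauchy (\<lambda>n. a n k)" for k
  proof (rule metric_CauchyI)
    fix e :: real assume "e > 0"
    then obtain N where "\<forall>m\<ge>N. \<forall>n\<ge>N. hnorm H2 (\<lambda>z. X m z - X n z) < e" using Cau by blast
    then show "\<exists>N. \<forall>m\<ge>N. \<forall>n\<ge>N. dist (a m k) (a n k) < e"
      unfolding dist_norm using le_less_trans[OF coeff] by blast
  qed
  then have "\<exists>l. (\<lambda>n. a n k) \<longlonglongrightarrow> l" for k
    using Cauchy_convergent convergent_def by blast
  then obtain b where b: "\<And>k. (\<lambda>n. a n k) \<longlonglongrightarrow> b k" by metis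
  have tail: "\<exists>N. \<forall>m\<ge>N. \<forall>K. (\<Sum>k<K. (cmod (a m k - b k))\<^sup>2) \<le> e\<^sup>2" if e: "e > 0" for e :: real
  proof -
    obtain N where N: "\<And>m n. \<lbrakk>m \<ge> N; n \<ge> N\<rbrakk> \<Longrightarrow> hnorm H2 (\<lambda>z. X m z - X n z) < e"
      using Cau[OF e] by blast
    have "(\<Sum>k<K. (cmod (a m k - b k))\<^sup>2) \<le> e\<^sup>2" if m: "m \<ge> N" for m K
    proof (rule LIMSEQ_le_const2)
      show "(\<lambda>n. \<Sum>k<K. (cmod (a m k - a n k))\<^sup>2) \<longlonglongrightarrow> (\<Sum>k<K. (cmod (a m k - b k))\<^sup>2)"
        using b by (intro tendsto_intros)
      have "(\<Sum>k<K. (cmod (a m k - a n k))\<^sup>2) \<le> e\<^sup>2" if "n \<ge> N" for n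
      proof -
        have "(hnorm H2 (\<lambda>z. X m z - X n z))\<^sup>2 \<le> e\<^sup>2"
          using N[OF m that] X by (intro power_mono) auto
        then show ?thesis using part order_trans by blast
      qed
      then show "\<exists>N. \<forall>n\<ge>N. (\<Sum>k<K. (cmod (a m k - a n k))\<^sup>2) \<le> e\<^sup>2" by blast
    qed
    then show ?thesis by blast
  qed
  obtain M where M: "\<And>K. (\<Sum>k<K. (cmod (a M k - b k))\<^sup>2) \<le> 1\<^sup>2"
    using tail[OF zero_less_one] by blast
  have "summable (\<lambda>k. (cmod (a M k - b k))\<^sup>2)"
    using M by (intro summableI_nonneg_bounded[of _ "1\<^sup>2"]) auto
  \<comment> \<open>The limit sequence is written as a square summable sequence minus a square
    summable difference.\<close>
  then have "summable (\<lambda>k. (cmod (a M k + (-1) * (a M k - b k)))\<^sup>2)"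
    using H2_summable[OF X[of M]]
    by (intro summable_norm_add_power2 summable_norm_scale_power2) (auto simp: a_def)
  then have bs: "summable (\<lambda>k. (cmod (b k))\<^sup>2)" by simp
  define l where "l = disk_series b"
  have l: "l \<in> vectors H2" unfolding l_def using bs by (rule disk_series_H2)
  have lk: "taylor_coeff l k = b k" for k
    unfolding l_def using bs by (rule taylor_coeff_disk_series)
  have "(\<lambda>n. hnorm H2 (\<lambda>z. X n z - l z)) \<longlonglongrightarrow> 0"
  proof (rule LIMSEQ_I)
    fix r :: real assume r: "r > 0"
    then obtain N where N: "\<forall>m\<ge>N. \<forall>K. (\<Sum>k<K. (cmod (a m k - b k))\<^sup>2) \<le> (r/2)\<^sup>2"
      using tail[of "r/2"] by auto
    have "norm (hnorm H2 (\<lambda>z. X m z - l z) - 0) < r" if "m \<ge> N" for m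
    proof -
      have mem: "(\<lambda>z. X m z - l z) \<in> vectors H2" using X[of m] l by (rule H2.diff_mem)
      have coeffs: "taylor_coeff (\<lambda>z. X m z - l z) k = a m k - b k" for k
        using X[of m] l by (simp add: taylor_coeff_diff lk a_def)
      have "(hnorm H2 (\<lambda>z. X m z - l z))\<^sup>2 \<le> (r/2)\<^sup>2"
        using N that by (intro H2_hnorm_le mem) (simp only: coeffs)
      then have "hnorm H2 (\<lambda>z. X m z - l z) \<le> r/2"
        by (rule power2_le_imp_le) (use r in simp)
      then show ?thesis using r H2.hnorm_nonneg[OF mem] by simp
    qed
    then show "\<exists>N. \<forall>n\<ge>N. norm (hnorm H2 (\<lambda>z. X n z - l z) - 0) < r" by blast
  qed
  then show "\<exists>l\<in>vectors H2. (\<lambda>n. hnorm H2 (\<lambda>z. X n z - l z)) \<longlonglongrightarrow> 0" using l by blast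
qed

section \<open>The Szego kernel\<close>

definition szego_kernel :: "complex \<Rightarrow> complex \<Rightarrow> complex" where
  "szego_kernel w = disk_series (\<lambda>n. cnj w ^ n)"

context
  fixes w :: complex
  assumes w: "cmod w < 1"
begin

lemma szego_kernel_H2: "szego_kernel w \<in> vectors H2"
  unfolding szego_kernel_def using summable_power_power2[of "cnj w"] w
  by (intro disk_series_H2) simp

lemma szego_kernel_reproducing:
  assumes f: "f \<in> vectors H2"
  shows "cinner H2 f (szego_kernel w) = f w"
proof -
  have "taylor_coeff (szego_kernel w) n = cnj w ^ n" for n
    unfolding szego_kernel_def using summable_power_power2[of "cnj w"] w
    by (intro taylor_coeff_disk_series) simp
  then have "(\<lambda>n. taylor_coeff f n * w ^ n) sums cinner H2 f (szego_kernel w)"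
    using H2_cinner_sums[OF f szego_kernel_H2] by simp
  then show ?thesis using H2_sums[OF f w] by (rule sums_unique2)
qed

lemma szego_kernel_eq:
  assumes z: "cmod z < 1"
  shows "szego_kernel w z = 1 / (1 - z * cnj w)"
proof -
  have "cmod (z * cnj w) < 1 * 1"
    unfolding norm_mult using w z by (intro mult_strict_mono') auto
  then have "(\<lambda>n. (z * cnj w) ^ n) sums (1 / (1 - z * cnj w))"
    by (intro geometric_sums) simp
  then show ?thesis
    using z by (simp add: szego_kernel_def disk_series_def sums_iff power_mult_distrib mult.commute)
qed

end


section \<open>Inner functions act isometrically\<close>

text \<open>Lebesgue measure without normalization, hence the factors 2 * pi below; it matches the
  almost-everywhere condition in \<open>inner_function\<close>.\<close>

definition circle :: "real measure" where
  "circle = restrict_space lborel {0..2*pi}"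

lemma circle_measurable: "continuous_on UNIV f \<Longrightarrow> f \<in> borel_measurable circle"
  unfolding circle_def by (intro measurable_restrict_space1) (auto intro: borel_measurable_continuous_onI)

lemma circle_integrable:
  fixes f :: "real \<Rightarrow> 'a :: {banach, second_countable_topology}"
  shows "continuous_on UNIV f \<Longrightarrow> integrable circle f"
  unfolding circle_def
  using borel_integrable_compact[of "{0..2*pi}" f]
  by (subst integrable_restrict_space) (auto intro: continuous_on_subset)

lemma finite_measure_circle: "finite_measure circle"
  unfolding circle_def by (rule finite_measureI) (simp add: emeasure_restrict_space space_restrict_space)

lemma circle_integral_cis_powers:
  "(LINT t|circle. cis t ^ n * cnj (cis t ^ m)) = (if n = m then of_real (2 * pi) else 0)"
proof -
  define k where "k = real n - real m"
  have eq: "cis t ^ n * cnj (cis t ^ m) = cis (k * t)" for t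
    by (simp add: k_def Complex.DeMoivre cis_cnj cis_mult left_diff_distrib)
  have "(LINT t|circle. cis t ^ n * cnj (cis t ^ m))
      = (\<integral>t. indicator {0..2*pi} t *\<^sub>R cis (k * t) \<partial>lborel)"
    unfolding eq circle_def by (rule integral_restrict_space) simp
  also have "\<dots> = (if n = m then of_real (2 * pi) else 0)"
  proof (cases "n = m")
    case True
    have "(\<integral>t. indicator {0..2*pi} t *\<^sub>R (1::complex) \<partial>lborel) = of_real (2 * pi) - of_real 0"
      by (rule integral_FTC_Icc) (auto intro!: derivative_eq_intros has_vector_derivative_of_real continuous_intros)
    then show ?thesis using True by (simp add: k_def)
  next
    case False
    then have k: "k \<noteq> 0" by (simp add: k_def)
    have "((\<lambda>t. cis (k * t) / (\<i> * of_real k)) has_vector_derivative cis (k * t)) (at t within A)"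
      for t A
      unfolding has_vector_derivative_def using k
      by (auto intro!: derivative_eq_intros simp: scaleR_conv_of_real field_simps)
    then have "(\<integral>t. indicator {0..2*pi} t *\<^sub>R cis (k * t) \<partial>lborel)
        = cis (k * (2 * pi)) / (\<i> * of_real k) - cis (k * 0) / (\<i> * of_real k)"
      by (intro integral_FTC_Icc) (auto intro!: continuous_intros)
    moreover have "k \<in> \<int>" by (simp add: k_def)
    ultimately show ?thesis
      using False cis_multiple_2pi[of k] by (simp add: mult.commute)
  qed
  finally show ?thesis .
qed

lemma Parseval_finite:
  "(LINT t|circle. (cmod (\<Sum>n<N. c n * cis t ^ n))\<^sup>2) = 2 * pi * (\<Sum>n<N. (cmod (c n))\<^sup>2)"
proof -
  have "complex_of_real (LINT t|circle. (cmod (\<Sum>n<N. c n * cis t ^ n))\<^sup>2)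
      = (LINT t|circle. complex_of_real ((cmod (\<Sum>n<N. c n * cis t ^ n))\<^sup>2))"
    by (rule integral_complex_of_real[symmetric])
  also have "\<dots> = (LINT t|circle. (\<Sum>n<N. \<Sum>m<N. (c n * cnj (c m)) * (cis t ^ n * cnj (cis t ^ m))))"
    by (simp add: complex_norm_square sum_product mult_ac del: of_real_power)
  also have "\<dots> = (\<Sum>n<N. \<Sum>m<N. (c n * cnj (c m)) * (LINT t|circle. cis t ^ n * cnj (cis t ^ m)))"
    by (simp add: Bochner_Integration.integral_sum circle_integrable continuous_intros)
  also have "\<dots> = (\<Sum>n<N. \<Sum>m<N. if n = m then c n * cnj (c m) * of_real (2 * pi) else 0)"
    unfolding circle_integral_cis_powers by (intro sum.cong) auto
  also have "\<dots> = (\<Sum>n<N. c n * cnj (c n) * of_real (2 * pi))"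
    by (intro sum.cong) simp_all
  also have "\<dots> = of_real (2 * pi * (\<Sum>n<N. (cmod (c n))\<^sup>2))"
    by (simp add: complex_norm_square[symmetric] sum_distrib_left mult_ac)
  finally show ?thesis using of_real_eq_iff by blast
qed

text \<open>Absolute summability bounds all partial sums by one constant, which is integrable on the
  circle, so the finite identity passes to the limit by dominated convergence.\<close>

lemma Parseval:
  assumes c: "summable (\<lambda>n. cmod (c n))"
    and g: "\<And>t. (\<lambda>n. c n * cis t ^ n) sums g t"
  shows "(\<lambda>n. 2 * pi * (cmod (c n))\<^sup>2) sums (LINT t|circle. (cmod (g t))\<^sup>2)"
proof -
  interpret finite_measure circle by (rule finite_measure_circle)
  let ?s = "\<lambda>N t. (cmod (\<Sum>n<N. c n * cis t ^ n))\<^sup>2"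
  have s: "?s N \<in> borel_measurable circle" for N
    by (intro circle_measurable continuous_intros)
  have lim: "(\<lambda>N. ?s N t) \<longlonglongrightarrow> (cmod (g t))\<^sup>2" for t
    using g[of t] unfolding sums_def by (intro tendsto_intros)
  have "(\<lambda>N. LINT t|circle. ?s N t) \<longlonglongrightarrow> (LINT t|circle. (cmod (g t))\<^sup>2)"
  proof (rule integral_dominated_convergence[where w = "\<lambda>_. (\<Sum>n. cmod (c n))\<^sup>2"])
    show "(\<lambda>t. (cmod (g t))\<^sup>2) \<in> borel_measurable circle"
      by (rule borel_measurable_LIMSEQ_metric[OF s lim])
    have "norm (?s N t) \<le> (\<Sum>n. cmod (c n))\<^sup>2" for N t
    proof -
      have "cmod (\<Sum>n<N. c n * cis t ^ n) \<le> (\<Sum>n<N. cmod (c n))"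
        by (rule order_trans[OF norm_sum]) (simp add: norm_mult norm_power)
      also have "\<dots> \<le> (\<Sum>n. cmod (c n))" using c by (intro sum_le_suminf) auto
      finally show ?thesis by (simp add: power_mono)
    qed
    then show "AE t in circle. norm (?s N t) \<le> (\<Sum>n. cmod (c n))\<^sup>2" for N by simp
  qed (simp_all only: s lim integrable_const AE_I2)
  then show ?thesis
    by (simp add: sums_def Parseval_finite sum_distrib_left)
qed

lemma circle_continuous:
  assumes f: "f holomorphic_on ball 0 1" and r: "0 \<le> r" "r < 1"
  shows "continuous_on UNIV (\<lambda>t. f (of_real r * cis t))"
proof (rule continuous_on_compose2[OF holomorphic_on_imp_continuous_on[OF f]])
  show "continuous_on UNIV (\<lambda>t. complex_of_real r * cis t)" by (intro continuous_intros)
qed (use r in \<open>auto simp: norm_mult\<close>)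

lemma Parseval_radius:
  assumes f: "f holomorphic_on ball 0 1" and r: "0 \<le> r" "r < 1"
  shows "(\<lambda>n. 2 * pi * ((cmod (taylor_coeff f n))\<^sup>2 * r ^ (2 * n)))
    sums (LINT t|circle. (cmod (f (of_real r * cis t)))\<^sup>2)"
proof -
  let ?c = "\<lambda>n. taylor_coeff f n * of_real r ^ n"
  have "summable (\<lambda>n. cmod (?c n))"
  proof (rule powser_insidea)
    \<comment> \<open>A point strictly between r and 1: convergence of the power series there gives
      absolute convergence at r.\<close>
    let ?r' = "complex_of_real ((1 + r) / 2)"
    have nr: "cmod ?r' = (1 + r) / 2" using r by (simp only: norm_of_real) simp
    then show "summable (\<lambda>n. taylor_coeff f n * ?r' ^ n)"
      using r by (intro sums_summable[OF taylor_coeff_sums[OF f]]) simp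
    show "cmod (complex_of_real r) < cmod ?r'" unfolding nr using r by simp
  qed
  moreover have "(\<lambda>n. ?c n * cis t ^ n) sums f (of_real r * cis t)" for t
    using taylor_coeff_sums[OF f, of "of_real r * cis t"] r
    by (simp add: norm_mult power_mult_distrib mult.assoc)
  ultimately have "(\<lambda>n. 2 * pi * (cmod (?c n))\<^sup>2)
      sums (LINT t|circle. (cmod (f (of_real r * cis t)))\<^sup>2)"
    by (rule Parseval)
  moreover have "(cmod (?c n))\<^sup>2 = (cmod (taylor_coeff f n))\<^sup>2 * r ^ (2 * n)" for n
    using r by (simp add: norm_mult norm_power power_mult_distrib power_mult[symmetric] mult.commute[of 2])
  ultimately show ?thesis by (simp only:)
qed

lemma radius_integral_le:
  assumes f: "f \<in> vectors H2" and r: "0 \<le> r" "r < 1"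
  shows "(LINT t|circle. (cmod (f (of_real r * cis t)))\<^sup>2) \<le> 2 * pi * (hnorm H2 f)\<^sup>2"
proof (rule sums_le[OF _ Parseval_radius[OF H2_holomorphic[OF f] r]])
  show "(\<lambda>n. 2 * pi * (cmod (taylor_coeff f n))\<^sup>2) sums (2 * pi * (hnorm H2 f)\<^sup>2)"
    using H2_hnorm_sums[OF f] by (rule sums_mult)
  show "2 * pi * ((cmod (taylor_coeff f n))\<^sup>2 * r ^ (2 * n)) \<le> 2 * pi * (cmod (taylor_coeff f n))\<^sup>2" for n
    using r by (simp add: mult_left_le power_le_one)
qed

text \<open>For fixed N the first N Parseval terms are continuous in the radius, so the radii tend
  to 1 before N grows. This recovers an \<open>H2\<close> bound from integral means.\<close>

lemma taylor_coeff_bound_of_radius_integrals: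
  assumes f: "f holomorphic_on ball 0 1"
    and r: "\<And>k. 0 \<le> r k" "\<And>k. r k < 1" "r \<longlonglongrightarrow> 1" and Q: "q \<longlonglongrightarrow> Q"
    and le: "\<And>k. (LINT t|circle. (cmod (f (of_real (r k) * cis t)))\<^sup>2) \<le> q k"
  shows "2 * pi * (\<Sum>n<N. (cmod (taylor_coeff f n))\<^sup>2) \<le> Q"
proof (rule LIMSEQ_le[OF _ Q])
  have "(\<lambda>k. \<Sum>n<N. 2 * pi * ((cmod (taylor_coeff f n))\<^sup>2 * r k ^ (2 * n)))
      \<longlonglongrightarrow> (\<Sum>n<N. 2 * pi * ((cmod (taylor_coeff f n))\<^sup>2 * 1 ^ (2 * n)))"
    using r(3) by (intro tendsto_intros)
  then show "(\<lambda>k. \<Sum>n<N. 2 * pi * ((cmod (taylor_coeff f n))\<^sup>2 * r k ^ (2 * n)))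
      \<longlonglongrightarrow> 2 * pi * (\<Sum>n<N. (cmod (taylor_coeff f n))\<^sup>2)"
    by (simp add: sum_distrib_left)
  have "(\<Sum>n<N. 2 * pi * ((cmod (taylor_coeff f n))\<^sup>2 * r k ^ (2 * n))) \<le> q k" for k
  proof -
    note s = Parseval_radius[OF f r(1,2), of k]
    have "(\<Sum>n<N. 2 * pi * ((cmod (taylor_coeff f n))\<^sup>2 * r k ^ (2 * n)))
        \<le> (\<Sum>n. 2 * pi * ((cmod (taylor_coeff f n))\<^sup>2 * r k ^ (2 * n)))"
      using r(1) by (intro sum_le_suminf sums_summable[OF s]) auto
    then show ?thesis using le[of k] s by (simp add: sums_iff)
  qed
  then show "\<exists>N'. \<forall>k\<ge>N'. (\<Sum>n<N. 2 * pi * ((cmod (taylor_coeff f n))\<^sup>2 * r k ^ (2 * n))) \<le> q k"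
    by blast
qed

text \<open>A concrete sequence of radii increasing to 1, since dominated convergence is applied
  along sequences.\<close>

definition radius :: "nat \<Rightarrow> real" where
  "radius k = 1 - inverse (real (Suc k))"

lemma radius: "0 \<le> radius k" "radius k < 1" "radius \<longlonglongrightarrow> 1"
proof -
  show "0 \<le> radius k" "radius k < 1" by (simp_all add: radius_def field_simps)
  have "(\<lambda>k. 1 - inverse (real (Suc k))) \<longlonglongrightarrow> 1 - 0"
    by (intro tendsto_intros LIMSEQ_inverse_real_of_nat)
  then show "radius \<longlonglongrightarrow> 1" by (simp add: radius_def[abs_def])
qed

lemma radius_at_left: "filterlim radius (at_left 1) sequentially"
  unfolding filterlim_at using radius by (auto intro!: always_eventually simp: less_imp_neq)

section \<open>Bounded multipliers and polynomial approximation\<close>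

context
  fixes \<phi> :: "complex \<Rightarrow> complex" and C :: real
  assumes hol: "\<phi> holomorphic_on ball 0 1" and bd: "\<And>z. cmod z < 1 \<Longrightarrow> cmod (\<phi> z) \<le> C"
begin

lemma bounded_multiplier_coeff:
  assumes f: "f \<in> vectors H2"
  shows "(\<Sum>n<N. (cmod (taylor_coeff (\<lambda>z. \<phi> z * f z) n))\<^sup>2) \<le> C\<^sup>2 * (hnorm H2 f)\<^sup>2"
proof -
  have hf: "f holomorphic_on ball 0 1" using f by (rule H2_holomorphic)
  have hol2: "(\<lambda>z. \<phi> z * f z) holomorphic_on ball 0 1"
    using hol hf by (rule holomorphic_on_mult)
  have "2 * pi * (\<Sum>n<N. (cmod (taylor_coeff (\<lambda>z. \<phi> z * f z) n))\<^sup>2)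
      \<le> C\<^sup>2 * (2 * pi * (hnorm H2 f)\<^sup>2)"
  proof (rule taylor_coeff_bound_of_radius_integrals[OF hol2 radius tendsto_const])
    fix k
    let ?z = "\<lambda>t. complex_of_real (radius k) * cis t"
    have z: "cmod (?z t) < 1" for t using radius(1,2)[of k] by (simp add: norm_mult)
    have "(LINT t|circle. (cmod (\<phi> (?z t) * f (?z t)))\<^sup>2)
        \<le> (LINT t|circle. C\<^sup>2 * (cmod (f (?z t)))\<^sup>2)"
    proof (rule integral_mono)
      show "integrable circle (\<lambda>t. (cmod (\<phi> (?z t) * f (?z t)))\<^sup>2)"
        by (intro circle_integrable continuous_on_power continuous_on_norm
            circle_continuous[OF hol2 radius(1,2)])
      show "integrable circle (\<lambda>t. C\<^sup>2 * (cmod (f (?z t)))\<^sup>2)"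
        using circle_continuous[OF hf radius(1,2), of k]
        by (intro circle_integrable continuous_intros)
      show "(cmod (\<phi> (?z t) * f (?z t)))\<^sup>2 \<le> C\<^sup>2 * (cmod (f (?z t)))\<^sup>2" for t
        unfolding norm_mult power_mult_distrib using bd[OF z] by (intro mult_right_mono power_mono) auto
    qed
    also have "\<dots> \<le> C\<^sup>2 * (2 * pi * (hnorm H2 f)\<^sup>2)"
      using radius_integral_le[OF f radius(1,2), of k] by (simp add: mult_left_mono)
    finally show "(LINT t|circle. (cmod (\<phi> (?z t) * f (?z t)))\<^sup>2) \<le> C\<^sup>2 * (2 * pi * (hnorm H2 f)\<^sup>2)" .
  qed
  then have "2 * pi * (\<Sum>n<N. (cmod (taylor_coeff (\<lambda>z. \<phi> z * f z) n))\<^sup>2)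
      \<le> 2 * pi * (C\<^sup>2 * (hnorm H2 f)\<^sup>2)" by (simp add: mult_ac)
  then show ?thesis by (rule mult_left_le_imp_le) simp
qed

lemma bounded_multiplier_H2:
  assumes f: "f \<in> vectors H2"
  shows "(\<lambda>z. \<phi> z * f z) \<in> vectors H2"
proof (rule H2_I[OF taylor_coeff_sums])
  show "(\<lambda>z. \<phi> z * f z) holomorphic_on ball 0 1"
    using hol H2_holomorphic[OF f] by (rule holomorphic_on_mult)
  show "\<phi> z * f z = 0" if "\<not> cmod z < 1" for z using H2_outside[OF f that] by simp
  show "summable (\<lambda>n. (cmod (taylor_coeff (\<lambda>z. \<phi> z * f z) n))\<^sup>2)"
    using bounded_multiplier_coeff[OF f] by (intro summableI_nonneg_bounded) auto
qed

lemma bounded_multiplier_hnorm: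
  assumes f: "f \<in> vectors H2"
  shows "hnorm H2 (\<lambda>z. \<phi> z * f z) \<le> \<bar>C\<bar> * hnorm H2 f"
proof (rule power2_le_imp_le)
  show "(hnorm H2 (\<lambda>z. \<phi> z * f z))\<^sup>2 \<le> (\<bar>C\<bar> * hnorm H2 f)\<^sup>2"
    using H2_hnorm_le[OF bounded_multiplier_H2[OF f] bounded_multiplier_coeff[OF f]]
    by (simp add: power_mult_distrib)
qed (use f in simp)

end

definition truncation :: "nat \<Rightarrow> (complex \<Rightarrow> complex) \<Rightarrow> complex \<Rightarrow> complex" where
  "truncation N f = disk_series (\<lambda>n. if n < N then taylor_coeff f n else 0)"

lemma truncation:
  shows truncation_H2: "truncation N f \<in> vectors H2"
    and taylor_coeff_truncation:
      "taylor_coeff (truncation N f) n = (if n < N then taylor_coeff f n else 0)"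
    and truncation_eq: "cmod z < 1 \<Longrightarrow> truncation N f z = (\<Sum>n<N. taylor_coeff f n * z ^ n)"
proof -
  have "summable (\<lambda>n. (cmod (if n < N then taylor_coeff f n else 0))\<^sup>2)"
    by (rule summable_finite[of "{..<N}"]) auto
  then show "truncation N f \<in> vectors H2"
    "taylor_coeff (truncation N f) n = (if n < N then taylor_coeff f n else 0)"
    unfolding truncation_def by (rule disk_series_H2, rule taylor_coeff_disk_series)
  assume z: "cmod z < 1"
  have "(\<Sum>n. (if n < N then taylor_coeff f n else 0) * z ^ n)
      = (\<Sum>n<N. (if n < N then taylor_coeff f n else 0) * z ^ n)"
    by (rule suminf_finite) auto
  then show "truncation N f z = (\<Sum>n<N. taylor_coeff f n * z ^ n)"
    using z by (simp add: truncation_def disk_series_def)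
qed

lemma hnorm_truncation: "(hnorm H2 (truncation N f))\<^sup>2 = (\<Sum>n<N. (cmod (taylor_coeff f n))\<^sup>2)"
proof -
  have "(\<lambda>n. (cmod (taylor_coeff (truncation N f) n))\<^sup>2)
      sums (\<Sum>n<N. (cmod (taylor_coeff (truncation N f) n))\<^sup>2)"
    by (rule sums_finite) (auto simp: taylor_coeff_truncation)
  then show ?thesis
    using H2_hnorm_sums[OF truncation_H2, of N f] sums_unique2
    by (fastforce simp: taylor_coeff_truncation)
qed

text \<open>The squared error is the tail of the convergent coefficient series.\<close>

lemma truncation_tendsto:
  assumes f: "f \<in> vectors H2"
  shows "(\<lambda>N. hnorm H2 (\<lambda>z. f z - truncation N f z)) \<longlonglongrightarrow> 0"
proof -
  have "(hnorm H2 (\<lambda>z. f z - truncation N f z))\<^sup>2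
      = (hnorm H2 f)\<^sup>2 - (\<Sum>n<N. (cmod (taylor_coeff f n))\<^sup>2)" for N
  proof -
    have "(\<lambda>n. (cmod (taylor_coeff f n))\<^sup>2 - (cmod (taylor_coeff (truncation N f) n))\<^sup>2)
        sums ((hnorm H2 f)\<^sup>2 - (hnorm H2 (truncation N f))\<^sup>2)"
      by (intro sums_diff H2_hnorm_sums f truncation_H2)
    moreover have "(cmod (taylor_coeff f n))\<^sup>2 - (cmod (taylor_coeff (truncation N f) n))\<^sup>2
        = (cmod (taylor_coeff (\<lambda>z. f z - truncation N f z) n))\<^sup>2" for n
      using f truncation_H2 by (simp add: taylor_coeff_diff taylor_coeff_truncation)
    ultimately show ?thesis
      using H2_hnorm_sums[OF H2.diff_mem[OF f truncation_H2], of N f]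
      by (auto simp: hnorm_truncation intro: sums_unique2)
  qed
  moreover have "(\<lambda>N. (hnorm H2 f)\<^sup>2 - (\<Sum>n<N. (cmod (taylor_coeff f n))\<^sup>2))
      \<longlonglongrightarrow> (hnorm H2 f)\<^sup>2 - (hnorm H2 f)\<^sup>2"
    using H2_hnorm_sums[OF f] unfolding sums_def by (intro tendsto_intros)
  ultimately have "(\<lambda>N. (hnorm H2 (\<lambda>z. f z - truncation N f z))\<^sup>2) \<longlonglongrightarrow> 0" by simp
  then have "(\<lambda>N. sqrt ((hnorm H2 (\<lambda>z. f z - truncation N f z))\<^sup>2)) \<longlonglongrightarrow> sqrt 0"
    by (rule tendsto_real_sqrt)
  then show ?thesis using f truncation_H2 by simp
qed

section \<open>Multiplication by an inner function\<close>

context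
  fixes \<phi> :: "complex \<Rightarrow> complex"
  assumes inner: "inner_function \<phi>"
begin

lemma inner_function_holomorphic: "\<phi> holomorphic_on ball 0 1"
  using inner by (simp add: inner_function_def)

lemma inner_function_bounded: "\<exists>C\<ge>0. \<forall>z. cmod z < 1 \<longrightarrow> cmod (\<phi> z) \<le> C"
proof -
  have "bounded (\<phi> ` ball 0 1)" using inner by (simp add: inner_function_def)
  then obtain C where "C > 0" "\<forall>x\<in>\<phi> ` ball 0 1. norm x \<le> C" using bounded_pos by blast
  then show ?thesis by (intro exI[of _ C]) auto
qed

lemma inner_mult_H2: "f \<in> vectors H2 \<Longrightarrow> (\<lambda>z. \<phi> z * f z) \<in> vectors H2"
  using inner_function_bounded bounded_multiplier_H2[OF inner_function_holomorphic] by blast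

text \<open>Against a polynomial, the integral over the circle of radius \<open>r\<close> converges as
  \<open>r\<close> tends to 1, by dominated convergence, and unimodularity removes \<open>\<phi>\<close> from the limit.\<close>

lemma hnorm_inner_mult_truncation:
  "hnorm H2 (\<lambda>z. \<phi> z * truncation N f z) = hnorm H2 (truncation N f)"
proof -
  interpret finite_measure circle by (rule finite_measure_circle)
  let ?f = "truncation N f"
  let ?g = "\<lambda>z. \<phi> z * ?f z"
  let ?z = "\<lambda>k t. complex_of_real (radius k) * cis t"
  have z: "cmod (?z k t) < 1" for k t using radius(1,2)[of k] by (simp add: norm_mult)
  obtain C where C: "C \<ge> 0" "\<And>z. cmod z < 1 \<Longrightarrow> cmod (\<phi> z) \<le> C"
    using inner_function_bounded by blast
  have g: "?g \<in> vectors H2" by (intro inner_mult_H2 truncation_H2)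
  have hg: "?g holomorphic_on ball 0 1" using g by (rule H2_holomorphic)
  define D where "D = (\<Sum>n<N. cmod (taylor_coeff f n))"
  let ?p = "\<lambda>t. \<Sum>n<N. taylor_coeff f n * cis t ^ n"
  have "(\<lambda>k. LINT t|circle. (cmod (?g (?z k t)))\<^sup>2) \<longlonglongrightarrow> (LINT t|circle. (cmod (?p t))\<^sup>2)"
  \<comment> \<open>\<open>C\<close> bounds \<phi> on the disk and \<open>D\<close>, the sum of the
    moduli of the coefficients, bounds the polynomial there.\<close>
  proof (rule integral_dominated_convergence[where w = "\<lambda>_. (C * D)\<^sup>2"])
    show "(\<lambda>t. (cmod (?p t))\<^sup>2) \<in> borel_measurable circle"
      by (intro circle_measurable continuous_intros)
    show "(\<lambda>t. (cmod (?g (?z k t)))\<^sup>2) \<in> borel_measurable circle" for k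
      by (intro circle_measurable continuous_on_power continuous_on_norm circle_continuous[OF hg radius(1,2)])
    have "norm ((cmod (?g (?z k t)))\<^sup>2) \<le> (C * D)\<^sup>2" for k t
    proof -
      have "cmod (?f (?z k t)) \<le> (\<Sum>n<N. cmod (taylor_coeff f n) * cmod (?z k t) ^ n)"
        unfolding truncation_eq[OF z]
        by (rule order_trans[OF norm_sum]) (simp add: norm_mult norm_power)
      also have "\<dots> \<le> D"
        unfolding D_def using z[of k t]
        by (intro sum_mono mult_left_le power_le_one) auto
      finally have "cmod (?g (?z k t)) \<le> C * D"
        unfolding norm_mult using C z by (intro mult_mono) auto
      then show ?thesis by (simp add: power_mono)
    qed
    then show "AE t in circle. norm ((cmod (?g (?z k t)))\<^sup>2) \<le> (C * D)\<^sup>2" for k by simp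
    have "AE t in circle. \<exists>l. cmod l = 1 \<and> ((\<lambda>r. \<phi> (of_real r * cis t)) \<longlongrightarrow> l) (at_left 1)"
      unfolding circle_def using inner
      by (subst AE_restrict_space_iff) (simp_all add: inner_function_def)
    then show "AE t in circle. (\<lambda>k. (cmod (?g (?z k t)))\<^sup>2) \<longlonglongrightarrow> (cmod (?p t))\<^sup>2"
    proof eventually_elim
      case (elim t)
      then obtain l where l: "cmod l = 1" "((\<lambda>r. \<phi> (of_real r * cis t)) \<longlongrightarrow> l) (at_left 1)"
        by blast
      have 1: "(\<lambda>k. \<phi> (?z k t)) \<longlonglongrightarrow> l"
        using filterlim_compose[OF l(2) radius_at_left] .
      have "(\<lambda>k. \<Sum>n<N. taylor_coeff f n * ?z k t ^ n)
          \<longlonglongrightarrow> (\<Sum>n<N. taylor_coeff f n * (of_real 1 * cis t) ^ n)"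
        using radius(3) by (intro tendsto_intros)
      then have "(\<lambda>k. ?f (?z k t)) \<longlonglongrightarrow> ?p t"
        by (simp add: truncation_eq[OF z])
      with 1 have "(\<lambda>k. (cmod (?g (?z k t)))\<^sup>2) \<longlonglongrightarrow> (cmod (l * ?p t))\<^sup>2"
        by (intro tendsto_intros)
      then show ?case using l(1) by (simp add: norm_mult)
    qed
  qed simp_all
  then have lim: "(\<lambda>k. LINT t|circle. (cmod (?g (?z k t)))\<^sup>2) \<longlonglongrightarrow> 2 * pi * (hnorm H2 ?f)\<^sup>2"
    unfolding Parseval_finite hnorm_truncation .
  \<comment> \<open>Both inequalities come from this one limit: no integral mean exceeds 2 * pi
    times the squared norm of \<open>?g\<close>, and the limit of the means bounds every partial
    coefficient sum of \<open>?g\<close>.\<close>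
  have "2 * pi * (hnorm H2 ?f)\<^sup>2 \<le> 2 * pi * (hnorm H2 ?g)\<^sup>2"
    using radius_integral_le[OF g radius(1,2)] by (intro LIMSEQ_le_const2[OF lim]) auto
  moreover have "2 * pi * (\<Sum>n<K. (cmod (taylor_coeff ?g n))\<^sup>2) \<le> 2 * pi * (hnorm H2 ?f)\<^sup>2" for K
    using taylor_coeff_bound_of_radius_integrals[OF hg radius lim] by simp
  then have "(hnorm H2 ?g)\<^sup>2 \<le> (hnorm H2 ?f)\<^sup>2"
    by (intro H2_hnorm_le[OF g]) simp
  ultimately have "(hnorm H2 ?g)\<^sup>2 = (hnorm H2 ?f)\<^sup>2" by simp
  then show ?thesis using g truncation_H2 by (simp add: power2_eq_iff_nonneg)
qed

text \<open>Both sides are continuous in f, the left one because \<phi> is a bounded multiplier, and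
  they agree on the dense set of truncations.\<close>

lemma hnorm_inner_mult:
  assumes f: "f \<in> vectors H2"
  shows "hnorm H2 (\<lambda>z. \<phi> z * f z) = hnorm H2 f"
proof -
  obtain C where C: "C \<ge> 0" "\<And>z. cmod z < 1 \<Longrightarrow> cmod (\<phi> z) \<le> C"
    using inner_function_bounded by blast
  have conv: "(\<lambda>N. hnorm H2 (X N)) \<longlonglongrightarrow> hnorm H2 x"
    if x: "x \<in> vectors H2" and X: "\<And>N. X N \<in> vectors H2"
      and lim: "(\<lambda>N. hnorm H2 (\<lambda>z. x z - X N z)) \<longlonglongrightarrow> 0" for x X
  proof -
    have "(\<lambda>N. hnorm H2 x - hnorm H2 (X N)) \<longlonglongrightarrow> 0"
      using H2.hnorm_triangle_diff[OF x X]
      by (intro tendsto_0_le[OF lim, where K = 1]) (auto intro!: always_eventually simp: x X)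
    from tendsto_diff[OF tendsto_const[of "hnorm H2 x"] this] show ?thesis by simp
  qed
  have "(\<lambda>N. hnorm H2 (\<lambda>z. \<phi> z * f z - \<phi> z * truncation N f z)) \<longlonglongrightarrow> 0"
  proof (rule tendsto_0_le[OF truncation_tendsto[OF f], where K = "\<bar>C\<bar>"], intro always_eventually allI)
    fix N
    have d: "(\<lambda>z. f z - truncation N f z) \<in> vectors H2" using f truncation_H2 by simp
    have "hnorm H2 (\<lambda>z. \<phi> z * (f z - truncation N f z)) \<le> \<bar>C\<bar> * hnorm H2 (\<lambda>z. f z - truncation N f z)"
      using inner_function_holomorphic C(2) d by (rule bounded_multiplier_hnorm)
    then show "norm (hnorm H2 (\<lambda>z. \<phi> z * f z - \<phi> z * truncation N f z))
        \<le> norm (hnorm H2 (\<lambda>z. f z - truncation N f z)) * \<bar>C\<bar>"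
      using H2.hnorm_nonneg[OF inner_mult_H2[OF d]] H2.hnorm_nonneg[OF d]
      by (simp add: right_diff_distrib mult.commute)
  qed
  then have "(\<lambda>N. hnorm H2 (\<lambda>z. \<phi> z * truncation N f z)) \<longlonglongrightarrow> hnorm H2 (\<lambda>z. \<phi> z * f z)"
    using f truncation_H2 by (intro conv inner_mult_H2)
  moreover have "(\<lambda>N. hnorm H2 (truncation N f)) \<longlonglongrightarrow> hnorm H2 f"
    using f truncation_H2 truncation_tendsto[OF f] by (intro conv)
  ultimately show ?thesis
    unfolding hnorm_inner_mult_truncation by (rule LIMSEQ_unique)
qed

text \<open>Polarization: equal norms of f, g and f + g give equal real parts; replacing f by -\<i>
  * f turns the imaginary part into a real part.\<close>

lemma cinner_inner_mult:
  assumes f: "f \<in> vectors H2" and g: "g \<in> vectors H2"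
  shows "cinner H2 (\<lambda>z. \<phi> z * f z) (\<lambda>z. \<phi> z * g z) = cinner H2 f g"
proof -
  have re: "Re (cinner H2 (\<lambda>z. \<phi> z * f z) (\<lambda>z. \<phi> z * g z)) = Re (cinner H2 f g)"
    if f: "f \<in> vectors H2" and g: "g \<in> vectors H2" for f g
    using H2.hnorm_add_power2[OF f g] H2.hnorm_add_power2[OF inner_mult_H2[OF f] inner_mult_H2[OF g]]
      hnorm_inner_mult[OF f] hnorm_inner_mult[OF g] hnorm_inner_mult[OF H2.add_mem[OF f g]]
    by (simp add: distrib_left)
  have "Re (cinner H2 (\<lambda>z. - \<i> * (\<phi> z * f z)) (\<lambda>z. \<phi> z * g z)) = Re (cinner H2 (\<lambda>z. - \<i> * f z) g)"
    using re[OF H2.scale_mem[OF f, of "- \<i>"] g] by (simp add: mult_ac)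
  then have "Im (cinner H2 (\<lambda>z. \<phi> z * f z) (\<lambda>z. \<phi> z * g z)) = Im (cinner H2 f g)"
    using H2.cinner_scale_left[OF f g, of "- \<i>"]
      H2.cinner_scale_left[OF inner_mult_H2[OF f] inner_mult_H2[OF g], of "- \<i>"]
    by simp
  then show ?thesis using re[OF f g] by (simp add: complex_eq_iff)
qed

end


section \<open>The space of an inner function\<close>

context inner_fspace
begin

lemma bounded_op_mem: "\<lbrakk>bounded_op H T; f \<in> vectors H\<rbrakk> \<Longrightarrow> T f \<in> vectors H"
  by (simp add: bounded_op_def)

lemma bounded_op_add:
  "\<lbrakk>bounded_op H T; f \<in> vectors H; g \<in> vectors H\<rbrakk> \<Longrightarrow> T (\<lambda>z. f z + g z) = (\<lambda>z. T f z + T g z)"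
  by (simp add: bounded_op_def)

lemma bounded_op_scale:
  "\<lbrakk>bounded_op H T; f \<in> vectors H\<rbrakk> \<Longrightarrow> T (\<lambda>z. c * f z) = (\<lambda>z. c * T f z)"
  by (simp add: bounded_op_def)

lemma bounded_op_diff:
  assumes "bounded_op H T" "f \<in> vectors H" "g \<in> vectors H"
  shows "T (\<lambda>z. f z - g z) = (\<lambda>z. T f z - T g z)"
  using bounded_op_add[of T f "\<lambda>z. (-1) * g z"] bounded_op_scale[of T g "-1"] scale_mem[of g "-1"]
    assms by simp

lemma positive_op_cinner:
  assumes "positive_op H T" "f \<in> vectors H"
  shows "0 \<le> Re (cinner H (T f) f)" "Im (cinner H (T f) f) = 0"
  using assms by (simp_all add: positive_op_def complex_nonneg_Reals_iff)

text \<open>\<open>positive_op\<close> speaks only of the quadratic form. Over the complex numbers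
  its being real at f + g and at f + \<i> * g already forces symmetry.\<close>

lemma positive_op_self_adjoint:
  assumes T: "positive_op H T" and f: "f \<in> vectors H" and g: "g \<in> vectors H"
  shows "cinner H (T f) g = cinner H f (T g)"
proof -
  have B: "bounded_op H T" using T by (simp add: positive_op_def)
  note T_mem = bounded_op_mem[OF B f] bounded_op_mem[OF B g]
  have ig: "(\<lambda>z. \<i> * g z) \<in> vectors H" using g by simp
  have expand: "cinner H (T (\<lambda>z. f z + h z)) (\<lambda>z. f z + h z)
      = cinner H (T f) f + cinner H (T f) h + (cinner H (T h) f + cinner H (T h) h)"
    if h: "h \<in> vectors H" for h
    unfolding bounded_op_add[OF B f h] using f h T_mem(1) bounded_op_mem[OF B h]
    by (simp add: cinner_add_left cinner_add_right)
  have "Im (cinner H (T f) h + cinner H (T h) f) = 0" if h: "h \<in> vectors H" for h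
    using positive_op_cinner(2)[OF T add_mem[OF f h]] positive_op_cinner(2)[OF T f]
      positive_op_cinner(2)[OF T h] unfolding expand[OF h] by simp
  \<comment> \<open>The instance at g compares imaginary parts, the one at \<i> * g real
    parts.\<close>
  from this[OF g] this[OF ig] have "cinner H (T f) g = cnj (cinner H (T g) f)"
    using f g T_mem
    by (simp add: bounded_op_scale[OF B] cinner_scale_left cinner_scale_right complex_eq_iff)
  then show ?thesis using cinner_commute[OF f T_mem(2)] by simp
qed

text \<open>On the kernel of \<open>P\<close> the root vanishes because \<open>\<parallel>T n\<parallel>\<^sup>2 = \<langle>P n, n\<rangle>\<close>; on its range,
  \<open>T p - p\<close> would be an eigenvector for the eigenvalue \<open>-1\<close>.\<close>

lemma positive_sqrt_of_projection:
  assumes T: "positive_op H T" and sq: "\<And>f. f \<in> vectors H \<Longrightarrow> T (T f) = P f"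
    and idem: "\<And>f. f \<in> vectors H \<Longrightarrow> P (P f) = P f" and f: "f \<in> vectors H"
  shows "T f = P f"
proof -
  have B: "bounded_op H T" using T by (simp add: positive_op_def)
  note T_mem = bounded_op_mem[OF B]
  define p where "p = P f"
  have p: "p \<in> vectors H" using T_mem[OF T_mem[OF f]] by (simp add: p_def sq f)
  define n where "n = (\<lambda>z. f z - p z)"
  have n: "n \<in> vectors H" using f p by (simp add: n_def)
  have Tn: "T n = (\<lambda>z. T f z - T p z)" unfolding n_def using B f p by (rule bounded_op_diff)
  have "T (T n) = (\<lambda>z. T (T f) z - T (T p) z)"
    unfolding Tn using B T_mem[OF f] T_mem[OF p] by (rule bounded_op_diff)
  then have TTn: "T (T n) = (\<lambda>z. 0)" using f p by (simp add: sq) (simp add: p_def idem f)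
  have "cinner H (T n) (T n) = cinner H (T (T n)) n"
    using positive_op_self_adjoint[OF T T_mem[OF n] n] by simp
  then have "cinner H (T n) (T n) = 0" using n by (simp add: TTn)
  then have "T n = (\<lambda>z. 0)" by (rule cinner_self_eq_0[OF T_mem[OF n]])
  then have Tfp: "T f = T p" unfolding Tn by (simp add: fun_eq_iff)
  define g where "g = (\<lambda>z. T p z - p z)"
  have g: "g \<in> vectors H" using p T_mem by (simp add: g_def)
  have "T g = (\<lambda>z. T (T p) z - T p z)"
    unfolding g_def using B T_mem[OF p] p by (rule bounded_op_diff)
  also have "\<dots> = (\<lambda>z. (-1) * g z)"
    using p by (simp add: sq g_def) (simp add: p_def idem f)
  finally have "cinner H (T g) g = - cinner H g g" using g cinner_scale_left[OF g g, of "-1"] by simp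
  then have "Re (cinner H g g) \<le> 0" using positive_op_cinner(1)[OF T g] by simp
  then have "hnorm H g = 0" using g cinner_self_nonneg[OF g] by (simp add: hnorm_def)
  then have "g = (\<lambda>z. 0)" using g hnorm_eq_0_iff by blast
  then show ?thesis using Tfp by (simp add: g_def p_def fun_eq_iff)
qed

end

section \<open>The projection onto the range of an inner function\<close>

definition monomial :: "nat \<Rightarrow> complex \<Rightarrow> complex" where
  "monomial n = disk_series (\<lambda>k. if k = n then 1 else 0)"

lemma monomial_H2: "monomial n \<in> vectors H2"
  and taylor_coeff_monomial: "taylor_coeff (monomial n) k = (if k = n then 1 else 0)"
proof -
  have "summable (\<lambda>k. (cmod (if k = n then 1 else 0))\<^sup>2)"
    by (rule summable_finite[of "{n}"]) auto
  then show "monomial n \<in> vectors H2" "taylor_coeff (monomial n) k = (if k = n then 1 else 0)"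
    unfolding monomial_def by (rule disk_series_H2, rule taylor_coeff_disk_series)
qed

lemma cinner_monomial:
  assumes f: "f \<in> vectors H2"
  shows "cinner H2 f (monomial n) = taylor_coeff f n"
proof -
  have "(\<lambda>k. taylor_coeff f k * cnj (taylor_coeff (monomial n) k))
      sums (\<Sum>k\<in>{n}. taylor_coeff f k * cnj (taylor_coeff (monomial n) k))"
    by (rule sums_finite) (auto simp: taylor_coeff_monomial)
  then show ?thesis
    using H2_cinner_sums[OF f monomial_H2[of n]] sums_unique2
    by (fastforce simp: taylor_coeff_monomial)
qed

lemma truncation_monomials: "truncation N f = (\<lambda>z. \<Sum>n<N. taylor_coeff f n * monomial n z)"
proof (rule H2_eqI[OF truncation_H2])
  show mem: "(\<lambda>z. \<Sum>n<N. taylor_coeff f n * monomial n z) \<in> vectors H2"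
    by (intro H2.sum_mem monomial_H2)
  fix k
  have "taylor_coeff (\<lambda>z. \<Sum>n<N. taylor_coeff f n * monomial n z) k
      = (\<Sum>n<N. taylor_coeff f n * cinner H2 (monomial n) (monomial k))"
    unfolding cinner_monomial[OF mem, symmetric] by (intro H2.cinner_sum_left monomial_H2)
  also have "\<dots> = (\<Sum>n<N. if k = n then taylor_coeff f n else 0)"
    by (intro sum.cong) (auto simp: cinner_monomial monomial_H2 taylor_coeff_monomial)
  finally show "taylor_coeff (truncation N f) k
      = taylor_coeff (\<lambda>z. \<Sum>n<N. taylor_coeff f n * monomial n z) k"
    by (simp add: taylor_coeff_truncation)
qed

context
  fixes \<phi> :: "complex \<Rightarrow> complex"
  assumes inner: "inner_function \<phi>"
begin

private abbreviation (input) "M \<equiv> (\<lambda>f z. \<phi> z * f z) ` vectors H2"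
private abbreviation (input) "P \<equiv> P_inner \<phi>"

lemma inner_range_subset: "M \<subseteq> vectors H2"
  using inner_mult_H2[OF inner] by blast

lemma inner_range_zero: "(\<lambda>z. 0) \<in> M"
  by (rule image_eqI[of _ _ "\<lambda>z. 0"]) simp_all

lemma inner_range_add: "\<lbrakk>f \<in> M; g \<in> M\<rbrakk> \<Longrightarrow> (\<lambda>z. f z + g z) \<in> M"
  by (auto simp: distrib_left[symmetric] intro!: image_eqI[OF refl])

lemma inner_range_scale: "f \<in> M \<Longrightarrow> (\<lambda>z. c * f z) \<in> M"
  by (auto simp: mult.left_commute[of c] intro!: image_eqI[OF refl])

lemma inner_range_diff: "\<lbrakk>f \<in> M; g \<in> M\<rbrakk> \<Longrightarrow> (\<lambda>z. f z - g z) \<in> M"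
  using inner_range_add[of f "\<lambda>z. (-1) * g z"] inner_range_scale[of g "-1"] by simp

text \<open>The products of \<phi> with the monomials are orthonormal. By Bessel's inequality the
  coefficients of f against them are square summable, hence are the Taylor coefficients of some h in
  \<open>H2\<close>, and \<phi> * h is the projection.\<close>

lemma inner_range_projection_ex:
  assumes f: "f \<in> vectors H2"
  shows "\<exists>g\<in>M. \<forall>h\<in>M. cinner H2 (\<lambda>z. f z - g z) h = 0"
proof -
  define e where "e n = (\<lambda>z. \<phi> z * monomial n z)" for n
  define a where "a n = cinner H2 f (e n)" for n
  have e: "e n \<in> vectors H2" for n
    unfolding e_def by (intro inner_mult_H2 inner monomial_H2)
  have orth: "cinner H2 (e n) (e m) = (if n = m then 1 else 0)" for n m
    unfolding e_def using cinner_inner_mult[OF inner monomial_H2 monomial_H2]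
    by (simp add: cinner_monomial monomial_H2 taylor_coeff_monomial)
  have "(\<Sum>n<N. (cmod (a n))\<^sup>2) \<le> (hnorm H2 f)\<^sup>2" for N
    unfolding a_def using e orth f by (intro H2.Bessel_inequality) auto
  then have a: "summable (\<lambda>n. (cmod (a n))\<^sup>2)"
    by (intro summableI_nonneg_bounded) auto
  define h where "h = disk_series a"
  have h: "h \<in> vectors H2" unfolding h_def using a by (rule disk_series_H2)
  define d where "d = (\<lambda>z. f z - \<phi> z * h z)"
  have \<phi>h: "(\<lambda>z. \<phi> z * h z) \<in> vectors H2" using inner h by (rule inner_mult_H2)
  have d: "d \<in> vectors H2" unfolding d_def using f \<phi>h by (rule H2.diff_mem)
  have de: "cinner H2 d (e n) = 0" for n
  proof -
    have "cinner H2 (\<lambda>z. \<phi> z * h z) (e n) = a n"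
      unfolding e_def using cinner_inner_mult[OF inner h monomial_H2] taylor_coeff_disk_series[OF a]
      by (simp add: cinner_monomial h) (simp add: h_def)
    then show ?thesis
      unfolding d_def using H2.cinner_diff_left[OF f \<phi>h e] by (simp add: a_def)
  qed
  \<comment> \<open>The residual is orthogonal to \<phi> times each truncation of g; Cauchy-Schwarz
    and the isometry bound what remains by the truncation error.\<close>
  have "cinner H2 d (\<lambda>z. \<phi> z * g z) = 0" if g: "g \<in> vectors H2" for g
  proof -
    have le: "cmod (cinner H2 d (\<lambda>z. \<phi> z * g z)) \<le> hnorm H2 d * hnorm H2 (\<lambda>z. g z - truncation N g z)" for N
    proof -
      let ?t = "truncation N g"
      note t = truncation_H2[of N g]
      have "(\<lambda>z. \<phi> z * ?t z) = (\<lambda>z. \<Sum>n<N. taylor_coeff g n * e n z)"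
        by (simp add: truncation_monomials e_def sum_distrib_left mult.left_commute)
      then have "cinner H2 d (\<lambda>z. \<phi> z * ?t z) = (\<Sum>n<N. cnj (taylor_coeff g n) * cinner H2 d (e n))"
        using H2.cinner_sum_right[OF e d] by simp
      then have "cinner H2 d (\<lambda>z. \<phi> z * ?t z) = 0" by (simp add: de)
      then have "cinner H2 d (\<lambda>z. \<phi> z * g z) = cinner H2 d (\<lambda>z. \<phi> z * g z - \<phi> z * ?t z)"
        using H2.cinner_diff_right[OF inner_mult_H2[OF inner g] inner_mult_H2[OF inner t] d] by simp
      also have "(\<lambda>z. \<phi> z * g z - \<phi> z * ?t z) = (\<lambda>z. \<phi> z * (g z - ?t z))"
        by (simp add: right_diff_distrib)
      finally show ?thesis
        using H2.Cauchy_Schwarz[OF d inner_mult_H2[OF inner H2.diff_mem[OF g t]]]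
        by (simp only: hnorm_inner_mult[OF inner H2.diff_mem[OF g t]])
    qed
    have "(\<lambda>N. hnorm H2 d * hnorm H2 (\<lambda>z. g z - truncation N g z)) \<longlonglongrightarrow> hnorm H2 d * 0"
      by (intro tendsto_intros truncation_tendsto g)
    then have "cmod (cinner H2 d (\<lambda>z. \<phi> z * g z)) \<le> hnorm H2 d * 0"
      using le by (intro LIMSEQ_le_const) auto
    then show ?thesis by simp
  qed
  then show ?thesis
    unfolding d_def using h by (intro bexI[of _ "\<lambda>z. \<phi> z * h z"]) auto
qed

lemma P_inner_eqI:
  assumes f: "f \<in> vectors H2" and g: "g \<in> M"
    and orth: "\<And>h. h \<in> M \<Longrightarrow> cinner H2 (\<lambda>z. f z - g z) h = 0"
  shows "P f = g"
  unfolding P_inner_def orth_proj_def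
proof (rule the_equality)
  show "g \<in> M \<and> (\<forall>h\<in>M. cinner H2 (\<lambda>z. f z - g z) h = 0)" using g orth by blast
  fix g' assume g': "g' \<in> M \<and> (\<forall>h\<in>M. cinner H2 (\<lambda>z. f z - g' z) h = 0)"
  let ?x = "\<lambda>z. g' z - g z"
  have x: "?x \<in> M" using g' g by (intro inner_range_diff) auto
  have mem: "g \<in> vectors H2" "g' \<in> vectors H2" "?x \<in> vectors H2"
    using g g' x inner_range_subset by blast+
  have "cinner H2 (\<lambda>z. f z - g' z) ?x = 0" using g' x by blast
  then have "cinner H2 (\<lambda>z. f z - g z) ?x - cinner H2 (\<lambda>z. f z - g' z) ?x = 0"
    using orth[OF x] by simp
  then have "cinner H2 g' ?x - cinner H2 g ?x = 0"
    using f mem by (simp only: H2.cinner_diff_left) simp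
  then have "cinner H2 ?x ?x = 0"
    using mem by (simp only: H2.cinner_diff_left)
  then have "?x = (\<lambda>z. 0)" using H2.cinner_self_eq_0[OF mem(3)] by blast
  then show "g' = g" by (simp add: fun_eq_iff)
qed

lemma P_inner_props:
  assumes f: "f \<in> vectors H2"
  shows "P f \<in> M" "h \<in> M \<Longrightarrow> cinner H2 (\<lambda>z. f z - P f z) h = 0"
proof -
  obtain g where g: "g \<in> M" "\<And>h. h \<in> M \<Longrightarrow> cinner H2 (\<lambda>z. f z - g z) h = 0"
    using inner_range_projection_ex[OF f] by blast
  then have "P f = g" using f by (intro P_inner_eqI)
  then show "P f \<in> M" "h \<in> M \<Longrightarrow> cinner H2 (\<lambda>z. f z - P f z) h = 0" using g by auto
qed

lemma P_inner_mem: "f \<in> vectors H2 \<Longrightarrow> P f \<in> vectors H2"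
  using P_inner_props(1) inner_range_subset by blast

lemma P_inner_id: "g \<in> M \<Longrightarrow> P g = g"
  using inner_range_subset by (intro P_inner_eqI) auto

lemma cinner_P_inner:
  assumes f: "f \<in> vectors H2" and h: "h \<in> M"
  shows "cinner H2 (P f) h = cinner H2 f h"
  using P_inner_props(2)[OF f h] H2.cinner_diff_left[OF f P_inner_mem[OF f]] h inner_range_subset
  by auto

lemma positive_op_P_inner: "positive_op H2 P"
  unfolding positive_op_def bounded_op_def
proof (intro conjI ballI allI)
  fix f assume f: "f \<in> vectors H2"
  note Pf = P_inner_mem[OF f]
  show "P f \<in> vectors H2" by (rule Pf)
  show "P (\<lambda>z. f z + g z) = (\<lambda>z. P f z + P g z)" if g: "g \<in> vectors H2" for g
  proof (rule P_inner_eqI)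
    note Pg = P_inner_mem[OF g]
    show "(\<lambda>z. P f z + P g z) \<in> M" using f g by (intro inner_range_add P_inner_props)
    show "cinner H2 (\<lambda>z. (f z + g z) - (P f z + P g z)) h = 0" if h: "h \<in> M" for h
    proof -
      have "h \<in> vectors H2" using h inner_range_subset by blast
      then show ?thesis
        using f g Pf Pg cinner_P_inner[OF f h] cinner_P_inner[OF g h]
        by (simp add: H2.cinner_diff_left H2.cinner_add_left)
    qed
  qed (use f g in simp)
  show "P (\<lambda>z. c * f z) = (\<lambda>z. c * P f z)" for c
  proof (rule P_inner_eqI)
    show "(\<lambda>z. c * P f z) \<in> M" using f by (intro inner_range_scale P_inner_props)
    show "cinner H2 (\<lambda>z. c * f z - c * P f z) h = 0" if h: "h \<in> M" for h
    proof -
      have "h \<in> vectors H2" using h inner_range_subset by blast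
      then show ?thesis
        using f Pf cinner_P_inner[OF f h] by (simp add: H2.cinner_diff_left H2.cinner_scale_left)
    qed
  qed (use f in simp)
  have "cinner H2 (P f) f = cnj (cinner H2 f (P f))" using f Pf by (intro H2.cinner_commute)
  also have "\<dots> = of_real ((hnorm H2 (P f))\<^sup>2)"
    unfolding cinner_P_inner[OF f P_inner_props(1)[OF f], symmetric] H2.cinner_self[OF Pf] by simp
  finally show "cinner H2 (P f) f \<in> \<real>\<^sub>\<ge>\<^sub>0"
    by (simp only: nonneg_Reals_of_real_iff zero_le_power2)
next
  show "\<exists>C. \<forall>f\<in>vectors H2. hnorm H2 (P f) \<le> C * hnorm H2 f"
  proof (intro exI[of _ 1] ballI)
    fix f assume f: "f \<in> vectors H2"
    note Pf = P_inner_mem[OF f]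
    have "complex_of_real ((hnorm H2 (P f))\<^sup>2) = cinner H2 f (P f)"
      using cinner_P_inner[OF f P_inner_props(1)[OF f]] Pf by (simp add: H2.cinner_self)
    then have "(hnorm H2 (P f))\<^sup>2 = cmod (cinner H2 f (P f))"
      by (metis abs_of_nonneg norm_of_real zero_le_power2)
    then have "hnorm H2 (P f) * hnorm H2 (P f) \<le> hnorm H2 f * hnorm H2 (P f)"
      using H2.Cauchy_Schwarz[OF f Pf] by (simp add: power2_eq_square)
    then show "hnorm H2 (P f) \<le> 1 * hnorm H2 f"
      using H2.hnorm_nonneg[OF Pf] H2.hnorm_nonneg[OF f]
      by (cases "hnorm H2 (P f) = 0") (auto simp: mult_le_cancel_right)
  qed
qed

text \<open>A projection is its own positive root. The restriction appears because
  \<open>op_sqrt\<close> selects an extensional function.\<close>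

lemma op_sqrt_P_inner: "op_sqrt H2 P = restrict P (vectors H2)"
  unfolding op_sqrt_def
proof (rule the_equality)
  have "positive_op H2 (restrict P (vectors H2))"
    using positive_op_P_inner unfolding positive_op_def bounded_op_def by simp
  then show "restrict P (vectors H2) \<in> extensional (vectors H2) \<and> positive_op H2 (restrict P (vectors H2)) \<and>
      (\<forall>f\<in>vectors H2. restrict P (vectors H2) (restrict P (vectors H2) f) = P f)"
    by (auto simp: P_inner_mem P_inner_id P_inner_props)
  fix Q assume Q: "Q \<in> extensional (vectors H2) \<and> positive_op H2 Q \<and> (\<forall>f\<in>vectors H2. Q (Q f) = P f)"
  have "Q f = P f" if "f \<in> vectors H2" for f
  proof (rule H2.positive_sqrt_of_projection[OF _ _ _ that])
    show "positive_op H2 Q" "\<And>f. f \<in> vectors H2 \<Longrightarrow> Q (Q f) = P f" using Q by blast+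
    show "P (P f) = P f" if "f \<in> vectors H2" for f
      using that by (intro P_inner_id P_inner_props(1))
  qed
  then show "Q = restrict P (vectors H2)"
    using Q by (intro extensionalityI[of Q "vectors H2"]) auto
qed

section \<open>The space of the projection and its kernel functions\<close>

lemma vectors_HP: "vectors (HP P) = M"
proof -
  have "P ` vectors H2 = M"
  proof (rule equalityI)
    show "P ` vectors H2 \<subseteq> M" using P_inner_props(1) by (rule image_subsetI)
    show "M \<subseteq> P ` vectors H2"
    proof
      fix g assume g: "g \<in> M"
      then show "g \<in> P ` vectors H2"
        using inner_range_subset by (intro image_eqI[of g P g] P_inner_id[symmetric]) blast+
    qed
  qed
  then show ?thesis by (simp add: HP_def op_sqrt_P_inner)
qed

text \<open>A vector y of the range is its own preimage orthogonal to the kernel of the projection,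
  so the range norm is the inherited norm.\<close>

lemma cinner_HP:
  assumes y: "y \<in> M" "y' \<in> M"
  shows "cinner (HP P) y y' = cinner H2 y y'"
proof -
  have "range_preimage (restrict P (vectors H2)) y = y" if y: "y \<in> M" for y
    unfolding range_preimage_def
  proof (rule the_equality)
    have yH: "y \<in> vectors H2" using y inner_range_subset by blast
    have "cinner H2 y g = 0" if g: "g \<in> vectors H2" "P g = (\<lambda>z. 0)" for g
      using cinner_P_inner[OF g(1) y] H2.cinner_commute[OF yH g(1)] yH by (simp add: g(2))
    then show "y \<in> vectors H2 \<and> restrict P (vectors H2) y = y \<and>
        (\<forall>g\<in>vectors H2. restrict P (vectors H2) g = (\<lambda>z. 0) \<longrightarrow> cinner H2 y g = 0)"
      using yH P_inner_id[OF y] by simp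
    fix x assume x: "x \<in> vectors H2 \<and> restrict P (vectors H2) x = y \<and>
        (\<forall>g\<in>vectors H2. restrict P (vectors H2) g = (\<lambda>z. 0) \<longrightarrow> cinner H2 x g = 0)"
    then have xH: "x \<in> vectors H2" and Px: "P x = y" by auto
    \<comment> \<open>The difference of two candidate preimages lies in the kernel, and both are
      orthogonal to the kernel, so it is orthogonal to itself.\<close>
    let ?g = "\<lambda>z. x z - y z"
    have g: "?g \<in> vectors H2" using xH yH by simp
    have "P ?g = (\<lambda>z. 0)"
      using g inner_range_zero P_inner_props(2)[OF xH] by (intro P_inner_eqI) (auto simp: Px)
    then have "cinner H2 x ?g = 0" using x g by simp
    moreover have "cinner H2 y ?g = 0"
      using P_inner_props(2)[OF xH y] H2.cinner_commute[OF yH g] by (simp add: Px)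
    ultimately have "cinner H2 ?g ?g = 0" using H2.cinner_diff_left[OF xH yH g] by simp
    then have "?g = (\<lambda>z. 0)" by (rule H2.cinner_self_eq_0[OF g])
    then show "x = y" by (simp add: fun_eq_iff)
  qed
  then show ?thesis using y by (simp add: HP_def op_sqrt_P_inner)
qed

lemma hnorm_HP: "y \<in> M \<Longrightarrow> hnorm (HP P) y = hnorm H2 y"
  by (simp add: hnorm_def cinner_HP)

text \<open>Completeness is pulled back along the isometry g \<mapsto> \<phi> * g: a Cauchy sequence
  in the range comes from a Cauchy sequence in \<open>H2\<close>, and the limit there is mapped
  forward.\<close>

lemma hilbert_fspace_HP: "hilbert_fspace (HP P)"
proof -
  note sub = subsetD[OF inner_range_subset]
  show ?thesis
  proof (unfold_locales, unfold vectors_HP)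
    fix f g h :: "complex \<Rightarrow> complex" and c :: complex
    show "(\<lambda>z. 0) \<in> M" by (rule inner_range_zero)
    assume f: "f \<in> M"
    show "(\<lambda>z. c * f z) \<in> M" using f by (rule inner_range_scale)
    show "0 \<le> Re (cinner (HP P) f f)" using f sub by (simp add: cinner_HP H2.cinner_self_nonneg)
    show "f = (\<lambda>z. 0)" if "cinner (HP P) f f = 0"
      using H2.cinner_self_eq_0[OF sub[OF f]] that f by (simp add: cinner_HP)
    show "cinner (HP P) (\<lambda>z. c * f z) h = c * cinner (HP P) f h" if h: "h \<in> M"
      using H2.cinner_scale_left[OF sub[OF f] sub[OF h]] cinner_HP[OF f h]
        cinner_HP[OF inner_range_scale[OF f] h] by simp
    assume g: "g \<in> M"
    show "(\<lambda>z. f z + g z) \<in> M" using f g by (rule inner_range_add)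
    show "cinner (HP P) f g = cnj (cinner (HP P) g f)"
      using H2.cinner_commute[OF sub[OF f] sub[OF g]] cinner_HP[OF f g] cinner_HP[OF g f] by simp
    show "cinner (HP P) (\<lambda>z. f z + g z) h = cinner (HP P) f h + cinner (HP P) g h" if h: "h \<in> M"
      using H2.cinner_add_left[OF sub[OF f] sub[OF g] sub[OF h]] cinner_HP[OF f h] cinner_HP[OF g h]
        cinner_HP[OF inner_range_add[OF f g] h] by simp
  next
    fix X :: "nat \<Rightarrow> complex \<Rightarrow> complex"
    assume X: "\<And>n. X n \<in> M"
      and Cau: "\<And>e. e > 0 \<Longrightarrow> \<exists>N. \<forall>m\<ge>N. \<forall>n\<ge>N. hnorm (HP P) (\<lambda>z. X m z - X n z) < e"
    have "\<forall>n. \<exists>y. y \<in> vectors H2 \<and> X n = (\<lambda>z. \<phi> z * y z)" using X by blast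
    then obtain Y where Y: "\<And>n. Y n \<in> vectors H2" "\<And>n. X n = (\<lambda>z. \<phi> z * Y n z)" by metis
    have diff: "hnorm (HP P) (\<lambda>z. X m z - \<phi> z * y z) = hnorm H2 (\<lambda>z. Y m z - y z)"
      if y: "y \<in> vectors H2" for m y
    proof -
      have "hnorm (HP P) (\<lambda>z. X m z - \<phi> z * y z) = hnorm H2 (\<lambda>z. X m z - \<phi> z * y z)"
        using X y by (intro hnorm_HP inner_range_diff) auto
      also have "\<dots> = hnorm H2 (\<lambda>z. \<phi> z * (Y m z - y z))"
        by (simp add: Y(2) right_diff_distrib)
      also have "\<dots> = hnorm H2 (\<lambda>z. Y m z - y z)"
        using Y(1) y by (intro hnorm_inner_mult inner H2.diff_mem)
      finally show ?thesis .
    qed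
    have "hnorm (HP P) (\<lambda>z. X m z - X n z) = hnorm H2 (\<lambda>z. Y m z - Y n z)" for m n
      using diff[OF Y(1), of m n] by (simp only: Y(2)[of n])
    then obtain l where l: "l \<in> vectors H2" "(\<lambda>n. hnorm H2 (\<lambda>z. Y n z - l z)) \<longlonglongrightarrow> 0"
      using H2.complete[of Y] Y(1) Cau by auto
    then show "\<exists>l\<in>M. (\<lambda>n. hnorm (HP P) (\<lambda>z. X n z - l z)) \<longlonglongrightarrow> 0"
      using diff[OF l(1)] by (intro bexI[of _ "\<lambda>z. \<phi> z * l z"]) auto
  qed
qed

text \<open>For f = \<phi> * g, the value f(w) = \<phi>(w) * g(w) is the pairing of g with the Szego
  kernel scaled by the conjugate of \<phi>(w); the isometry moves this pairing into the
  range.\<close>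

lemma kernel_fun_HP:
  assumes w: "cmod w < 1"
  shows "kernel_fun (HP P) w = (\<lambda>z. \<phi> z * (cnj (\<phi> w) * szego_kernel w z))" (is "_ = ?k")
  unfolding kernel_fun_def
proof (rule the_equality)
  interpret K: hilbert_fspace "HP P" by (rule hilbert_fspace_HP)
  note kw = szego_kernel_H2[OF w]
  have cw: "(\<lambda>z. cnj (\<phi> w) * szego_kernel w z) \<in> vectors H2" using kw by simp
  then have k: "?k \<in> M" by (rule image_eqI[rotated]) simp
  have rep: "f w = cinner (HP P) f ?k" if f: "f \<in> M" for f
  proof -
    obtain g where g: "g \<in> vectors H2" "f = (\<lambda>z. \<phi> z * g z)" using f by blast
    have "cinner (HP P) f ?k = cinner H2 g (\<lambda>z. cnj (\<phi> w) * szego_kernel w z)"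
      using cinner_HP[OF f k] cinner_inner_mult[OF inner g(1) cw] by (simp add: g(2))
    also have "\<dots> = \<phi> w * g w"
      using H2.cinner_scale_right[OF kw g(1)] szego_kernel_reproducing[OF w g(1)] by simp
    finally show ?thesis by (simp add: g(2))
  qed
  then show "?k \<in> vectors (HP P) \<and> (\<forall>f\<in>vectors (HP P). f w = cinner (HP P) f ?k)"
    using k by (simp add: vectors_HP)
  fix k' assume k': "k' \<in> vectors (HP P) \<and> (\<forall>f\<in>vectors (HP P). f w = cinner (HP P) f k')"
  let ?x = "\<lambda>z. k' z - ?k z"
  have kV: "?k \<in> vectors (HP P)" using k by (simp add: vectors_HP)
  have x: "?x \<in> vectors (HP P)" using k' kV by (intro K.diff_mem) auto
  have "cinner (HP P) ?x ?x = cinner (HP P) ?x k' - cinner (HP P) ?x ?k"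
    using k' kV x by (intro K.cinner_diff_right) auto
  also have "cinner (HP P) ?x k' = ?x w" using k' x by (metis (no_types, lifting))
  also have "cinner (HP P) ?x ?k = ?x w" using x unfolding vectors_HP by (rule rep[symmetric])
  also have "?x w - ?x w = 0" by simp
  finally have "?x = (\<lambda>z. 0)" by (rule K.cinner_self_eq_0[OF x])
  then show "k' = ?k" by (simp add: fun_eq_iff)
qed

lemma cinner_kernel_fun_HP:
  assumes v: "cmod v < 1" and w: "cmod w < 1"
  shows "kernel_fun (HP P) v \<in> vectors (HP P)"
    and "cinner (HP P) (kernel_fun (HP P) w) (kernel_fun (HP P) v)
      = \<phi> v * cnj (\<phi> w) / (1 - v * cnj w)"
proof -
  have cx: "(\<lambda>z. cnj (\<phi> x) * szego_kernel x z) \<in> vectors H2" if "cmod x < 1" for x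
    using szego_kernel_H2[OF that] by simp
  have mem: "kernel_fun (HP P) x \<in> M" if "cmod x < 1" for x
    using cx[OF that] by (simp add: kernel_fun_HP[OF that])
  show "kernel_fun (HP P) v \<in> vectors (HP P)" using mem[OF v] by (simp add: vectors_HP)
  have "cinner (HP P) (kernel_fun (HP P) w) (kernel_fun (HP P) v)
      = cinner H2 (\<lambda>z. cnj (\<phi> w) * szego_kernel w z) (\<lambda>z. cnj (\<phi> v) * szego_kernel v z)"
    using cinner_HP[OF mem[OF w] mem[OF v]] cinner_inner_mult[OF inner cx[OF w] cx[OF v]]
    by (simp add: kernel_fun_HP v w)
  also have "\<dots> = \<phi> v * (cnj (\<phi> w) * szego_kernel w v)"
    using H2.cinner_scale_right[OF szego_kernel_H2[OF v] cx[OF w]]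
      szego_kernel_reproducing[OF v cx[OF w]] by simp
  finally show "cinner (HP P) (kernel_fun (HP P) w) (kernel_fun (HP P) v)
      = \<phi> v * cnj (\<phi> w) / (1 - v * cnj w)"
    by (simp add: szego_kernel_eq[OF w v])
qed

lemma hnorm_kernel_fun_HP:
  assumes w: "cmod w < 1"
  shows "hnorm (HP P) (kernel_fun (HP P) w) = cmod (\<phi> w) / sqrt (1 - (cmod w)\<^sup>2)"
proof -
  have "\<phi> w * cnj (\<phi> w) / (1 - w * cnj w) = of_real ((cmod (\<phi> w))\<^sup>2 / (1 - (cmod w)\<^sup>2))"
    by (simp only: complex_norm_square[symmetric] of_real_divide of_real_diff of_real_1)
  then show ?thesis
    by (simp add: hnorm_def cinner_kernel_fun_HP(2)[OF w w] real_sqrt_divide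
        del: of_real_divide of_real_power)
qed

text \<open>The moduli of \<phi> cancel in the normalization, leaving a Szego entry and two phases.
  At a zero of \<phi> both sides are 0, by the convention for division by 0.\<close>

lemma cinner_normalized_kernel_HP:
  fixes w :: "'i \<Rightarrow> complex"
  assumes i: "cmod (w i) < 1" and j: "cmod (w j) < 1"
  shows "cinner (HP P) (normalized_kernel (HP P) (w j)) (normalized_kernel (HP P) (w i))
    = (cnj (\<phi> (w j)) / of_real (cmod (\<phi> (w j)))) * cnj (cnj (\<phi> (w i)) / of_real (cmod (\<phi> (w i))))
      * szego_gram w i j"
proof -
  interpret K: hilbert_fspace "HP P" by (rule hilbert_fspace_HP)
  let ?n = "\<lambda>x. of_real (hnorm (HP P) (kernel_fun (HP P) x)) :: complex"
  have nk: "normalized_kernel (HP P) x = (\<lambda>z. inverse (?n x) * kernel_fun (HP P) x z)" for x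
    by (simp add: normalized_kernel_def divide_inverse mult.commute)
  have "cinner (HP P) (normalized_kernel (HP P) (w j)) (normalized_kernel (HP P) (w i))
      = inverse (?n (w j)) * inverse (?n (w i)) * (\<phi> (w i) * cnj (\<phi> (w j)) / (1 - w i * cnj (w j)))"
    unfolding nk using cinner_kernel_fun_HP[OF i j] cinner_kernel_fun_HP(1)[OF j i]
    by (simp add: K.cinner_scale_left K.cinner_scale_right)
  then show ?thesis
    unfolding hnorm_kernel_fun_HP[OF i] hnorm_kernel_fun_HP[OF j]
    by (simp add: szego_gram_def field_simps)
qed

end

theorem theorem5p3:
  fixes \<phi> :: "complex \<Rightarrow> complex"
  assumes "inner_function \<phi>"
  shows "satisfies_FCKF TYPE('i) (HP (P_inner \<phi>))"
  unfolding satisfies_FCKF_def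
proof (intro allI impI)
  fix J :: "'i set" and w :: "'i \<Rightarrow> complex"
  let ?H = "HP (P_inner \<phi>)"
  let ?u = "\<lambda>i. cnj (\<phi> (w i)) / of_real (cmod (\<phi> (w i)))"
  assume w: "\<forall>i\<in>J. w i \<in> ball 0 1 \<and> kernel_fun ?H (w i) \<noteq> (\<lambda>z. 0)"
    and bessel: "bessel_sequence ?H J (\<lambda>i. normalized_kernel ?H (w i))"
  interpret hilbert_fspace ?H using assms by (rule hilbert_fspace_HP)
  have disk: "cmod (w i) < 1" if "i \<in> J" for i using w that by simp
  show "\<exists>\<A>. finite \<A> \<and> partition_on J \<A> \<and>
      (\<forall>A\<in>\<A>. riesz_basic_sequence ?H A (\<lambda>i. normalized_kernel ?H (w i)))"
  proof (rule szego_bessel_partition[OF _ _ _ bessel])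
    show "cmod (w i) < 1" if "i \<in> J" for i using that by (rule disk)
    show "cmod (?u i) = 1" if "i \<in> J" for i
    proof -
      \<comment> \<open>The kernel function at \<open>w i\<close> carries the factor
        \<open>cnj (\<phi> (w i))\<close>, so its being nonzero makes the phase unimodular.\<close>
      have "\<phi> (w i) \<noteq> 0"
        using w that kernel_fun_HP[OF assms disk[OF that]] by auto
      then show ?thesis by (simp add: norm_divide)
    qed
    show "cinner ?H (normalized_kernel ?H (w j)) (normalized_kernel ?H (w i))
        = ?u j * cnj (?u i) * szego_gram w i j" if "i \<in> J" "j \<in> J" for i j
      using assms disk[OF that(1)] disk[OF that(2)] by (rule cinner_normalized_kernel_HP)
  qed
qed

end
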